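(* Let $X$ be a real Banach space and let $I_0\in\mathcal{I}$ be a closed non-degenerate interval in $\mathbb{R}^m$. Let $f:I_0\to X$ be a function and let $F:\mathcal{I}_{I_0}\to X$ be an additive interval function. Then the following statements are equivalent: (i) $f$ is Dunford integrable, and $f$ is Dunford-Henstock-Kurzweil integrable on $I_0$ with the primitive $F$; (ii) $f$ is Dunford-McShane integrable on $I_0$ with the primitive $F$.
   Context: $\mathbb{R}^m$ carries the maximum norm; $B_m(t,r)$ is the open ball with center $t$ and radius $r>0$; $|A|$ is the Lebesgue measure of $A$; $E^{o}$ is the interior of $E$; $X^{*}$ is the dual of $X$. Intervals. A closed non-degenerate interval in $\mathbb{R}^m$ is a set $\prod_{j=1}^m[a_j,b_j]$ with $-\infty<a_j<b_j<+\infty$ for all $j$. $\mathcal{I}$ is the family of all of them, and $\mathcal{I}_E$ is the family of those contained in $E$. Intervals $I,J$ are non-overlapping if $I^{o}\cap J^{o}=\emptyset$. A function $F:\mathcal{I}_E\to X$ is an additive interval function if $F(I\cup J)=F(I)+F(J)$ whenever $I,J\in\mathcal{I}_E$ are non-overlapping and $I\cup J\in\mathcal{I}_E$. Partitions. An $\mathcal{M}$-partition in $E$ is a finite collection of pairs $(t_i,I_i)$, $i=1,\dots,p$, with $t_i\in E$, $I_i\in\mathcal{I}_E$ and the $I_i$ pairwise non-overlapping (it is not required that $t_i\in I_i$). An $\mathcal{HK}$-partition in $E$ is an $\mathcal{M}$-partition in $E$ with $t_i\in I_i$ for all $i$. A partition is $Z$-tagged if all $t_i\in Z$. A gauge on $Z$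 is a function $\delta:Z\to(0,+\infty)$; a partition with tags in the domain of $\delta$ is $\delta$-fine if $I_i\subset B_m(t_i,\delta(t_i))$ for all $i$. Divisions. Let $E\subset\mathbb{R}^m$ be bounded and Lebesgue measurable with $E^{o}\neq\emptyset$. $\mathscr{P}_E$ is the family of all divisions in $E$, i.e. sequences $(I_k)_{k\ge1}$ of pairwise non-overlapping intervals in $\mathcal{I}_E$. $\mathscr{D}_E$ is the family of all divisions of $E$, i.e. those $(I_k)\in\mathscr{P}_E$ with $E=\bigcup_{k=1}^{\infty}I_k$. (The same notation is used for $E^{o}$.) Dunford-function. An additive interval function $F:\mathcal{I}_E\to X$ is a Dunford-function if for every $(I_k)\in\mathscr{P}_E$: (a) the series $\sum_{k:|I\cap I_k|>0}F(I\cap I_k)$ is unconditionally convergent in $X$ for each $I\in\mathcal{I}$; and (b) if $(I_k)\in\mathscr{D}_{E^{o}}$, then $F(I)=\sum_{k:|I\cap I_k|>0}F(I\cap I_k)$ for all $I\in\mathcal{I}_E$. Negligible variation. An additive interval function $F:\mathcal{I}_E\to X$ has $\mathcal{M}$-negligible (respectively $\mathcal{HK}$-negligible) variation over $Z\subset\mathbb{R}^m$ if for each $\varepsilon>0$ there is a gauge $\delta_\varepsilon$ on $Z$ such that for each $Z$-tagged $\delta_\varepsilon$-fine $\mathcal{M}$-partition (respectively $\mathcal{HK}$-partition) $\pi$ in $\mathbb{R}^m$ and every $(I_k)\in\mathscr{D}_{E^{o}}$: the series $\sum_{k:|I\cap I_k|>0}F(I\cap I_k)$ is unconditionally convergent in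 $X$ for each $(t,I)\in\pi$, and $\big\|\sum_{(t,I)\in\pi}\big(\sum_{k:|I\cap I_k|>0}F(I\cap I_k)\big)\big\|<\varepsilon$. $F$ has such negligible variation outside of $E^{o}$ if it has it over $\mathbb{R}^m\setminus E^{o}$. Dunford-McShane and Dunford-Henstock-Kurzweil integrals. $f:E\to X$ is Dunford-McShane (respectively Dunford-Henstock-Kurzweil) integrable on $E$ with the primitive $F:\mathcal{I}_E\to X$ if: for each $\varepsilon>0$ there is a gauge $\delta_\varepsilon$ on $E^{o}$ such that $\|\sum_{(t,I)\in\pi}(f(t)|I|-F(I))\|<\varepsilon$ for each $\delta_\varepsilon$-fine $\mathcal{M}$-partition (respectively $\mathcal{HK}$-partition) $\pi$ in $E^{o}$; $F$ is a Dunford-function; and $F$ has $\mathcal{M}$-negligible (respectively $\mathcal{HK}$-negligible) variation outside of $E^{o}$. Dunford integrability. $f:E\to X$ is Dunford integrable if $x^{*}f$ is Lebesgue integrable on $E$ for all $x^{*}\in X^{*}$. *)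

theory Defs
  imports "HOL-Analysis.Analysis"
begin

text \<open>
  \<^term>\<open>infnorm\<close> is the maximum norm; \<^term>\<open>ball\<close> and \<^term>\<open>dist\<close> on \<^typ>\<open>real^'m\<close> are Euclidean.
\<close>

definition max_ball :: "real^'m \<Rightarrow> real \<Rightarrow> (real^'m) set" where
  "max_ball t r = {s. infnorm (s - t) < r}"

subsection \<open>Intervals and additive interval functions\<close>

definition intervals :: "(real^'m) set set" where
  "intervals = {cbox a b | a b. \<forall>j. a $ j < b $ j}"

definition intervals_in :: "(real^'m) set \<Rightarrow> (real^'m) set set" where
  "intervals_in E = {I \<in> intervals. I \<subseteq> E}"

definition nonoverlapping :: "(real^'m) set \<Rightarrow> (real^'m) set \<Rightarrow> bool" where
  "nonoverlapping I J \<longleftrightarrow> interior I \<inter> interior J = {}"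

text \<open>
  An interval function on \<^term>\<open>E\<close> is a total function on sets of which only the
  values on \<^term>\<open>intervals_in E\<close> matter; likewise an integrand on \<^term>\<open>E\<close> is a
  total function of which only the values on \<^term>\<open>E\<close> matter.
\<close>

definition additive_interval_function ::
    "(real^'m) set \<Rightarrow> ((real^'m) set \<Rightarrow> 'x::banach) \<Rightarrow> bool" where
  "additive_interval_function E F \<longleftrightarrow>
    (\<forall>I \<in> intervals_in E. \<forall>J \<in> intervals_in E.
      nonoverlapping I J \<longrightarrow> I \<union> J \<in> intervals_in E \<longrightarrow> F (I \<union> J) = F I + F J)"

subsection \<open>Partitions\<close>

text \<open>
  A finite collection of tagged intervals is modelled as a finite set of pairs. No repetition is
  lost: a non-degenerate interval overlaps itself, so it occurs in at most one pair.
\<close>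

definition M_partition :: "(real^'m) set \<Rightarrow> ((real^'m) \<times> (real^'m) set) set \<Rightarrow> bool" where
  "M_partition E \<pi> \<longleftrightarrow>
    finite \<pi> \<and>
    (\<forall>(t, I) \<in> \<pi>. t \<in> E \<and> I \<in> intervals_in E) \<and>
    (\<forall>p \<in> \<pi>. \<forall>q \<in> \<pi>. p \<noteq> q \<longrightarrow> nonoverlapping (snd p) (snd q))"

definition HK_partition :: "(real^'m) set \<Rightarrow> ((real^'m) \<times> (real^'m) set) set \<Rightarrow> bool" where
  "HK_partition E \<pi> \<longleftrightarrow> M_partition E \<pi> \<and> (\<forall>(t, I) \<in> \<pi>. t \<in> I)"

definition tagged_in :: "(real^'m) set \<Rightarrow> ((real^'m) \<times> (real^'m) set) set \<Rightarrow> bool" where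
  "tagged_in Z \<pi> \<longleftrightarrow> (\<forall>(t, I) \<in> \<pi>. t \<in> Z)"

text \<open>
  Unlike the library's set-valued \<^term>\<open>gauge\<close>, a gauge here is a positive function.
\<close>

definition gauge_on :: "(real^'m) set \<Rightarrow> (real^'m \<Rightarrow> real) \<Rightarrow> bool" where
  "gauge_on Z \<delta> \<longleftrightarrow> (\<forall>t \<in> Z. \<delta> t > 0)"

definition fine_partition :: "(real^'m \<Rightarrow> real) \<Rightarrow> ((real^'m) \<times> (real^'m) set) set \<Rightarrow> bool" where
  "fine_partition \<delta> \<pi> \<longleftrightarrow> (\<forall>(t, I) \<in> \<pi>. I \<subseteq> max_ball t (\<delta> t))"

subsection \<open>Divisions\<close>

text \<open>Sequences of intervals are indexed from 0.\<close>

definition divisions_in :: "(real^'m) set \<Rightarrow> (nat \<Rightarrow> (real^'m) set) set" where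
  "divisions_in E =
    {D. (\<forall>k. D k \<in> intervals_in E) \<and> (\<forall>j k. j \<noteq> k \<longrightarrow> nonoverlapping (D j) (D k))}"

definition divisions_of :: "(real^'m) set \<Rightarrow> (nat \<Rightarrow> (real^'m) set) set" where
  "divisions_of E = {D \<in> divisions_in E. E = (\<Union>k. D k)}"

subsection \<open>Unconditionally convergent series\<close>

text \<open>
  The library's \<^term>\<open>a summable_on K\<close> is convergence of the net of finite partial sums. For series
  in a Banach space this is unconditional convergence, i.e. convergence of all rearrangements, as
  the next lemma confirms.
\<close>

lemma summable_on_iff_rearrangements:
  fixes a :: "nat \<Rightarrow> 'x::banach"
  shows "a summable_on K \<longleftrightarrow>
    (\<forall>p. bij p \<longrightarrow> summable (\<lambda>n. if p n \<in> K then a (p n) else 0))"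
proof -
  define b where "b = (\<lambda>n. if n \<in> K then a n else 0)"
  have ab: "a summable_on K \<longleftrightarrow> b summable_on UNIV"
    unfolding b_def by (rule summable_on_cong_neutral) auto
  have 1: "summable (\<lambda>n. b (p n))" if "b summable_on UNIV" "bij p" for p
  proof -
    have "(\<lambda>n. b (p n)) summable_on UNIV"
      using that summable_on_reindex_bij_betw[of p UNIV UNIV b] by simp
    thus ?thesis by (meson summable_on_def has_sum_imp_sums sums_summable)
  qed
  have 2: "b summable_on UNIV" if s: "\<And>p. bij p \<Longrightarrow> summable (\<lambda>n. b (p n))"
  proof (rule ccontr)
    assume n: "\<not> b summable_on UNIV"
    have "\<exists>e>0. \<forall>M. \<exists>G. finite G \<and> G \<subseteq> {M..} \<and> norm (sum b G) \<ge> e"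
    proof (rule ccontr)
      assume "\<not> ?thesis"
      then have c: "\<exists>M. \<forall>G. finite G \<longrightarrow> G \<subseteq> {M..} \<longrightarrow> norm (sum b G) < e" if "e > 0" for e
        using that by (meson not_le)
      have "\<exists>P. eventually P (finite_subsets_at_top UNIV) \<and>
            (\<forall>x y. P x \<and> P y \<longrightarrow> dist (sum b x) (sum b y) < e)" if e: "e > 0" for e
      proof -
        from c[of "e/2"] e obtain M where
          M: "\<And>G. finite G \<Longrightarrow> G \<subseteq> {M..} \<Longrightarrow> norm (sum b G) < e/2" by auto
        have d: "dist (sum b x) (sum b {..<M}) < e/2" if "finite x" "{..<M} \<subseteq> x" for x
        proof -
          have "sum b x - sum b {..<M} = sum b (x - {..<M})"
            using that by (simp add: sum_diff)
          moreover have "norm (sum b (x - {..<M})) < e/2"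
            using that by (intro M) auto
          ultimately show ?thesis by (simp add: dist_norm)
        qed
        show ?thesis
        proof (intro exI conjI allI impI)
          show "eventually (\<lambda>x. finite x \<and> {..<M} \<subseteq> x) (finite_subsets_at_top UNIV)"
            by (auto simp: eventually_finite_subsets_at_top)
        next
          fix x y assume "(finite x \<and> {..<M} \<subseteq> x) \<and> (finite y \<and> {..<M} \<subseteq> y)"
          then show "dist (sum b x) (sum b y) < e"
            using dist_triangle_half_l[OF d d, of x y] by simp
        qed
      qed
      then have "cauchy_filter (filtermap (sum b) (finite_subsets_at_top UNIV))"
        by (simp add: cauchy_filter_metric_filtermap)
      moreover have "filtermap (sum b) (finite_subsets_at_top UNIV) \<noteq> bot"
        by (simp add: filtermap_bot_iff)
      ultimately obtain x where "filtermap (sum b) (finite_subsets_at_top UNIV) \<le> nhds x"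
        using complete_UNIV[where 'a='x, unfolded complete_uniform, rule_format] by auto
      then have "(sum b \<longlongrightarrow> x) (finite_subsets_at_top UNIV)"
        by (simp add: filterlim_def)
      with n show False by (auto simp: summable_on_def has_sum_def)
    qed
    then obtain e where e: "e > 0" and
      "\<And>M. \<exists>G. finite G \<and> G \<subseteq> {M..} \<and> norm (sum b G) \<ge> e" by auto
    then obtain G where G: "\<And>M. finite (G M)" "\<And>M. G M \<subseteq> {M..}" "\<And>M. norm (sum b (G M)) \<ge> e"
      by metis
    define nx where "nx M = Suc (Max (insert M (G M)))" for M
    define N where "N k = (nx ^^ k) 0" for k
    have N0: "N 0 = 0" and NS: "N (Suc k) = nx (N k)" for k by (auto simp: N_def)
    have nx: "M < nx M" "G M \<subseteq> {M..<nx M}" for M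
    proof -
      have "x \<le> Max (insert M (G M))" if "x \<in> insert M (G M)" for x
        using that G(1) by (intro Max_ge) auto
      then show "M < nx M" "G M \<subseteq> {M..<nx M}" using G(2)[of M]
        by (auto simp: nx_def less_Suc_eq_le)
    qed
    have smN: "strict_mono N" using nx(1) NS by (simp add: strict_mono_Suc_iff)
    have "\<exists>q. bij_betw q {M..<nx M} {M..<nx M} \<and> q ` {M..<M + card (G M)} = G M" for M
    proof -
      let ?c = "M + card (G M)"
      have le: "?c \<le> nx M" using card_mono[OF _ nx(2)[of M]] nx(1)[of M] by simp
      obtain q1 where q1: "bij_betw q1 {M..<?c} (G M)"
        using finite_same_card_bij[of "{M..<?c}" "G M"] G(1) by auto
      have "card {?c..<nx M} = card ({M..<nx M} - G M)"
        using card_Diff_subset[OF G(1) nx(2), of M] by simp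
      then obtain q2 where q2: "bij_betw q2 {?c..<nx M} ({M..<nx M} - G M)"
        using finite_same_card_bij[of "{?c..<nx M}" "{M..<nx M} - G M"] by auto
      let ?q = "\<lambda>x. if x \<in> {M..<?c} then q1 x else q2 x"
      have "bij_betw ?q ({M..<?c} \<union> {?c..<nx M}) (G M \<union> ({M..<nx M} - G M))"
        using q1 q2 by (intro bij_betw_disjoint_Un) auto
      moreover have "{M..<?c} \<union> {?c..<nx M} = {M..<nx M}" using le by auto
      moreover have "G M \<union> ({M..<nx M} - G M) = {M..<nx M}" using nx(2) by auto
      moreover have "?q ` {M..<?c} = G M" using q1 by (auto simp: bij_betw_def)
      ultimately show ?thesis by (intro exI[of _ ?q]) simp
    qed
    then obtain q where q: "\<And>M. bij_betw (q M) {M..<nx M} {M..<nx M}"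
      "\<And>M. q M ` {M..<M + card (G M)} = G M" by metis
    have ex: "\<exists>k. n \<in> {N k..<N (Suc k)}" for n
    proof -
      have "n < N (Suc n)"
        using strict_mono_imp_increasing[OF smN, of "Suc n"] by simp
      then obtain j where j: "n < N j" "\<And>i. i < j \<Longrightarrow> \<not> n < N i"
        using exists_least_iff[of "\<lambda>k. n < N k"] by auto
      then obtain i where "j = Suc i" using N0 by (cases j) auto
      with j show ?thesis by (intro exI[of _ i]) (simp add: not_less)
    qed
    have un: "k = l" if "n \<in> {N k..<N (Suc k)}" "n \<in> {N l..<N (Suc l)}" for n k l
    proof (rule ccontr)
      assume "k \<noteq> l"
      then consider "Suc k \<le> l" | "Suc l \<le> k" by linarith
      then have "N (Suc k) \<le> N l \<or> N (Suc l) \<le> N k"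
        by cases (simp_all add: strict_mono_less_eq[OF smN])
      then show False using that by auto
    qed
    define ix where "ix n = (THE k. n \<in> {N k..<N (Suc k)})" for n
    have ix: "ix n = k" if "n \<in> {N k..<N (Suc k)}" for n k
      unfolding ix_def using that un by blast
    define p where "p n = q (N (ix n)) n" for n
    have pk: "bij_betw p {N k..<N (Suc k)} {N k..<N (Suc k)}" for k
      using q(1)[of "N k"] unfolding NS
      by (rule bij_betw_cong[THEN iffD1, rotated]) (simp add: p_def ix NS)
    have "bij p"
    proof (rule bijI)
      show "inj p"
      proof (rule injI)
        fix x y assume xy: "p x = p y"
        obtain k l where kl: "x \<in> {N k..<N (Suc k)}" "y \<in> {N l..<N (Suc l)}" using ex by meson
        then have "p x \<in> {N k..<N (Suc k)}" "p y \<in> {N l..<N (Suc l)}"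
          using pk bij_betw_apply by metis+
        then have "k = l" using xy un by simp
        then show "x = y" using kl pk[of k] xy by (meson bij_betw_imp_inj_on inj_onD)
      qed
      have "y \<in> range p" for y
      proof -
        obtain k where "y \<in> {N k..<N (Suc k)}" using ex by blast
        then show ?thesis using bij_betw_imp_surj_on[OF pk[of k]] by blast
      qed
      then show "surj p" by blast
    qed
    from s[OF this] e obtain L where
      L: "\<And>m n. m \<ge> L \<Longrightarrow> norm (\<Sum>i=m..<n. b (p i)) < e"
      unfolding summable_Cauchy by metis
    let ?M = "N L" let ?S = "{?M..<?M + card (G ?M)}"
    have sub: "?S \<subseteq> {N L..<N (Suc L)}"
      using card_mono[OF _ nx(2)[of ?M]] nx(1)[of ?M] by (auto simp: NS)
    have im: "p ` ?S = G ?M"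
    proof -
      have "p n = q ?M n" if "n \<in> ?S" for n
        unfolding p_def using ix[OF subsetD[OF sub that]] by simp
      then have "p ` ?S = q ?M ` ?S" by (rule image_cong[OF refl])
      then show ?thesis unfolding q(2) .
    qed
    have "inj_on p ?S" using pk[of L] sub by (meson bij_betw_imp_inj_on inj_on_subset)
    then have "(\<Sum>i\<in>?S. b (p i)) = sum b (G ?M)"
      using sum.reindex[of p ?S b] unfolding im by (simp add: o_def)
    moreover have "?M \<ge> L" using smN by (rule strict_mono_imp_increasing)
    ultimately show False using L[of ?M "?M + card (G ?M)"] G(3)[of ?M] by simp
  qed
  have "b summable_on UNIV \<longleftrightarrow> (\<forall>p. bij p \<longrightarrow> summable (\<lambda>n. b (p n)))"
    by (intro iffI allI impI) (rule 1, assumption+, rule 2, simp)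
  with ab show ?thesis unfolding b_def by (rule trans)
qed

text \<open>
  The terms and the sum of the series of all \<^term>\<open>F (I \<inter> D k)\<close> with \<^term>\<open>I \<inter> D k\<close> of positive
  measure. When \<^term>\<open>I\<close> and \<^term>\<open>D k\<close> are intervals, positive measure makes \<^term>\<open>I \<inter> D k\<close>
  a non-degenerate interval.
\<close>

definition meeting :: "(nat \<Rightarrow> (real^'m) set) \<Rightarrow> (real^'m) set \<Rightarrow> nat set" where
  "meeting D I = {k. measure lebesgue (I \<inter> D k) > 0}"

definition series_convergent ::
    "((real^'m) set \<Rightarrow> 'x::banach) \<Rightarrow> (nat \<Rightarrow> (real^'m) set) \<Rightarrow> (real^'m) set \<Rightarrow> bool" where
  "series_convergent F D I \<longleftrightarrow> (\<lambda>k. F (I \<inter> D k)) summable_on meeting D I"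

definition series_sum ::
    "((real^'m) set \<Rightarrow> 'x::banach) \<Rightarrow> (nat \<Rightarrow> (real^'m) set) \<Rightarrow> (real^'m) set \<Rightarrow> 'x" where
  "series_sum F D I = (\<Sum>\<^sub>\<infinity>k \<in> meeting D I. F (I \<inter> D k))"

subsection \<open>Dunford-functions and negligible variation\<close>

definition Dunford_function ::
    "(real^'m) set \<Rightarrow> ((real^'m) set \<Rightarrow> 'x::banach) \<Rightarrow> bool" where
  "Dunford_function E F \<longleftrightarrow>
    additive_interval_function E F \<and>
    (\<forall>D \<in> divisions_in E.
      (\<forall>I \<in> intervals. series_convergent F D I) \<and>
      (D \<in> divisions_of (interior E) \<longrightarrow> (\<forall>I \<in> intervals_in E. F I = series_sum F D I)))"

text \<open>
  In the next two definitions \<^term>\<open>P\<close> is \<^term>\<open>M_partition\<close> or \<^term>\<open>HK_partition\<close>.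
\<close>

definition negligible_variation ::
    "((real^'m) set \<Rightarrow> ((real^'m) \<times> (real^'m) set) set \<Rightarrow> bool) \<Rightarrow>
     (real^'m) set \<Rightarrow> ((real^'m) set \<Rightarrow> 'x::banach) \<Rightarrow> (real^'m) set \<Rightarrow> bool" where
  "negligible_variation P E F Z \<longleftrightarrow>
    additive_interval_function E F \<and>
    (\<forall>\<epsilon>>0. \<exists>\<delta>. gauge_on Z \<delta> \<and>
      (\<forall>\<pi>. P UNIV \<pi> \<longrightarrow> tagged_in Z \<pi> \<longrightarrow> fine_partition \<delta> \<pi> \<longrightarrow>
        (\<forall>D \<in> divisions_of (interior E).
          (\<forall>(t, I) \<in> \<pi>. series_convergent F D I) \<and>
          norm (\<Sum>(t, I) \<in> \<pi>. series_sum F D I) < \<epsilon>)))"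

subsection \<open>The integrals\<close>

definition Dunford_gauge_integrable ::
    "((real^'m) set \<Rightarrow> ((real^'m) \<times> (real^'m) set) set \<Rightarrow> bool) \<Rightarrow>
     (real^'m) set \<Rightarrow> (real^'m \<Rightarrow> 'x::banach) \<Rightarrow> ((real^'m) set \<Rightarrow> 'x) \<Rightarrow> bool" where
  "Dunford_gauge_integrable P E f F \<longleftrightarrow>
    (\<forall>\<epsilon>>0. \<exists>\<delta>. gauge_on (interior E) \<delta> \<and>
      (\<forall>\<pi>. P (interior E) \<pi> \<longrightarrow> fine_partition \<delta> \<pi> \<longrightarrow>
        norm (\<Sum>(t, I) \<in> \<pi>. measure lebesgue I *\<^sub>R f t - F I) < \<epsilon>)) \<and>
    Dunford_function E F \<and>
    negligible_variation P E F (UNIV - interior E)"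

definition Dunford_McShane_integrable ::
    "(real^'m) set \<Rightarrow> (real^'m \<Rightarrow> 'x::banach) \<Rightarrow> ((real^'m) set \<Rightarrow> 'x) \<Rightarrow> bool" where
  "Dunford_McShane_integrable E f F \<longleftrightarrow> Dunford_gauge_integrable M_partition E f F"

definition Dunford_Henstock_Kurzweil_integrable ::
    "(real^'m) set \<Rightarrow> (real^'m \<Rightarrow> 'x::banach) \<Rightarrow> ((real^'m) set \<Rightarrow> 'x) \<Rightarrow> bool" where
  "Dunford_Henstock_Kurzweil_integrable E f F \<longleftrightarrow> Dunford_gauge_integrable HK_partition E f F"

definition Dunford_integrable :: "(real^'m) set \<Rightarrow> (real^'m \<Rightarrow> 'x::banach) \<Rightarrow> bool" where
  "Dunford_integrable E f \<longleftrightarrow>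
    (\<forall>x :: 'x \<Rightarrow>\<^sub>L real. set_integrable lebesgue E (\<lambda>t. blinfun_apply x (f t)))"

end

theory Submission
  imports Defs
begin

text \<open>
  The hard direction is the upgrade from Henstock-Kurzweil to McShane partitions. Applied to open
  sets, the unconditional convergence over divisions makes the scalar functions \<open>x f\<close>, \<open>x\<close> in the
  unit ball of the dual, uniformly absolutely continuous (an argument of Dieudonne-Grothendieck
  type). Together with one Henstock-Kurzweil gauge this yields step functions that approximate \<open>f\<close>
  scalarly in \<open>L\<^sup>1\<close>, uniformly in \<open>x\<close>. Now consider tags with \<open>norm (f t) \<le> n\<close>. Where \<open>x f\<close> differs
  from a good step function at the tag by more than \<open>\<eta>\<close>, disjoint cubes centred at the tags, selected by
  a Vitali covering argument, form a Henstock-Kurzweil partition, and this bounds the total measure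
  of the intervals with such tags. A finer gauge and step function for each \<open>n\<close> then make the
  errors of the classes \<open>norm (f t) \<le> n\<close> summable; no measurability of the gauges is needed. The
  variation outside the interior is negligible by uniform absolute continuity.

  Conversely, the McShane estimate gives bounded variation on compact subintervals by refinement,
  and the unconditional convergence then gives integrability on the whole interval.
\<close>

subsection \<open>Norming functionals\<close>

text \<open>The function \<open>f\<close> need not be strongly measurable, and exceptional sets that
  depend on a functional cannot be united over an uncountable dual ball. The gauge and the step
  function are therefore fixed first, with constants that serve the whole dual unit ball. A norming
  functional is chosen only after the partition, to turn the norm of its sum into a scalar sum; sets
  that depend on the functional occur in estimates, never in the construction of a gauge. The
  obstacle peculiar to McShane partitions is that an interval may miss its tag, so the
  Henstock-Kurzweil estimate says nothing about it. A cube centred at the tag can replace it because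
  the step function is constant near the tag. Small total measure of the intervals controls their
  integrals by absolute continuity, but it controls the terms
  \<open>measure lebesgue I *\<^sub>R f t\<close> only while \<open>norm (f t)\<close> is bounded;
  hence the splitting of the tags by \<open>norm (f t)\<close>.\<close>

definition sublinear :: "('x::real_vector \<Rightarrow> real) \<Rightarrow> bool" where
  "sublinear p \<longleftrightarrow> (\<forall>x y. p (x + y) \<le> p x + p y) \<and> (\<forall>c x. c \<ge> 0 \<longrightarrow> p (c *\<^sub>R x) = c * p x)"

lemma sublinear_zero: "sublinear p \<Longrightarrow> p 0 = 0"
  unfolding sublinear_def by (metis mult_zero_left order_refl scaleR_zero_left)

lemma sublinear_minus: "sublinear p \<Longrightarrow> - p (- x) \<le> p x"
  using sublinear_zero[of p] unfolding sublinear_def by (metis add.right_inverse add.commute neg_le_iff_le minus_le_iff le_add_same_cancel1 add_le_cancel_left diff_ge_0_iff_ge diff_minus_eq_add)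

text \<open>
  A sublinear functional that is minimal below a given one is linear: it is not lowered by the
  following construction, which forces additivity.
\<close>

definition sublinear_drop :: "('x::real_vector \<Rightarrow> real) \<Rightarrow> 'x \<Rightarrow> 'x \<Rightarrow> real" where
  "sublinear_drop p y x = (INF t\<in>{0..}. p (x + t *\<^sub>R y) - t * p y)"

lemma sublinear_drop:
  assumes p: "sublinear p"
  shows "sublinear (sublinear_drop p y)" (is ?A)
    and "t \<ge> 0 \<Longrightarrow> sublinear_drop p y x \<le> p (x + t *\<^sub>R y) - t * p y" (is "_ \<Longrightarrow> ?B")
proof -
  note add = p[unfolded sublinear_def, THEN conjunct1, rule_format]
  note scale = p[unfolded sublinear_def, THEN conjunct2, rule_format]
  \<comment> \<open>The bound does not involve \<open>t\<close>; it makes the infimum in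
    \<open>sublinear_drop\<close> a genuine one, over a set bounded below.\<close>
  have lower: "- p (- x) \<le> p (x + t *\<^sub>R y) - t * p y" if "t \<ge> 0" for x t
    using add[of "x + t *\<^sub>R y" "- x"] scale[OF that, of y] by simp
  have bdd: "bdd_below ((\<lambda>t. p (x + t *\<^sub>R y) - t * p y) ` {0..})" for x
    using lower by (auto intro!: bdd_belowI)
  have le: "sublinear_drop p y x \<le> p (x + t *\<^sub>R y) - t * p y" if "t \<ge> 0" for x t
    unfolding sublinear_drop_def using that by (intro cINF_lower bdd) auto
  show ?B if "t \<ge> 0" by (rule le[OF that])
  have ge: "b \<le> sublinear_drop p y x" if "\<And>t. t \<ge> 0 \<Longrightarrow> b \<le> p (x + t *\<^sub>R y) - t * p y" for b x
    unfolding sublinear_drop_def using that by (intro cINF_greatest) auto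
  have "sublinear_drop p y (x + z) \<le> sublinear_drop p y x + sublinear_drop p y z" for x z
  proof -
    have *: "sublinear_drop p y (x + z) \<le> (p (x + s *\<^sub>R y) - s * p y) + (p (z + t *\<^sub>R y) - t * p y)"
      if "s \<ge> 0" "t \<ge> 0" for s t
      using le[of "s + t" "x + z"] add[of "x + s *\<^sub>R y" "z + t *\<^sub>R y"] that
      by (simp add: algebra_simps)
    have "sublinear_drop p y (x + z) - (p (x + s *\<^sub>R y) - s * p y) \<le> sublinear_drop p y z" if "s \<ge> 0" for s
      using *[OF that] by (intro ge) (simp add: algebra_simps)
    then have "sublinear_drop p y (x + z) - sublinear_drop p y z \<le> sublinear_drop p y x"
      by (intro ge) (simp add: algebra_simps)
    then show ?thesis by simp
  qed
  moreover have "sublinear_drop p y (c *\<^sub>R x) = c * sublinear_drop p y x" if c: "c \<ge> 0" for c x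
  proof (cases "c = 0")
    case True
    have "sublinear_drop p y 0 \<le> 0" using le[of 0 0] sublinear_zero[OF p] by simp
    moreover have "0 \<le> sublinear_drop p y 0"
      using scale by (intro ge) simp
    ultimately show ?thesis using True by simp
  next
    case False
    \<comment> \<open>One inequality for every positive factor is enough: applied to
      \<open>1/c\<close> and \<open>c *\<^sub>R x\<close> it gives the reverse one.\<close>
    have half: "sublinear_drop p y (c *\<^sub>R x) \<le> c * sublinear_drop p y x" if c: "c > 0" for c x
    proof -
      have "sublinear_drop p y (c *\<^sub>R x) / c \<le> sublinear_drop p y x"
      proof (rule ge)
        fix t :: real assume t: "t \<ge> 0"
        have "sublinear_drop p y (c *\<^sub>R x) \<le> p (c *\<^sub>R (x + t *\<^sub>R y)) - (c * t) * p y"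
          using le[of "c * t" "c *\<^sub>R x"] c t by (simp add: scaleR_right_distrib)
        also have "\<dots> = c * (p (x + t *\<^sub>R y) - t * p y)"
          using scale[of c "x + t *\<^sub>R y"] c by (simp add: right_diff_distrib)
        finally show "sublinear_drop p y (c *\<^sub>R x) / c \<le> p (x + t *\<^sub>R y) - t * p y"
          using c by (simp add: divide_le_eq mult.commute)
      qed
      then show ?thesis using c by (simp add: divide_le_eq mult.commute)
    qed
    have c0: "c > 0" using c False by simp
    have "sublinear_drop p y ((1/c) *\<^sub>R (c *\<^sub>R x)) \<le> (1/c) * sublinear_drop p y (c *\<^sub>R x)"
      using c0 by (intro half) simp
    then have "c * sublinear_drop p y x \<le> sublinear_drop p y (c *\<^sub>R x)"
      using c0 by (simp add: field_simps)
    with half[OF c0, of x] show ?thesis by simp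
  qed
  ultimately show ?A unfolding sublinear_def by blast
qed

text \<open>Zorn's lemma yields a minimal sublinear \<open>q\<close> below \<open>p\<close>. Then
  \<open>sublinear_drop q y\<close> lies below \<open>q\<close>, hence equals it, and its bound at
  \<open>t = 1\<close> is the inequality reverse to subadditivity.\<close>

lemma exists_linear_below_sublinear:
  assumes p: "sublinear p"
  shows "\<exists>q. linear q \<and> (\<forall>x. q x \<le> p x)"
proof -
  define A where "A = {q. sublinear q \<and> (\<forall>x. q x \<le> p x)}"
  \<comment> \<open>The pointwise order is reversed, so a maximal element of \<open>r\<close> is a
    minimal functional and an upper bound of a chain is its pointwise infimum.\<close>
  define r where "r = {(q, q'). q \<in> A \<and> q' \<in> A \<and> (\<forall>x. q' x \<le> q x)}"
  have fld: "Field r = A" unfolding r_def Field_def by auto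
  have po: "Partial_order r"
    unfolding partial_order_on_def preorder_on_def fld
    by (auto simp: r_def refl_on_def trans_def antisym_def fun_eq_iff intro: order_trans order.antisym)
  have "\<exists>m\<in>Field r. \<forall>a\<in>Field r. (m, a) \<in> r \<longrightarrow> a = m"
  proof (rule Zorns_po_lemma[OF po])
    fix C assume C: "C \<in> Chains r"
    show "\<exists>u\<in>Field r. \<forall>a\<in>C. (a, u) \<in> r"
    proof (cases "C = {}")
      case True
      then show ?thesis using p by (auto simp: fld A_def)
    next
      case False
      have CA: "C \<subseteq> A" using C by (auto simp: Chains_def r_def)
      have tot: "(\<forall>x. a x \<le> b x) \<or> (\<forall>x. b x \<le> a x)" if "a \<in> C" "b \<in> C" for a b
        using C that unfolding Chains_def r_def by blast
      define u where "u x = (INF q\<in>C. q x)" for x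
      have low: "- p (- x) \<le> q x" if "q \<in> C" for q x
        using that CA sublinear_minus[of q x] unfolding A_def
        by (smt (verit) mem_Collect_eq subsetD)
      have bdd: "bdd_below ((\<lambda>q. q x) ` C)" for x using low by (auto intro!: bdd_belowI)
      have le: "u x \<le> q x" if "q \<in> C" for q x
        unfolding u_def using that by (intro cINF_lower bdd) auto
      have ge: "b \<le> u x" if "\<And>q. q \<in> C \<Longrightarrow> b \<le> q x" for b x
        unfolding u_def using that False by (intro cINF_greatest) auto
      have "u (x + y) \<le> u x + u y" for x y
      proof -
        \<comment> \<open>Subadditivity of an infimum would fail for arbitrary families; in a chain
          the smaller of \<open>a\<close> and \<open>b\<close> can be used for both terms.\<close>
        have *: "u (x + y) \<le> a x + b y" if ab: "a \<in> C" "b \<in> C" for a b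
        proof -
          have sa: "sublinear a" "sublinear b" using ab CA by (auto simp: A_def)
          from tot[OF ab] show ?thesis
          proof
            assume "\<forall>x. a x \<le> b x"
            then show ?thesis using le[OF ab(1), of "x + y"] sa unfolding sublinear_def
              by (smt (verit))
          next
            assume "\<forall>x. b x \<le> a x"
            then show ?thesis using le[OF ab(2), of "x + y"] sa unfolding sublinear_def
              by (smt (verit))
          qed
        qed
        have "u (x + y) - a x \<le> u y" if "a \<in> C" for a
          using *[OF that] by (intro ge) (simp add: algebra_simps)
        then have "u (x + y) - u y \<le> u x"
          by (intro ge) (simp add: algebra_simps)
        then show ?thesis by simp
      qed
      moreover have "u (c *\<^sub>R x) = c * u x" if c: "c \<ge> 0" for c x
      proof (cases "c = 0")
        case True
        have "q 0 = 0" if "q \<in> C" for q using that CA sublinear_zero by (auto simp: A_def)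
        then have "(\<lambda>q. q 0) ` C = {0}" using False by force
        then have "u 0 = 0" unfolding u_def by simp
        then show ?thesis using True by simp
      next
        case F: False
        have sc: "q (c *\<^sub>R x) = c * q x" if "q \<in> C" for q
          using that CA c by (auto simp: A_def sublinear_def)
        show ?thesis
        proof (rule antisym)
          have "u (c *\<^sub>R x) / c \<le> u x"
          proof (rule ge)
            fix q assume "q \<in> C"
            then show "u (c *\<^sub>R x) / c \<le> q x"
              using sc le[of q "c *\<^sub>R x"] c F by (simp add: divide_le_eq mult.commute)
          qed
          then show "u (c *\<^sub>R x) \<le> c * u x" using c F by (simp add: divide_le_eq mult.commute)
          show "c * u x \<le> u (c *\<^sub>R x)"
            using le c by (intro ge) (simp add: sc mult_left_mono)
        qed
      qed
      moreover have "u x \<le> p x" for x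
      proof -
        obtain q where "q \<in> C" using False by blast
        then show ?thesis using le[of q x] CA unfolding A_def by (smt (verit) mem_Collect_eq subsetD)
      qed
      ultimately have "u \<in> A" unfolding A_def sublinear_def by blast
      then show ?thesis using le CA unfolding fld by (intro bexI[of _ u]) (auto simp: r_def)
    qed
  qed
  then obtain q where q: "q \<in> A" and min: "\<And>a. a \<in> A \<Longrightarrow> (\<And>x. a x \<le> q x) \<Longrightarrow> a = q"
    unfolding fld by (auto simp: r_def)
  have sq: "sublinear q" and qp: "\<And>x. q x \<le> p x" using q by (auto simp: A_def)
  have add: "q (x + y) = q x + q y" for x y
  proof -
    have "sublinear_drop q y x \<le> q x" for x
      using sublinear_drop(2)[OF sq, of 0 y x] by simp
    then have "sublinear_drop q y = q"
      using sublinear_drop(1)[OF sq, of y] qp by (intro min) (auto simp: A_def intro: order_trans)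
    then have "q x + q y \<le> q (x + y)"
      using sublinear_drop(2)[OF sq, of 1 y x] by simp
    then show ?thesis using sq unfolding sublinear_def by (simp add: antisym)
  qed
  have neg: "q (- x) = - q x" for x
    using add[of x "- x"] sublinear_zero[OF sq] by simp
  have "q (c *\<^sub>R x) = c * q x" for c x
  proof (cases "c \<ge> 0")
    case True then show ?thesis using sq by (simp add: sublinear_def)
  next
    case False
    then have "q ((- c) *\<^sub>R x) = (- c) * q x" using sq unfolding sublinear_def by (meson le_minus_iff linear neg_0_le_iff_le not_le)
    then show ?thesis using neg[of "c *\<^sub>R x"] by simp
  qed
  then have "linear q" using add by (intro linearI) auto
  then show ?thesis using qp by blast
qed

text \<open>Hahn-Banach without extension from a subspace: the linear functional is taken below
  \<open>sublinear_drop norm v\<close> instead of \<open>norm\<close>. At \<open>- v\<close> with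
  \<open>t = 1\<close> this forces the value at \<open>- v\<close> to be at most
  \<open>- norm v\<close>.\<close>

lemma norming_functional:
  fixes v :: "'x::real_normed_vector"
  obtains x :: "'x \<Rightarrow>\<^sub>L real" where "norm x \<le> 1" "blinfun_apply x v = norm v"
proof -
  have sn: "sublinear (norm :: 'x \<Rightarrow> real)"
    by (auto simp: sublinear_def norm_triangle_ineq)
  obtain q where q: "linear q" "\<And>x. q x \<le> sublinear_drop norm v x"
    using exists_linear_below_sublinear[OF sublinear_drop(1)[OF sn, of v]] by blast
  have qn: "q x \<le> norm x" for x
    using q(2)[of x] sublinear_drop(2)[OF sn, of 0 v x] by simp
  have "q (- v) \<le> - norm v"
    using q(2)[of "- v"] sublinear_drop(2)[OF sn, of 1 v "- v"] by simp
  then have qv: "q v = norm v"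
    using qn[of v] linear_neg[OF q(1), of v] by simp
  have abs: "\<bar>q x\<bar> \<le> norm x" for x
    using qn[of x] qn[of "- x"] linear_neg[OF q(1), of x] by simp
  have bl: "bounded_linear q"
    using q(1) abs by (intro bounded_linear_intro[where K = 1]) (auto simp: linear_add linear_scale)
  show ?thesis
  proof
    show "norm (Blinfun q) \<le> 1"
      using abs by (intro norm_blinfun_bound) (auto simp: bounded_linear_Blinfun_apply[OF bl])
    show "blinfun_apply (Blinfun q) v = norm v"
      by (simp add: bounded_linear_Blinfun_apply[OF bl] qv)
  qed
qed

subsection \<open>Intervals and additive interval functions\<close>

lemma intervals_iff_content: "I \<in> intervals \<longleftrightarrow> (\<exists>a b. I = cbox a b \<and> 0 < measure lborel (cbox a b))"
  unfolding intervals_def content_pos_lt_eq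
  by (auto simp: Basis_vec_def inner_axis)

lemma intervalsE:
  assumes "I \<in> intervals"
  obtains a b where "I = cbox a b" "0 < measure lborel (cbox a b)" "box a b \<noteq> {}"
  using assms unfolding intervals_iff_content by (metis content_eq_0_interior interior_cbox less_irrefl)

lemma cbox_in_intervals: "0 < measure lborel (cbox a b) \<Longrightarrow> cbox a b \<in> intervals"
  by (auto simp: intervals_iff_content)

lemma interval_measure_pos: "I \<in> intervals \<Longrightarrow> 0 < measure lebesgue I"
  by (auto simp: intervals_iff_content)

lemma interval_lmeasurable: "I \<in> intervals \<Longrightarrow> I \<in> lmeasurable"
  by (auto simp: intervals_iff_content)

lemma interval_compact: "I \<in> intervals \<Longrightarrow> compact I"
  by (auto simp: intervals_iff_content)

lemma interval_nonempty: "I \<in> intervals \<Longrightarrow> I \<noteq> {}"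
  by (auto simp: intervals_iff_content)

lemma interval_interior_nonempty: "I \<in> intervals \<Longrightarrow> interior I \<noteq> {}"
  by (auto elim!: intervalsE)

lemma interval_Int:
  assumes "I \<in> intervals" "J \<in> intervals" "0 < measure lebesgue (I \<inter> J)"
  shows "I \<inter> J \<in> intervals"
proof -
  obtain a b c d where "I = cbox a b" "J = cbox c d" using assms by (auto elim!: intervalsE)
  moreover obtain u v where "cbox a b \<inter> cbox c d = cbox u v" using Int_interval by blast
  ultimately show ?thesis using assms(3) by (auto intro!: cbox_in_intervals)
qed

lemma nonoverlapping_negligible:
  assumes "I \<in> intervals" "J \<in> intervals" "nonoverlapping I J"
  shows "negligible (I \<inter> J)"
proof -
  have "convex (I \<inter> J)" using assms by (auto elim!: intervalsE intro: convex_Int)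
  then show ?thesis
    using assms(3) by (simp add: negligible_convex_interior interior_Int nonoverlapping_def)
qed

lemma nonoverlapping_mono:
  "nonoverlapping I J \<Longrightarrow> I' \<subseteq> I \<Longrightarrow> J' \<subseteq> J \<Longrightarrow> nonoverlapping I' J'"
  unfolding nonoverlapping_def using interior_mono by blast

lemma nonoverlapping_sym: "nonoverlapping I J \<Longrightarrow> nonoverlapping J I"
  by (auto simp: nonoverlapping_def)

text \<open>This brings \<open>F\<close> under the library's theory of operative functions, which
  evaluates sums over divisions. The values of \<open>F\<close> on degenerate boxes and outside
  \<open>E\<close> are arbitrary, hence the intersection with \<open>cbox a b\<close> and the value
  0 on null sets.\<close>

lemma additive_operative:
  assumes F: "additive_interval_function E F" and E: "cbox a b \<subseteq> E"
  shows "operative plus 0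
    (\<lambda>K. if 0 < measure lebesgue (K \<inter> cbox a b) then F (K \<inter> cbox a b) else 0)"
    (is "operative plus 0 ?h")
proof
  fix c d :: "real^'a"
  assume "box c d = {}"
  then have "measure lebesgue (cbox c d) = 0"
    by (simp add: content_eq_0_interior)
  moreover have "measure lebesgue (cbox c d \<inter> cbox a b) \<le> measure lebesgue (cbox c d)"
    by (rule measure_mono_fmeasurable) auto
  ultimately show "?h (cbox c d) = 0" by auto
next
  fix c d k :: "real^'a" and r
  assume k: "k \<in> Basis"
  obtain u v where uv: "cbox c d \<inter> cbox a b = cbox u v" using Int_interval by blast
  let ?L = "{x. x \<bullet> k \<le> r}" and ?R = "{x. r \<le> x \<bullet> k}"
  have eq: "(cbox c d \<inter> ?L) \<inter> cbox a b = cbox u v \<inter> ?L" "(cbox c d \<inter> ?R) \<inter> cbox a b = cbox u v \<inter> ?R"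
    using uv by auto
  define u' where "u' = (\<Sum>i\<in>Basis. (if i = k then max (u \<bullet> k) r else u \<bullet> i) *\<^sub>R i)"
  define v' where "v' = (\<Sum>i\<in>Basis. (if i = k then min (v \<bullet> k) r else v \<bullet> i) *\<^sub>R i)"
  have spl: "cbox u v \<inter> ?L = cbox u v'" "cbox u v \<inter> ?R = cbox u' v"
    unfolding u'_def v'_def using interval_split[OF k, of u v r] by auto
  have v': "v' \<bullet> i = (if i = k then min (v \<bullet> k) r else v \<bullet> i)" if "i \<in> Basis" for i
    unfolding v'_def using that by simp
  have u': "u' \<bullet> i = (if i = k then max (u \<bullet> k) r else u \<bullet> i)" if "i \<in> Basis" for i
    unfolding u'_def using that by simp
  have le: "measure lborel (cbox u v') \<le> measure lborel (cbox u v)" "measure lborel (cbox u' v) \<le> measure lborel (cbox u v)"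
    unfolding spl[symmetric] by (rule measure_mono_fmeasurable; auto)+
  show "?h (cbox c d) = ?h (cbox c d \<inter> ?L) + ?h (cbox c d \<inter> ?R)"
  proof (cases "0 < measure lborel (cbox u v)")
    case False
    then have "measure lborel (cbox u v) = 0" "measure lborel (cbox u v') = 0" "measure lborel (cbox u' v) = 0"
      using le by (smt (verit) measure_nonneg)+
    then show ?thesis unfolding eq uv spl by simp
  next
    case True
    then have uvi: "u \<bullet> i < v \<bullet> i" if "i \<in> Basis" for i using that by (simp add: content_pos_lt_eq)
    \<comment> \<open>Additivity of \<open>F\<close> is available only if the hyperplane cuts the
      box into two non-degenerate pieces; otherwise one piece is null and the other is the whole
      box.\<close>
    consider "r \<le> u \<bullet> k" | "v \<bullet> k \<le> r" | "u \<bullet> k < r" "r < v \<bullet> k" by linarith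
    then show ?thesis
    proof cases
      case 1
      then have "\<not> 0 < measure lborel (cbox u v')" using k by (auto simp: content_pos_lt_eq v')
      moreover have "r \<le> x \<bullet> k" if "x \<in> cbox u v" for x
        using that 1 k unfolding mem_box by (meson order_trans)
      then have "cbox u' v = cbox u v"
        unfolding spl(2)[symmetric] by auto
      ultimately show ?thesis unfolding eq uv spl using True by simp
    next
      case 2
      then have "\<not> 0 < measure lborel (cbox u' v)" using k by (auto simp: content_pos_lt_eq u')
      moreover have "x \<bullet> k \<le> r" if "x \<in> cbox u v" for x
        using that 2 k unfolding mem_box by (meson order_trans)
      then have "cbox u v' = cbox u v"
        unfolding spl(1)[symmetric] by auto
      ultimately show ?thesis unfolding eq uv spl using True by simp
    next
      case 3
      have pos: "0 < measure lborel (cbox u v')" "0 < measure lborel (cbox u' v)"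
        using 3 uvi by (auto simp: content_pos_lt_eq u' v')
      have un: "cbox u v' \<union> cbox u' v = cbox u v" unfolding spl[symmetric] by auto
      have sub: "cbox u v \<subseteq> E" using uv E by blast
      have k0: "k \<noteq> 0" using k nonzero_Basis by blast
      have "interior (cbox u v') \<inter> interior (cbox u' v) \<subseteq> interior ?L \<inter> interior ?R"
        unfolding spl[symmetric] by (simp add: interior_Int) blast
      also have "\<dots> = {}"
        using interior_halfspace_le[OF k0, of r] interior_halfspace_ge[OF k0, of r]
        by (auto simp: inner_commute)
      finally have "nonoverlapping (cbox u v') (cbox u' v)" unfolding nonoverlapping_def by blast
      then have "F (cbox u v' \<union> cbox u' v) = F (cbox u v') + F (cbox u' v)"
        using F pos True sub un unfolding additive_interval_function_def intervals_in_def
        by (metis (no_types, lifting) Un_subset_iff cbox_in_intervals mem_Collect_eq)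
      then show ?thesis unfolding eq uv spl un using True pos by simp
    qed
  qed
qed

lemma additive_sum_division:
  assumes F: "additive_interval_function E F" and I: "I \<in> intervals_in E" and d: "d division_of I"
  shows "F I = (\<Sum>K | K \<in> d \<and> 0 < measure lebesgue K. F K)"
proof -
  obtain a b where ab: "I = cbox a b" "0 < measure lborel (cbox a b)" and E: "cbox a b \<subseteq> E"
    using I by (auto simp: intervals_in_def elim!: intervalsE)
  interpret operative plus 0 "\<lambda>K. if 0 < measure lebesgue (K \<inter> cbox a b) then F (K \<inter> cbox a b) else 0"
    by (rule additive_operative[OF F E])
  have "F I = (\<Sum>K\<in>d. if 0 < measure lebesgue (K \<inter> cbox a b) then F (K \<inter> cbox a b) else 0)"
    using division[OF d[unfolded ab]] ab by (simp add: sum_def)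
  also have "\<dots> = (\<Sum>K\<in>d. if 0 < measure lebesgue K then F K else 0)"
    using division_ofD(2)[OF d] ab by (intro Groups_Big.sum.cong refl) (metis Int_absorb2)
  also have "\<dots> = (\<Sum>K | K \<in> d \<and> 0 < measure lebesgue K. F K)"
    using division_ofD(1)[OF d] by (simp add: sum.inter_filter)
  finally show ?thesis .
qed

lemma additive_sum_tagged_division:
  assumes F: "additive_interval_function E F" and I: "I \<in> intervals_in E" and d: "p tagged_division_of I"
  shows "F I = (\<Sum>(t, K)\<in>{q \<in> p. 0 < measure lebesgue (snd q)}. F K)"
proof -
  have "(\<Sum>(t, K)\<in>{q \<in> p. 0 < measure lebesgue (snd q)}. F K)
      = (\<Sum>(t, K)\<in>p. if 0 < measure lebesgue K then F K else 0)"
    using tagged_division_ofD(1)[OF d] by (simp add: sum.inter_filter case_prod_beta)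
  also have "\<dots> = (\<Sum>K\<in>snd ` p. if 0 < measure lebesgue K then F K else 0)"
    by (rule sum.over_tagged_division_lemma[OF d]) (simp add: zero_less_measure_iff content_eq_0_interior)
  also have "\<dots> = (\<Sum>K | K \<in> snd ` p \<and> 0 < measure lebesgue K. F K)"
    using tagged_division_ofD(1)[OF d] by (simp add: sum.inter_filter)
  also have "\<dots> = F I"
    using additive_sum_division[OF F I division_of_tagged_division[OF d]] by simp
  finally show ?thesis by simp
qed

section \<open>Balls of the maximum norm, fine partitions and the scalar primitive\<close>

lemma ball_subset_max_ball: "ball t r \<subseteq> max_ball t r"
  unfolding max_ball_def
  by (auto simp: dist_norm norm_minus_commute intro: le_less_trans[OF infnorm_le_norm])

lemma open_contains_max_ball:
  assumes "open U" "t \<in> U"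
  obtains r where "0 < r" "max_ball t r \<subseteq> U"
proof -
  obtain e where e: "0 < e" "ball t e \<subseteq> U" using assms by (meson openE)
  define r where "r = e / sqrt (real DIM(real^'a))"
  have d: "0 < sqrt (real DIM(real^'a))" by simp
  have "max_ball t r \<subseteq> ball t e"
  proof
    fix s assume "s \<in> max_ball t r"
    then have "infnorm (s - t) < r" by (simp add: max_ball_def)
    then have "sqrt (real DIM(real^'a)) * infnorm (s - t) < e"
      using d unfolding r_def by (simp add: pos_less_divide_eq mult.commute)
    then show "s \<in> ball t e"
      using norm_le_infnorm[of "s - t"] by (simp add: dist_norm norm_minus_commute)
  qed
  then show ?thesis using that[of r] e d by (simp add: r_def)
qed

lemma max_ball_mono: "r \<le> s \<Longrightarrow> max_ball t r \<subseteq> max_ball t s"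
  by (auto simp: max_ball_def)

text \<open>Divisions of the library may have degenerate cells, partitions may not; the null cells
  contribute nothing to the sums and are dropped.\<close>

lemma tagged_division_HK_partition:
  assumes p: "p tagged_division_of I" and I: "I \<subseteq> U"
  shows "HK_partition U {q \<in> p. 0 < measure lebesgue (snd q)}"
  unfolding HK_partition_def M_partition_def
proof (intro conjI)
  note D = tagged_division_ofD[OF p]
  show "finite {q \<in> p. 0 < measure lebesgue (snd q)}" using D(1) by simp
  show "\<forall>(t, K)\<in>{q \<in> p. 0 < measure lebesgue (snd q)}. t \<in> U \<and> K \<in> intervals_in U"
    using D(2,3,4) I unfolding intervals_in_def intervals_iff_content by fastforce
  show "\<forall>q\<in>{q \<in> p. 0 < measure lebesgue (snd q)}. \<forall>q'\<in>{q \<in> p. 0 < measure lebesgue (snd q)}.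
      q \<noteq> q' \<longrightarrow> nonoverlapping (snd q) (snd q')"
  proof (intro ballI impI)
    fix q q' assume "q \<in> {q \<in> p. 0 < measure lebesgue (snd q)}" "q' \<in> {q \<in> p. 0 < measure lebesgue (snd q)}" "q \<noteq> q'"
    then show "nonoverlapping (snd q) (snd q')"
      using D(5)[of "fst q" "snd q" "fst q'" "snd q'"] by (simp add: nonoverlapping_def)
  qed
  show "\<forall>(t, K)\<in>{q \<in> p. 0 < measure lebesgue (snd q)}. t \<in> K"
    by (clarsimp simp: D(2))
qed

text \<open>A fine tagged division of \<open>I\<close>, stripped of its null cells, is a
  Henstock-Kurzweil partition. By additivity of \<open>F\<close>, its scalar Riemann sum differs
  from \<open>blinfun_apply x (F I)\<close> exactly by \<open>x\<close> applied to the small sum in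
  \<open>est\<close>. Only intervals inside \<open>U\<close> are reached, since the gauge is
  positive only there.\<close>

lemma primitive_has_integral:
  fixes x :: "'x::banach \<Rightarrow>\<^sub>L real"
  assumes F: "additive_interval_function E F" and UE: "U \<subseteq> E"
    and est: "\<And>e. 0 < e \<Longrightarrow> \<exists>\<delta>. gauge_on U \<delta> \<and> (\<forall>\<pi>. HK_partition U \<pi> \<longrightarrow> fine_partition \<delta> \<pi> \<longrightarrow>
        norm (\<Sum>(t, I)\<in>\<pi>. measure lebesgue I *\<^sub>R f t - F I) < e)"
    and I: "I \<in> intervals_in U"
  shows "((\<lambda>t. blinfun_apply x (f t)) has_integral blinfun_apply x (F I)) I"
proof -
  obtain a b where ab: "I = cbox a b" and IU: "cbox a b \<subseteq> U"
    using I by (auto simp: intervals_in_def elim!: intervalsE)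
  have IE: "I \<in> intervals_in E" using I UE by (auto simp: intervals_in_def)
  show ?thesis unfolding ab has_integral
  proof (intro allI impI)
    fix e :: real assume e: "0 < e"
    \<comment> \<open>The summand 1 covers the case \<open>norm x = 0\<close> and makes the final
      inequality strict.\<close>
    define e' where "e' = e / (norm x + 1)"
    have e': "0 < e'" "norm x * e' < e"
      using e by (auto simp: e'_def field_simps add_pos_nonneg)
    obtain \<delta> where \<delta>: "gauge_on U \<delta>" and
      \<pi>: "\<And>\<pi>. HK_partition U \<pi> \<Longrightarrow> fine_partition \<delta> \<pi> \<Longrightarrow>
        norm (\<Sum>(t, I)\<in>\<pi>. measure lebesgue I *\<^sub>R f t - F I) < e'"
      using est[OF e'(1)] by blast
    \<comment> \<open>Tags lie in \<open>cbox a b\<close>, hence in \<open>U\<close>; the value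
      \<open>UNIV\<close> only keeps \<open>\<gamma>\<close> a gauge where \<open>\<delta>\<close>
      need not be positive.\<close>
    define \<gamma> where "\<gamma> t = (if t \<in> U then ball t (\<delta> t) else UNIV)" for t
    show "\<exists>\<gamma>. gauge \<gamma> \<and> (\<forall>\<D>. \<D> tagged_division_of cbox a b \<and> \<gamma> fine \<D> \<longrightarrow>
        norm ((\<Sum>(t, K)\<in>\<D>. measure lborel K *\<^sub>R blinfun_apply x (f t)) - blinfun_apply x (F (cbox a b))) < e)"
    proof (intro exI[of _ \<gamma>] conjI allI impI)
      show "gauge \<gamma>" using \<delta> by (auto simp: gauge_def \<gamma>_def gauge_on_def)
      fix \<D> assume "\<D> tagged_division_of cbox a b \<and> \<gamma> fine \<D>"
      then have D: "\<D> tagged_division_of cbox a b" and fin: "\<gamma> fine \<D>" by auto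
      define \<pi>' where "\<pi>' = {q \<in> \<D>. 0 < measure lebesgue (snd q)}"
      have HK: "HK_partition U \<pi>'"
        unfolding \<pi>'_def by (rule tagged_division_HK_partition[OF D IU])
      have "fine_partition \<delta> \<pi>'"
        unfolding fine_partition_def
      proof clarify
        fix t K s assume tK: "(t, K) \<in> \<pi>'" and s: "s \<in> K"
        have "t \<in> U" using HK tK by (auto simp: HK_partition_def M_partition_def)
        moreover have "K \<subseteq> \<gamma> t" using fin tK by (auto simp: \<pi>'_def fine_def)
        ultimately have "K \<subseteq> ball t (\<delta> t)" by (simp add: \<gamma>_def)
        then show "s \<in> max_ball t (\<delta> t)" using ball_subset_max_ball s by blast
      qed
      then have less: "norm (\<Sum>(t, I)\<in>\<pi>'. measure lebesgue I *\<^sub>R f t - F I) < e'"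
        using \<pi> HK by blast
      have bor: "K \<in> sets borel" if "(t, K) \<in> \<D>" for t K
        using tagged_division_ofD(4)[OF D that] by auto
      have "(\<Sum>(t, K)\<in>\<D>. measure lborel K *\<^sub>R blinfun_apply x (f t))
          = (\<Sum>(t, K)\<in>\<pi>'. measure lebesgue K *\<^sub>R blinfun_apply x (f t))"
        unfolding \<pi>'_def
      proof (rule sum.mono_neutral_cong_right)
        show "finite \<D>" using D by blast
      next
        show "\<forall>i\<in>\<D> - {q \<in> \<D>. 0 < measure lebesgue (snd q)}.
            (case i of (t, K) \<Rightarrow> measure lborel K *\<^sub>R blinfun_apply x (f t)) = 0"
          using bor by (auto simp: zero_less_measure_iff)
      qed (use bor in auto)
      moreover have "F (cbox a b) = (\<Sum>(t, K)\<in>\<pi>'. F K)"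
        unfolding \<pi>'_def using additive_sum_tagged_division[OF F IE] D ab by blast
      ultimately have "(\<Sum>(t, K)\<in>\<D>. measure lborel K *\<^sub>R blinfun_apply x (f t)) - blinfun_apply x (F (cbox a b))
          = blinfun_apply x (\<Sum>(t, I)\<in>\<pi>'. measure lebesgue I *\<^sub>R f t - F I)"
        by (simp add: case_prod_beta blinfun.sum_right blinfun.diff_right blinfun.scaleR_right sum_subtractf)
      also have "norm \<dots> \<le> norm x * norm (\<Sum>(t, I)\<in>\<pi>'. measure lebesgue I *\<^sub>R f t - F I)"
        by (rule norm_blinfun)
      also have "\<dots> \<le> norm x * e'" using less by (intro mult_left_mono) auto
      also have "\<dots> < e" by (rule e')
      finally show "norm ((\<Sum>(t, K)\<in>\<D>. measure lborel K *\<^sub>R blinfun_apply x (f t)) - blinfun_apply x (F (cbox a b))) < e" .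
    qed
  qed
qed

text \<open>
  Otherwise finite families with large sums could be extracted outside one another forever, and
  together they would form a division with a divergent series.
\<close>

lemma additive_sum_extraction:
  fixes F :: "(real^'m) set \<Rightarrow> 'x::banach"
  assumes conv: "\<And>D. D \<in> divisions_in E \<Longrightarrow> series_convergent F D J"
    and UE: "U \<subseteq> E" and EJ: "E \<subseteq> J" and e: "0 < e"
  shows "\<exists>G. finite G \<and> G \<subseteq> intervals_in U \<and>
    (\<forall>C. finite C \<longrightarrow> C \<subseteq> intervals_in (U - \<Union>G) \<longrightarrow> pairwise nonoverlapping C \<longrightarrow> norm (sum F C) \<le> e)"
proof (rule ccontr)
  assume neg: "\<not> ?thesis"
  have ex: "\<exists>C. finite C \<and> C \<subseteq> intervals_in (U - \<Union>G) \<and> pairwise nonoverlapping C \<and> e < norm (sum F C)"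
    if "finite G" "G \<subseteq> intervals_in U" for G
    using that neg by (meson not_less)
  define P where "P G \<longleftrightarrow> finite G \<and> G \<subseteq> intervals_in U \<and> pairwise nonoverlapping G"
    for G :: "(real^'m) set set"
  \<comment> \<open>The new intervals are disjoint from \<open>\<Union>G\<close>, not merely
    non-overlapping with it. So no interval is chosen twice and all stages together stay
    non-overlapping.\<close>
  define R where "R G G' \<longleftrightarrow> (\<exists>C. G' = G \<union> C \<and> finite C \<and> C \<subseteq> intervals_in (U - \<Union>G) \<and> e < norm (sum F C))"
    for G G'
  have "\<exists>G. \<forall>n. P (G n) \<and> R (G n) (G (Suc n))"
  proof (rule dependent_nat_choice)
    show "\<exists>G. P G" by (rule exI[of _ "{}"]) (simp add: P_def)
    fix G and n :: nat assume G: "P G"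
    then obtain C where C: "finite C" "C \<subseteq> intervals_in (U - \<Union>G)" "pairwise nonoverlapping C" "e < norm (sum F C)"
      using ex[of G] by (auto simp: P_def)
    have "nonoverlapping K L" if "K \<in> G" "L \<in> C" for K L
    proof -
      have "K \<inter> L = {}" using that C(2) by (auto simp: intervals_in_def)
      then show ?thesis unfolding nonoverlapping_def using interior_subset by blast
    qed
    then have "pairwise nonoverlapping (G \<union> C)"
      using G C(3) unfolding P_def pairwise_def by (metis Un_iff nonoverlapping_sym)
    moreover have "C \<subseteq> intervals_in U" using C(2) by (auto simp: intervals_in_def)
    ultimately show "\<exists>G'. P G' \<and> R G G'"
      using G C by (intro exI[of _ "G \<union> C"]) (auto simp: P_def R_def)
  qed
  then obtain G where G: "\<And>n. P (G n)" "\<And>n. R (G n) (G (Suc n))" by blast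
  obtain C where C: "\<And>n. G (Suc n) = G n \<union> C n" "\<And>n. finite (C n)"
    "\<And>n. C n \<subseteq> intervals_in (U - \<Union>(G n))" "\<And>n. e < norm (sum F (C n))"
    using G(2) unfolding R_def by metis
  define T where "T = (\<Union>n. G n)"
  have mono: "G m \<subseteq> G n" if "m \<le> n" for m n
    using that by (rule lift_Suc_mono_le[of G, rotated]) (simp add: C(1))
  have CT: "C n \<subseteq> T" for n using C(1)[of n] by (auto simp: T_def)
  have disj: "C n \<inter> G n = {}" for n
  proof -
    have False if "K \<in> C n" "K \<in> G n" for K
      using that C(3)[of n] interval_nonempty[of K] by (auto simp: intervals_in_def)
    then show ?thesis by blast
  qed
  have ne: "C n \<noteq> {}" for n using C(4)[of n] e by auto
  have pw: "pairwise nonoverlapping T"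
  proof -
    have "nonoverlapping K L" if KL: "K \<in> G m" "L \<in> G n" "K \<noteq> L" for K L m n
    proof -
      have "K \<in> G (max m n)" "L \<in> G (max m n)"
        using KL mono[of m "max m n"] mono[of n "max m n"] by auto
      moreover have "pairwise nonoverlapping (G (max m n))" using G(1) by (simp add: P_def)
      ultimately show ?thesis using KL(3) by (auto simp: pairwise_def)
    qed
    then show ?thesis unfolding pairwise_def T_def by blast
  qed
  have fsub: "\<exists>n. S \<subseteq> G n" if S: "finite S" "S \<subseteq> T" for S
    using S
  proof (induction S)
    case (insert K S)
    then obtain m n where "S \<subseteq> G m" "K \<in> G n" by (auto simp: T_def)
    then have "insert K S \<subseteq> G (max m n)"
      using mono[of m "max m n"] mono[of n "max m n"] by auto
    then show ?case by blast
  qed auto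
  \<comment> \<open>A division is an infinite sequence, so \<open>T\<close> must be enumerated
    bijectively by all natural numbers. Every stage adds an interval, because a sum of norm above
    \<open>e\<close> is not empty.\<close>
  have inf: "infinite T"
  proof
    assume "finite T"
    then obtain n where "T \<subseteq> G n" using fsub by blast
    then show False using CT[of n] disj[of n] ne[of n] by blast
  qed
  have cnt: "countable T" unfolding T_def using G(1) by (auto simp: P_def intro: countable_finite)
  define D where "D = from_nat_into T"
  have bij: "bij_betw D UNIV T" unfolding D_def by (rule bij_betw_from_nat_into[OF cnt inf])
  have DT: "D k \<in> T" for k using bij by (auto simp: bij_betw_def)
  have TU: "T \<subseteq> intervals_in U" using G(1) by (auto simp: P_def T_def)
  have "D \<in> divisions_in E"
    unfolding divisions_in_def
  proof (intro CollectI conjI allI impI)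
    show "D k \<in> intervals_in E" for k using DT TU UE by (auto simp: intervals_in_def)
    show "nonoverlapping (D j) (D k)" if "j \<noteq> k" for j k
    proof -
      have "D j \<noteq> D k" using that bij by (auto simp: bij_betw_def inj_def)
      then show ?thesis using pw DT by (auto simp: pairwise_def)
    qed
  qed
  then have "series_convergent F D J" by (rule conv)
  \<comment> \<open>As \<open>J\<close> contains all of \<open>E\<close>, the series over
    \<open>J\<close> is the plain series of the values \<open>F (D k)\<close>.\<close>
  moreover have JD: "J \<inter> D k = D k" for k using DT[of k] TU UE EJ by (auto simp: intervals_in_def)
  moreover have "meeting D J = UNIV"
    unfolding meeting_def JD using DT TU interval_measure_pos by (auto simp: intervals_in_def)
  ultimately have "(\<lambda>k. F (D k)) summable_on UNIV" by (simp add: series_convergent_def)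
  then have "F summable_on T" using summable_on_reindex_bij_betw[OF bij, of F] by simp
  then obtain s where "(F has_sum s) T" by (auto simp: summable_on_def)
  then have "eventually (\<lambda>X. dist (sum F X) s < e / 2) (finite_subsets_at_top T)"
    unfolding has_sum_def by (rule tendstoD) (use e in simp)
  then obtain S where S: "finite S" "S \<subseteq> T"
    and close: "\<forall>Y. finite Y \<and> S \<subseteq> Y \<and> Y \<subseteq> T \<longrightarrow> dist (sum F Y) s < e / 2"
    unfolding eventually_finite_subsets_at_top by blast
  obtain n where n: "S \<subseteq> G n" using fsub[OF S] by blast
  have fG: "finite (G n)" using G(1) by (simp add: P_def)
  have GT: "G n \<subseteq> T" by (auto simp: T_def)
  \<comment> \<open>Both index sets contain \<open>S\<close>, so both partial sums are within
    \<open>e / 2\<close> of \<open>s\<close>; but they differ by \<open>sum F (C n)\<close>, whose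
    norm exceeds \<open>e\<close>.\<close>
  have "dist (sum F (G n \<union> C n)) (sum F (G n)) < e"
  proof (rule dist_triangle_half_l)
    show "dist (sum F (G n \<union> C n)) s < e / 2"
      using close[rule_format, of "G n \<union> C n"] fG C(2)[of n] n GT CT[of n] by auto
    show "dist (sum F (G n)) s < e / 2"
      using close[rule_format, of "G n"] fG n GT by auto
  qed
  moreover have "sum F (G n \<union> C n) = sum F (G n) + sum F (C n)"
    using fG C(2) disj by (intro sum.union_disjoint) auto
  ultimately show False using C(4)[of n] by (simp add: dist_norm)
qed

subsection \<open>Absolute integrability and bounded interval sums\<close>

text \<open>Henstock's lemma is used for \<open>g\<close> and for its absolute value on one common
  division. On each cell the terms of the two Riemann sums agree up to sign, so the integral of the
  absolute value exceeds the absolute value of the integral by at most the two errors.\<close>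

lemma box_abs_integral_le_division_sum:
  fixes g :: "real^'m \<Rightarrow> real"
  assumes g: "g absolutely_integrable_on cbox a b" and e: "0 < e"
  shows "\<exists>d. d division_of cbox a b \<and>
    integral (cbox a b) (\<lambda>t. \<bar>g t\<bar>) \<le> (\<Sum>K\<in>d. \<bar>integral K g\<bar>) + e"
proof -
  have int: "g integrable_on cbox a b" "(\<lambda>t. \<bar>g t\<bar>) integrable_on cbox a b"
    using g by (auto simp: absolutely_integrable_on_def)
  obtain \<gamma>1 where \<gamma>1: "gauge \<gamma>1" "\<And>p. p tagged_partial_division_of cbox a b \<Longrightarrow> \<gamma>1 fine p \<Longrightarrow>
      (\<Sum>(x,k)\<in>p. norm (measure lborel k *\<^sub>R g x - integral k g)) < e / 2"
    using Henstock_lemma[OF int(1), of "e / 2"] e by auto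
  obtain \<gamma>2 where \<gamma>2: "gauge \<gamma>2" "\<And>p. p tagged_partial_division_of cbox a b \<Longrightarrow> \<gamma>2 fine p \<Longrightarrow>
      (\<Sum>(x,k)\<in>p. norm (measure lborel k *\<^sub>R \<bar>g x\<bar> - integral k (\<lambda>t. \<bar>g t\<bar>))) < e / 2"
    using Henstock_lemma[OF int(2), of "e / 2"] e by auto
  obtain p where p: "p tagged_division_of cbox a b" and fin: "(\<lambda>x. \<gamma>1 x \<inter> \<gamma>2 x) fine p"
    using fine_division_exists[OF gauge_Int[OF \<gamma>1(1) \<gamma>2(1)]] .
  have pp: "p tagged_partial_division_of cbox a b" using p by (simp add: tagged_division_of_def)
  have 1: "(\<Sum>(x,k)\<in>p. \<bar>measure lborel k * g x - integral k g\<bar>) < e / 2"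
    using \<gamma>1(2)[OF pp] fin by (simp add: fine_Int)
  have 2: "(\<Sum>(x,k)\<in>p. \<bar>measure lborel k * \<bar>g x\<bar> - integral k (\<lambda>t. \<bar>g t\<bar>)\<bar>) < e / 2"
    using \<gamma>2(2)[OF pp] fin by (simp add: fine_Int)
  have "integral (cbox a b) (\<lambda>t. \<bar>g t\<bar>) = (\<Sum>(x,k)\<in>p. integral k (\<lambda>t. \<bar>g t\<bar>))"
    by (rule integral_combine_tagged_division_topdown[OF int(2) p])
  also have "\<dots> \<le> (\<Sum>(x,k)\<in>p. \<bar>integral k g\<bar> + \<bar>measure lborel k * g x - integral k g\<bar>
      + \<bar>measure lborel k * \<bar>g x\<bar> - integral k (\<lambda>t. \<bar>g t\<bar>)\<bar>)"
  proof (rule sum_mono, clarify)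
    fix x and k :: "(real^'m) set"
    have "measure lborel k * \<bar>g x\<bar> = \<bar>measure lborel k * g x\<bar>" by (simp add: abs_mult)
    then show "integral k (\<lambda>t. \<bar>g t\<bar>) \<le> \<bar>integral k g\<bar> + \<bar>measure lborel k * g x - integral k g\<bar>
      + \<bar>measure lborel k * \<bar>g x\<bar> - integral k (\<lambda>t. \<bar>g t\<bar>)\<bar>" by linarith
  qed
  also have "\<dots> = (\<Sum>(x,k)\<in>p. \<bar>integral k g\<bar>) + (\<Sum>(x,k)\<in>p. \<bar>measure lborel k * g x - integral k g\<bar>)
      + (\<Sum>(x,k)\<in>p. \<bar>measure lborel k * \<bar>g x\<bar> - integral k (\<lambda>t. \<bar>g t\<bar>)\<bar>)"
    by (simp add: case_prod_beta sum.distrib)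
  also have "\<dots> \<le> (\<Sum>(x,k)\<in>p. \<bar>integral k g\<bar>) + e" using 1 2 by linarith
  also have "(\<Sum>(x,k)\<in>p. \<bar>integral k g\<bar>) = (\<Sum>K\<in>snd ` p. \<bar>integral K g\<bar>)"
    by (rule sum.over_tagged_division_lemma[OF p]) (simp add: content_eq_0_interior)
  finally show ?thesis using division_of_tagged_division[OF p] by blast
qed

text \<open>After refinement of the cells, the integral of the absolute value is nearly a sum of
  absolute values of interval integrals. Every subfamily has a signed sum of size at most
  \<open>e\<close>; the terms of each sign form such subfamilies, whence the factor 2.\<close>

lemma elementary_abs_integral_le:
  fixes g :: "real^'m \<Rightarrow> real"
  assumes d: "d division_of S"
    and loc: "\<And>K. K \<in> d \<Longrightarrow> g absolutely_integrable_on K"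
    and bd: "\<And>C. finite C \<Longrightarrow> C \<subseteq> intervals_in S \<Longrightarrow> pairwise nonoverlapping C \<Longrightarrow> \<bar>\<Sum>K\<in>C. integral K g\<bar> \<le> e"
  shows "g absolutely_integrable_on S" "integral S (\<lambda>t. \<bar>g t\<bar>) \<le> 2 * e"
proof -
  note D = division_ofD[OF d]
  have hi: "((\<lambda>t. \<bar>g t\<bar>) has_integral (\<Sum>K\<in>d. integral K (\<lambda>t. \<bar>g t\<bar>))) S"
    using loc by (intro has_integral_combine_division[OF d] integrable_integral) (auto simp: absolutely_integrable_on_def)
  moreover have "(g has_integral (\<Sum>K\<in>d. integral K g)) S"
    using loc by (intro has_integral_combine_division[OF d] integrable_integral) (auto simp: absolutely_integrable_on_def)
  ultimately show "g absolutely_integrable_on S"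
    unfolding absolutely_integrable_on_def by (auto dest: has_integral_integrable)
  have "integral S (\<lambda>t. \<bar>g t\<bar>) \<le> 2 * e + \<eta>" if \<eta>: "0 < \<eta>" for \<eta>
  proof -
    \<comment> \<open>The error is distributed over the cells of \<open>d\<close>; the summand 1
      covers an empty division.\<close>
    define \<eta>' where "\<eta>' = \<eta> / (real (card d) + 1)"
    have \<eta>': "0 < \<eta>'" "real (card d) * \<eta>' \<le> \<eta>" using \<eta> by (auto simp: \<eta>'_def field_simps)
    have "\<forall>K\<in>d. \<exists>p. p division_of K \<and> integral K (\<lambda>t. \<bar>g t\<bar>) \<le> (\<Sum>L\<in>p. \<bar>integral L g\<bar>) + \<eta>'"
      using box_abs_integral_le_division_sum[OF _ \<eta>'(1)] loc D(4) by metis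
    then obtain p where p: "\<And>K. K \<in> d \<Longrightarrow> p K division_of K"
      "\<And>K. K \<in> d \<Longrightarrow> integral K (\<lambda>t. \<bar>g t\<bar>) \<le> (\<Sum>L\<in>p K. \<bar>integral L g\<bar>) + \<eta>'"
      by metis
    define q where "q K = {L \<in> p K. 0 < measure lebesgue L}" for K
    define C where "C = (\<Union>K\<in>d. q K)"
    have finq: "finite (q K)" if "K \<in> d" for K
      using division_ofD(1)[OF p(1)[OF that]] by (simp add: q_def)
    have qint: "L \<in> intervals" "L \<subseteq> K" if KL: "K \<in> d" "L \<in> q K" for K L
    proof -
      have L: "L \<in> p K" "0 < measure lebesgue L" using KL(2) by (auto simp: q_def)
      obtain a b where "L = cbox a b" using division_ofD(4)[OF p(1)[OF KL(1)] L(1)] by blast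
      then show "L \<in> intervals" using L(2) by (auto intro: cbox_in_intervals)
      show "L \<subseteq> K" using division_ofD(2)[OF p(1)[OF KL(1)] L(1)] .
    qed
    have nov: "nonoverlapping L L'" if "K \<in> d" "K' \<in> d" "L \<in> q K" "L' \<in> q K'" "K \<noteq> K'" for K K' L L'
      using D(5)[OF that(1,2,5)] qint[OF that(1,3)] qint[OF that(2,4)]
      by (auto intro: nonoverlapping_mono[of K K'] simp: nonoverlapping_def[of K K'])
    have pw: "pairwise nonoverlapping C"
      unfolding pairwise_def
    proof (intro ballI impI)
      fix L L' assume "L \<in> C" "L' \<in> C" and ne: "L \<noteq> L'"
      then obtain K K' where K: "K \<in> d" "K' \<in> d" "L \<in> q K" "L' \<in> q K'" by (auto simp: C_def)
      show "nonoverlapping L L'"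
      proof (cases "K = K'")
        case True
        then show ?thesis using division_ofD(5)[OF p(1)[OF K(1)], of L L'] K ne
          by (simp add: q_def nonoverlapping_def)
      qed (rule nov[OF K])
    qed
    have Cin: "C \<subseteq> intervals_in S"
    proof
      fix L assume "L \<in> C"
      then obtain K where "K \<in> d" "L \<in> q K" by (auto simp: C_def)
      then show "L \<in> intervals_in S" using qint[of K L] D(2)[of K] by (auto simp: intervals_in_def)
    qed
    have finC: "finite C" using finq D(1) by (auto simp: C_def)
    have "integral S (\<lambda>t. \<bar>g t\<bar>) = (\<Sum>K\<in>d. integral K (\<lambda>t. \<bar>g t\<bar>))"
      using hi by (rule integral_unique)
    also have "\<dots> \<le> (\<Sum>K\<in>d. (\<Sum>L\<in>p K. \<bar>integral L g\<bar>) + \<eta>')"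
      using p(2) by (rule sum_mono)
    also have "\<dots> = (\<Sum>K\<in>d. \<Sum>L\<in>p K. \<bar>integral L g\<bar>) + real (card d) * \<eta>'"
      by (simp add: sum.distrib)
    also have "(\<Sum>K\<in>d. \<Sum>L\<in>p K. \<bar>integral L g\<bar>) = (\<Sum>K\<in>d. \<Sum>L\<in>q K. \<bar>integral L g\<bar>)"
    proof (rule sum.cong[OF refl], rule sum.mono_neutral_right)
      fix K assume K: "K \<in> d"
      show "finite (p K)" using division_ofD(1)[OF p(1)[OF K]] .
      show "q K \<subseteq> p K" by (auto simp: q_def)
      show "\<forall>L\<in>p K - q K. \<bar>integral L g\<bar> = 0"
      proof
        fix L assume L: "L \<in> p K - q K"
        then obtain a b where "L = cbox a b" using division_ofD(4)[OF p(1)[OF K]] by blast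
        with L show "\<bar>integral L g\<bar> = 0" by (auto simp: q_def zero_less_measure_iff)
      qed
    qed
    also have "\<dots> = (\<Sum>L\<in>C. \<bar>integral L g\<bar>)"
      unfolding C_def
    proof (rule sum.UNION_disjoint[symmetric])
      show "finite d" by (rule D(1))
      show "\<forall>K\<in>d. finite (q K)" using finq by blast
      show "\<forall>K\<in>d. \<forall>K'\<in>d. K \<noteq> K' \<longrightarrow> q K \<inter> q K' = {}"
      proof (intro ballI impI)
        fix K K' assume K: "K \<in> d" "K' \<in> d" "K \<noteq> K'"
        have False if "L \<in> q K" "L \<in> q K'" for L
          using nov[OF K(1,2) that K(3)] interval_interior_nonempty[OF qint(1)[OF K(1) that(1)]]
          by (simp add: nonoverlapping_def)
        then show "q K \<inter> q K' = {}" by blast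
      qed
    qed
    also have "(\<Sum>L\<in>C. \<bar>integral L g\<bar>) \<le> 2 * e"
    proof -
      have "norm (\<Sum>L\<in>Q. integral L g) \<le> e" if "Q \<subseteq> C" for Q
        using bd[of Q] that finC Cin pw by (auto intro: finite_subset pairwise_subset)
      from sum_norm_allsubsets_bound[OF finC this] show ?thesis by simp
    qed
    finally show ?thesis using \<eta>'(2) by linarith
  qed
  then show "integral S (\<lambda>t. \<bar>g t\<bar>) \<le> 2 * e" by (rule field_le_epsilon)
qed

text \<open>An open set is exhausted by finite unions of boxes, on which the bound
  \<open>2 * e\<close> holds uniformly. Monotone convergence carries over the absolute value, and
  that limit then dominates \<open>g\<close> itself. This turns bounds on sums of interval integrals
  into integrability up to the boundary.\<close>

lemma absolutely_integrable_open_bounded_sums: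
  fixes g :: "real^'m \<Rightarrow> real"
  assumes V: "open V"
    and loc: "\<And>a b. cbox a b \<subseteq> V \<Longrightarrow> g absolutely_integrable_on cbox a b"
    and bd: "\<And>C. finite C \<Longrightarrow> C \<subseteq> intervals_in V \<Longrightarrow> pairwise nonoverlapping C \<Longrightarrow> \<bar>\<Sum>K\<in>C. integral K g\<bar> \<le> e"
  shows "g absolutely_integrable_on V" "integral V (\<lambda>t. \<bar>g t\<bar>) \<le> 2 * e"
proof -
  obtain \<D> where \<D>: "countable \<D>" "\<D> \<subseteq> Pow V" "\<And>X. X \<in> \<D> \<Longrightarrow> \<exists>a b. X = cbox a b" "\<Union>\<D> = V"
    using open_countable_Union_open_cbox[OF V] by metis
  \<comment> \<open>The empty set is added because enumeration by \<open>from_nat_into\<close> needs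
    a non-empty set, while \<open>\<D>\<close> may be empty.\<close>
  define f where "f = from_nat_into (insert {} \<D>)"
  have ran: "range f = insert {} \<D>" unfolding f_def using \<D>(1) by (intro range_from_nat_into) auto
  have fbox: "\<exists>a b. f n = cbox a b" for n
    using ran \<D>(3) empty_as_interval by (metis insertE rangeI)
  have fV: "f n \<subseteq> V" for n using ran \<D>(2) by (metis Pow_iff empty_subsetI insert_subset rangeI subsetD subset_insertI insert_iff)
  define S where "S n = (\<Union>i\<le>n. f i)" for n :: nat
  have SV: "S n \<subseteq> V" for n using fV by (auto simp: S_def)
  have US: "(\<Union>n. S n) = V"
  proof -
    have "(\<Union>n. S n) = \<Union>(range f)" by (auto simp: S_def)
    then show ?thesis using ran \<D>(4) by simp
  qed
  have S: "g absolutely_integrable_on S n" "integral (S n) (\<lambda>t. \<bar>g t\<bar>) \<le> 2 * e" for n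
  proof -
    obtain d where d: "d division_of \<Union>(f ` {..n})"
      using elementary_unions_intervals[of "f ` {..n}"] fbox by (metis finite_atMost finite_imageI imageE)
    have d': "d division_of S n" using d by (simp add: S_def)
    have "g absolutely_integrable_on K" if "K \<in> d" for K
      using division_ofD(2,4)[OF d' that] SV loc by (metis order_trans)
    moreover have "\<bar>\<Sum>K\<in>C. integral K g\<bar> \<le> e" if "finite C" "C \<subseteq> intervals_in (S n)" "pairwise nonoverlapping C" for C
      using that SV[of n] by (intro bd) (auto simp: intervals_in_def)
    ultimately show "g absolutely_integrable_on S n" "integral (S n) (\<lambda>t. \<bar>g t\<bar>) \<le> 2 * e"
      using elementary_abs_integral_le[OF d', of g e] by auto
  qed
  define h where "h n t = (if t \<in> S n then \<bar>g t\<bar> else 0)" for n t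
  have hint: "h n integrable_on UNIV" and hval: "integral UNIV (h n) = integral (S n) (\<lambda>t. \<bar>g t\<bar>)" for n
    using S(1)[of n] unfolding h_def absolutely_integrable_on_def
    by (auto simp: integrable_restrict_UNIV integral_restrict_UNIV)
  have mono: "S n \<subseteq> S (Suc n)" for n unfolding S_def by (intro UN_mono) auto
  have inS: "eventually (\<lambda>n. t \<in> S n) sequentially" if tV: "t \<in> V" for t
  proof -
    obtain N where "t \<in> S N" using tV US by blast
    moreover have "S N \<subseteq> S n" if "N \<le> n" for n
      using mono that by (rule lift_Suc_mono_le)
    ultimately show ?thesis unfolding eventually_sequentially by blast
  qed
  have ev: "(\<lambda>n. if t \<in> S n then y else 0) \<longlonglongrightarrow> (if t \<in> V then y else 0)" for t and y :: real
  proof (cases "t \<in> V")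
    case True
    then show ?thesis by (intro tendsto_eventually eventually_mono[OF inS[OF True]]) simp
  next
    case False
    then have "t \<notin> S n" for n using SV by blast
    then show ?thesis using False by simp
  qed
  define H where "H t = (if t \<in> V then \<bar>g t\<bar> else 0)" for t
  have nn: "0 \<le> integral UNIV (h n)" for n
    by (rule integral_nonneg[OF hint]) (simp add: h_def)
  have mc: "H integrable_on UNIV \<and> (\<lambda>n. integral UNIV (h n)) \<longlonglongrightarrow> integral UNIV H"
  proof (rule monotone_convergence_increasing)
    show "h n integrable_on UNIV" for n by (rule hint)
    show "h n t \<le> h (Suc n) t" for n t using mono[of n] by (auto simp: h_def)
    show "(\<lambda>n. h n t) \<longlonglongrightarrow> H t" for t unfolding h_def H_def by (rule ev)
    show "bounded (range (\<lambda>n. integral UNIV (h n)))"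
      unfolding bounded_iff using nn S(2) hval by (intro exI[of _ "2 * e"]) auto
  qed
  have "integral UNIV H \<le> 2 * e"
    using mc S(2) hval by (intro LIMSEQ_le_const2[of "\<lambda>n. integral UNIV (h n)"]) auto
  moreover have "integral UNIV H = integral V (\<lambda>t. \<bar>g t\<bar>)"
    unfolding H_def by (rule integral_restrict_UNIV)
  ultimately show "integral V (\<lambda>t. \<bar>g t\<bar>) \<le> 2 * e" by simp
  have "(\<lambda>t. if t \<in> V then g t else 0) integrable_on UNIV"
  proof (rule dominated_convergence(1))
    show "(\<lambda>t. if t \<in> S n then g t else 0) integrable_on UNIV" for n
      using S(1)[of n] by (auto simp: integrable_restrict_UNIV absolutely_integrable_on_def)
    show "H integrable_on UNIV" using mc by blast
    show "norm (if t \<in> S n then g t else 0) \<le> H t" for n t using SV[of n] by (auto simp: H_def)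
    show "(\<lambda>n. if t \<in> S n then g t else 0) \<longlonglongrightarrow> (if t \<in> V then g t else 0)" for t by (rule ev)
  qed
  then show "g absolutely_integrable_on V"
    using mc unfolding absolutely_integrable_on_def H_def by (simp add: integrable_restrict_UNIV)
qed

section \<open>Integrals of absolute values as a set function: monotonicity, subadditivity and
  disjoint families\<close>

lemma absolutely_integrable_on_subset:
  fixes g :: "real^'m \<Rightarrow> real"
  assumes "g absolutely_integrable_on S" "A \<in> sets lebesgue" "A \<subseteq> S"
  shows "g absolutely_integrable_on A" "g integrable_on A" "(\<lambda>t. \<bar>g t\<bar>) integrable_on A"
proof -
  show *: "g absolutely_integrable_on A" using assms by (rule set_integrable_subset)
  from * show "g integrable_on A" "(\<lambda>t. \<bar>g t\<bar>) integrable_on A"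
    unfolding absolutely_integrable_on_def by simp_all
qed

lemma abs_integral_mono:
  fixes g :: "real^'m \<Rightarrow> real"
  assumes "g absolutely_integrable_on S" "A \<in> sets lebesgue" "B \<in> sets lebesgue" "A \<subseteq> B" "B \<subseteq> S"
  shows "integral A (\<lambda>t. \<bar>g t\<bar>) \<le> integral B (\<lambda>t. \<bar>g t\<bar>)"
  using assms by (intro integral_subset_le absolutely_integrable_on_subset(3)[OF assms(1)]) auto

lemma abs_integral_Un_le:
  fixes g :: "real^'m \<Rightarrow> real"
  assumes g: "g absolutely_integrable_on S" and sets: "A \<in> sets lebesgue" "B \<in> sets lebesgue" "A \<subseteq> S" "B \<subseteq> S"
  shows "integral (A \<union> B) (\<lambda>t. \<bar>g t\<bar>) \<le> integral A (\<lambda>t. \<bar>g t\<bar>) + integral B (\<lambda>t. \<bar>g t\<bar>)"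
proof -
  have "((\<lambda>t. \<bar>g t\<bar>) has_integral integral A (\<lambda>t. \<bar>g t\<bar>) + integral (B - A) (\<lambda>t. \<bar>g t\<bar>)) (A \<union> (B - A))"
    using sets by (intro has_integral_Un integrable_integral absolutely_integrable_on_subset[OF g]) auto
  then have "integral (A \<union> B) (\<lambda>t. \<bar>g t\<bar>) = integral A (\<lambda>t. \<bar>g t\<bar>) + integral (B - A) (\<lambda>t. \<bar>g t\<bar>)"
    by (simp add: integral_unique)
  also have "integral (B - A) (\<lambda>t. \<bar>g t\<bar>) \<le> integral B (\<lambda>t. \<bar>g t\<bar>)"
    using sets by (intro abs_integral_mono[OF g]) auto
  finally show ?thesis by simp
qed

lemma abs_integral_UN_le:
  fixes g :: "real^'m \<Rightarrow> real"
  assumes g: "g absolutely_integrable_on S" and fin: "finite I"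
    and sets: "\<And>i. i \<in> I \<Longrightarrow> B i \<in> sets lebesgue" "\<And>i. i \<in> I \<Longrightarrow> B i \<subseteq> S"
  shows "integral (\<Union>i\<in>I. B i) (\<lambda>t. \<bar>g t\<bar>) \<le> (\<Sum>i\<in>I. integral (B i) (\<lambda>t. \<bar>g t\<bar>))"
  using fin sets
proof (induction I)
  case (insert i I)
  have "integral (B i \<union> (\<Union>i\<in>I. B i)) (\<lambda>t. \<bar>g t\<bar>)
      \<le> integral (B i) (\<lambda>t. \<bar>g t\<bar>) + integral (\<Union>i\<in>I. B i) (\<lambda>t. \<bar>g t\<bar>)"
    using insert by (intro abs_integral_Un_le[OF g]) (auto intro!: sets.finite_UN)
  then show ?case using insert by simp
qed simp

lemma abs_integral_almost_disjoint_le: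
  fixes g :: "real^'m \<Rightarrow> real"
  assumes g: "g absolutely_integrable_on S" and fin: "finite P"
    and sets: "\<And>i. i \<in> P \<Longrightarrow> K i \<in> sets lebesgue" "\<And>i. i \<in> P \<Longrightarrow> K i \<subseteq> A"
    and disj: "\<And>i j. i \<in> P \<Longrightarrow> j \<in> P \<Longrightarrow> i \<noteq> j \<Longrightarrow> negligible (K i \<inter> K j)"
    and A: "A \<in> sets lebesgue" "A \<subseteq> S"
  shows "(\<Sum>i\<in>P. integral (K i) (\<lambda>t. \<bar>g t\<bar>)) \<le> integral A (\<lambda>t. \<bar>g t\<bar>)"
proof -
  have "((\<lambda>t. \<bar>g t\<bar>) has_integral (\<Sum>i\<in>P. integral (K i) (\<lambda>t. \<bar>g t\<bar>))) (\<Union>i\<in>P. K i)"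
  proof (rule has_integral_UN[OF fin])
    show "((\<lambda>t. \<bar>g t\<bar>) has_integral integral (K i) (\<lambda>t. \<bar>g t\<bar>)) (K i)" if "i \<in> P" for i
      using sets(1)[OF that] sets(2)[OF that] A(2)
      by (intro integrable_integral absolutely_integrable_on_subset[OF g]) auto
    show "pairwise (\<lambda>i i'. negligible (K i \<inter> K i')) P"
      using disj by (auto simp: pairwise_def)
  qed
  then have "(\<Sum>i\<in>P. integral (K i) (\<lambda>t. \<bar>g t\<bar>)) = integral (\<Union>i\<in>P. K i) (\<lambda>t. \<bar>g t\<bar>)"
    by (simp add: integral_unique)
  also have "\<dots> \<le> integral A (\<lambda>t. \<bar>g t\<bar>)"
    using sets A fin by (intro abs_integral_mono[OF g]) (auto intro!: sets.finite_UN)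
  finally show ?thesis .
qed

lemma abs_integral_family_le:
  fixes g :: "real^'m \<Rightarrow> real"
  assumes g: "g absolutely_integrable_on S" and fin: "finite P"
    and sets: "\<And>i. i \<in> P \<Longrightarrow> K i \<in> intervals" "\<And>i. i \<in> P \<Longrightarrow> K i \<subseteq> A"
    and nov: "\<And>i j. i \<in> P \<Longrightarrow> j \<in> P \<Longrightarrow> i \<noteq> j \<Longrightarrow> nonoverlapping (K i) (K j)"
    and A: "A \<in> sets lebesgue" "A \<subseteq> S"
  shows "(\<Sum>i\<in>P. integral (K i) (\<lambda>t. \<bar>g t\<bar>)) \<le> integral A (\<lambda>t. \<bar>g t\<bar>)"
proof (rule abs_integral_almost_disjoint_le[OF g fin _ sets(2) _ A])
  show "K i \<in> sets lebesgue" if "i \<in> P" for i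
    using interval_lmeasurable[OF sets(1)[OF that]] by (rule fmeasurableD)
  show "negligible (K i \<inter> K j)" if "i \<in> P" "j \<in> P" "i \<noteq> j" for i j
    using that by (intro nonoverlapping_negligible sets(1) nov)
qed

lemma integral_abs_bound_subset:
  fixes g :: "real^'m \<Rightarrow> real"
  assumes "g absolutely_integrable_on S" "A \<in> sets lebesgue" "A \<subseteq> S"
  shows "\<bar>integral A g\<bar> \<le> integral A (\<lambda>t. \<bar>g t\<bar>)"
proof -
  have "norm (integral A g) \<le> integral A (\<lambda>t. \<bar>g t\<bar>)"
    by (rule integral_norm_bound_integral) (use absolutely_integrable_on_subset[OF assms] in simp_all)
  then show ?thesis by simp
qed

subsection \<open>Uniform absolute continuity\<close>

text \<open>Everything is stated over the interior, since \<open>primitive\<close> is known only for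
  intervals inside it. The gauge estimate is not among the assumptions: uniform absolute continuity
  rests on the series condition, and the estimate enters later as the hypothesis
  \<open>HK\<close>.\<close>

locale Dunford_primitive =
  fixes I0 :: "(real^'m) set" and f :: "real^'m \<Rightarrow> 'x::banach" and F :: "(real^'m) set \<Rightarrow> 'x"
  assumes interval: "I0 \<in> intervals"
    and scalar_integrable: "\<And>x::'x \<Rightarrow>\<^sub>L real. (\<lambda>t. blinfun_apply x (f t)) absolutely_integrable_on interior I0"
    and additive: "additive_interval_function I0 F"
    and series: "\<And>D J. D \<in> divisions_in I0 \<Longrightarrow> J \<in> intervals \<Longrightarrow> series_convergent F D J"
    and primitive: "\<And>(x::'x \<Rightarrow>\<^sub>L real) I. I \<in> intervals_in (interior I0) \<Longrightarrow>
      integral I (\<lambda>t. blinfun_apply x (f t)) = blinfun_apply x (F I)"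
begin

abbreviation mass :: "('x \<Rightarrow>\<^sub>L real) \<Rightarrow> (real^'m) set \<Rightarrow> real" where
  "mass x A \<equiv> integral A (\<lambda>t. \<bar>blinfun_apply x (f t)\<bar>)"

lemma lmeasurable_subset: "A \<in> sets lebesgue \<Longrightarrow> A \<subseteq> interior I0 \<Longrightarrow> A \<in> lmeasurable"
  using interval_compact[OF interval] interior_subset
  by (meson bounded_set_imp_lmeasurable bounded_subset compact_imp_bounded)

lemma sets_lebesgue_open: "open A \<Longrightarrow> A \<in> sets lebesgue"
  by simp

lemma sets_lebesgue_compact: "compact A \<Longrightarrow> A \<in> sets (lebesgue :: (real^'m) measure)"
  by (simp add: compact_imp_closed borel_closed)

text \<open>\<open>K\<close> is the union of the finite family supplied by
  \<open>additive_sum_extraction\<close>. Off \<open>K\<close> all finite sums of \<open>F\<close>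
  have norm at most \<open>e / 2\<close>, a bound free of \<open>x\<close>, so one \<open>K\<close>
  serves the whole dual unit ball.\<close>

lemma compact_inner_approximation:
  assumes U: "open U" "U \<subseteq> interior I0" and e: "0 < e"
  shows "\<exists>K. compact K \<and> K \<subseteq> U \<and> (\<forall>x::'x \<Rightarrow>\<^sub>L real. norm x \<le> 1 \<longrightarrow> mass x (U - K) \<le> e)"
proof -
  have "\<exists>G. finite G \<and> G \<subseteq> intervals_in U \<and>
    (\<forall>C. finite C \<longrightarrow> C \<subseteq> intervals_in (U - \<Union>G) \<longrightarrow> pairwise nonoverlapping C \<longrightarrow> norm (sum F C) \<le> e / 2)"
  proof (rule additive_sum_extraction)
    show "series_convergent F D I0" if "D \<in> divisions_in I0" for D
      using that interval by (rule series)
    show "U \<subseteq> I0" using U(2) interior_subset by (rule order_trans)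
  qed (use e in simp_all)
  then obtain G where G: "finite G" "G \<subseteq> intervals_in U"
    and bd: "\<And>C. finite C \<Longrightarrow> C \<subseteq> intervals_in (U - \<Union>G) \<Longrightarrow> pairwise nonoverlapping C \<Longrightarrow> norm (sum F C) \<le> e / 2"
    by (elim exE conjE) metis
  have K: "compact (\<Union>G)"
    using G interval_compact by (intro compact_Union) (auto simp: intervals_in_def)
  have KU: "\<Union>G \<subseteq> U" using G(2) by (auto simp: intervals_in_def)
  have op: "open (U - \<Union>G)" using U(1) K by (intro open_Diff) (auto intro: compact_imp_closed)
  have "mass x (U - \<Union>G) \<le> e" if x: "norm x \<le> 1" for x :: "'x \<Rightarrow>\<^sub>L real"
  proof -
    have "mass x (U - \<Union>G) \<le> 2 * (e / 2)"
    proof (rule absolutely_integrable_open_bounded_sums(2)[OF op])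
      show "(\<lambda>t. blinfun_apply x (f t)) absolutely_integrable_on cbox a b" if "cbox a b \<subseteq> U - \<Union>G" for a b
        using that U(2) by (intro absolutely_integrable_on_subset(1)[OF scalar_integrable]) auto
    next
      fix C assume C: "finite C" "C \<subseteq> intervals_in (U - \<Union>G)" "pairwise nonoverlapping C"
      have "(\<Sum>K\<in>C. integral K (\<lambda>t. blinfun_apply x (f t))) = (\<Sum>K\<in>C. blinfun_apply x (F K))"
        using C(2) U(2) by (intro sum.cong refl primitive) (auto simp: intervals_in_def)
      also have "\<dots> = blinfun_apply x (sum F C)" by (simp add: blinfun.sum_right)
      also have "\<bar>\<dots>\<bar> \<le> norm x * norm (sum F C)" using norm_blinfun[of x "sum F C"] by simp
      also have "\<dots> \<le> 1 * (e / 2)" using x bd[OF C] by (intro mult_mono) auto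
      finally show "\<bar>\<Sum>K\<in>C. integral K (\<lambda>t. blinfun_apply x (f t))\<bar> \<le> e / 2" by simp
    qed
    then show ?thesis by simp
  qed
  then show ?thesis using K KU by blast
qed

text \<open>A counterexample supplies sets of measure below \<open>(1/2)^n\<close> with functionals
  that vary with \<open>n\<close>, so absolute continuity for a single functional does not help.
  Compact approximations uniform in the functional are used instead. The tails of open hulls have a
  null intersection; compactness moves the smallness near that intersection to a finite stage
  \<open>N\<close>, where it contradicts the choice of \<open>A N\<close>.\<close>

lemma uniformly_absolutely_continuous:
  assumes e: "0 < e"
  shows "\<exists>\<eta>>0. \<forall>A (x::'x \<Rightarrow>\<^sub>L real). A \<in> sets lebesgue \<longrightarrow> A \<subseteq> interior I0 \<longrightarrow>
    measure lebesgue A < \<eta> \<longrightarrow> norm x \<le> 1 \<longrightarrow> mass x A \<le> e"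
proof (rule ccontr)
  assume neg: "\<not> ?thesis"
  have "\<exists>A x. A \<in> sets lebesgue \<and> A \<subseteq> interior I0 \<and> measure lebesgue A < (1/2)^n \<and> norm x \<le> 1 \<and> e < mass x A"
    for n :: nat
  proof -
    have "\<not> (\<forall>A (x::'x \<Rightarrow>\<^sub>L real). A \<in> sets lebesgue \<longrightarrow> A \<subseteq> interior I0 \<longrightarrow>
        measure lebesgue A < (1/2)^n \<longrightarrow> norm x \<le> 1 \<longrightarrow> mass x A \<le> e)"
    proof
      assume *: "\<forall>A (x::'x \<Rightarrow>\<^sub>L real). A \<in> sets lebesgue \<longrightarrow> A \<subseteq> interior I0 \<longrightarrow>
        measure lebesgue A < (1/2)^n \<longrightarrow> norm x \<le> 1 \<longrightarrow> mass x A \<le> e"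
      show False
        by (rule notE[OF neg], rule exI[of _ "(1/2)^n"], rule conjI[OF _ *]) simp
    qed
    then show ?thesis by (simp only: not_all not_imp not_le)
  qed
  then obtain A and x :: "nat \<Rightarrow> 'x \<Rightarrow>\<^sub>L real" where A: "\<And>n. A n \<in> sets lebesgue" "\<And>n. A n \<subseteq> interior I0"
      "\<And>n::nat. measure lebesgue (A n) < (1/2)^n" "\<And>n. norm (x n) \<le> 1" "\<And>n. e < mass (x n) (A n)"
    by metis
  have "\<exists>V. open V \<and> A n \<subseteq> V \<and> V \<subseteq> interior I0 \<and> measure lebesgue V \<le> 2 * (1/2)^n" for n
  proof -
    obtain T where T: "open T" "A n \<subseteq> T" "T - A n \<in> lmeasurable" "emeasure lebesgue (T - A n) < ennreal ((1/2)^n)"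
      using sets_lebesgue_outer_open[OF A(1), of "(1/2)^n" n] by auto
    have "measure lebesgue (T \<inter> interior I0) \<le> measure lebesgue (A n \<union> (T - A n))"
    proof (rule measure_mono_fmeasurable)
      show "A n \<union> (T - A n) \<in> lmeasurable"
        using lmeasurable_subset[OF A(1,2)] T(3) by (rule fmeasurable.Un)
      show "T \<inter> interior I0 \<in> sets lebesgue"
        using T(1) by simp
    qed auto
    also have "\<dots> \<le> measure lebesgue (A n) + measure lebesgue (T - A n)"
      using T(3) A(1) by (intro measure_Un_le) auto
    also have "measure lebesgue (T - A n) < (1/2)^n"
      using T(3,4) by (simp add: emeasure_eq_measure2 ennreal_less_iff)
    finally show ?thesis using A(2,3)[of n] T(1,2) by (intro exI[of _ "T \<inter> interior I0"]) auto
  qed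
  then obtain V where V: "\<And>n. open (V n)" "\<And>n. A n \<subseteq> V n" "\<And>n. V n \<subseteq> interior I0"
      "\<And>n::nat. measure lebesgue (V n) \<le> 2 * (1/2)^n" by metis
  \<comment> \<open>Tails make the sets decrease and contain all later \<open>A m\<close>, while
    their intersection is \<open>limsup V\<close>, which is null by Borel-Cantelli.\<close>
  define W where "W n = (\<Union>m\<in>{n..}. V m)" for n
  have W: "open (W n)" "W n \<subseteq> interior I0" "A n \<subseteq> W n" "m \<le> n \<Longrightarrow> W n \<subseteq> W m" for m n
    using V(1-3) by (fastforce simp: W_def)+
  \<comment> \<open>The losses are geometric: those of all stages up to \<open>N\<close> add up to
    at most \<open>e / 4\<close>, whatever \<open>N\<close> turns out to be.\<close>
  have "\<exists>K. compact K \<and> K \<subseteq> W n \<and> (\<forall>x::'x \<Rightarrow>\<^sub>L real. norm x \<le> 1 \<longrightarrow> mass x (W n - K) \<le> e / 8 * (1/2)^n)" for n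
    using e by (intro compact_inner_approximation W) auto
  then obtain K where K: "\<And>n. compact (K n)" "\<And>n. K n \<subseteq> W n"
      "\<And>n (x::'x \<Rightarrow>\<^sub>L real). norm x \<le> 1 \<Longrightarrow> mass x (W n - K n) \<le> e / 8 * (1/2)^n" by metis
  define L where "L = (\<Inter>n. K n)"
  have L: "compact L" unfolding L_def using K(1) by (intro compact_Inter) auto
  have "negligible L"
  proof -
    have "limsup V \<in> null_sets lebesgue"
    proof (rule borel_cantelli_limsup1)
      show "V n \<in> sets lebesgue" for n using V(1) by simp
      show "emeasure lebesgue (V n) < \<infinity>" for n
        using lmeasurable_subset[OF sets_lebesgue_open[OF V(1)] V(3), of n]
        unfolding fmeasurable_def by blast
      show "summable (\<lambda>n. measure lebesgue (V n))"
      proof (rule summable_comparison_test')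
        show "summable (\<lambda>n. 2 * (1/2::real)^n)" by (intro summable_mult summable_geometric) simp
        show "norm (measure lebesgue (V n)) \<le> 2 * (1/2)^n" if "0 \<le> n" for n using V(4) by simp
      qed
    qed
    moreover have "L \<subseteq> limsup V"
      using K(2) by (auto simp: L_def limsup_INF_SUP W_def)
    ultimately show ?thesis by (meson negligible_iff_null_sets negligible_subset)
  qed
  \<comment> \<open>Approximating the open complement of \<open>L\<close> as well leaves a compact
    \<open>K'\<close> that misses \<open>L\<close>. So finitely many of the open sets
    \<open>- K n\<close> already cover \<open>K'\<close>, which determines \<open>N\<close>.\<close>
  have "\<exists>K'. compact K' \<and> K' \<subseteq> interior I0 - L \<and>
      (\<forall>x::'x \<Rightarrow>\<^sub>L real. norm x \<le> 1 \<longrightarrow> mass x ((interior I0 - L) - K') \<le> e / 4)"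
    using e L by (intro compact_inner_approximation open_Diff) (auto intro: compact_imp_closed)
  then obtain K' where K': "compact K'" "K' \<subseteq> interior I0 - L"
      "\<And>x::'x \<Rightarrow>\<^sub>L real. norm x \<le> 1 \<Longrightarrow> mass x ((interior I0 - L) - K') \<le> e / 4" by blast
  have "K' \<subseteq> (\<Union>n\<in>UNIV. - K n)" using K'(2) by (auto simp: L_def)
  moreover have "open (- K n)" for n using K(1) compact_imp_closed by blast
  ultimately obtain C' where C': "finite C'" "K' \<subseteq> (\<Union>n\<in>C'. - K n)"
    using compactE_image[OF K'(1), of UNIV "\<lambda>n. - K n"] by metis
  define N where "N = Max (insert 0 C')"
  have N: "n \<le> N" if "n \<in> C'" for n using that C'(1) by (simp add: N_def)
  \<comment> \<open>A point of \<open>W N\<close> is lost at some stage \<open>n \<le> N\<close>, or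
    it lies in all \<open>K n\<close> with \<open>n \<le> N\<close>. In the latter case it is
    outside \<open>K'\<close>, by the choice of \<open>N\<close>.\<close>
  have cover: "W N \<subseteq> (\<Union>n\<in>{..N}. W n - K n) \<union> (((interior I0 - L) - K') \<union> L)"
  proof
    fix t assume t: "t \<in> W N"
    show "t \<in> (\<Union>n\<in>{..N}. W n - K n) \<union> (((interior I0 - L) - K') \<union> L)"
    proof (cases "\<exists>n\<le>N. t \<notin> K n")
      case True
      then show ?thesis using t W(4) by blast
    next
      case False
      then have "t \<notin> K'" using C' N by blast
      then show ?thesis using t W(2) by blast
    qed
  qed
  have sW: "W n - K n \<in> sets lebesgue" for n
    using W(1) sets_lebesgue_compact[OF K(1)] by (intro sets.Diff) auto
  have sL: "L \<in> sets lebesgue" using L by (rule sets_lebesgue_compact)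
  have sK: "interior I0 - L - K' \<in> sets lebesgue"
    using sL sets_lebesgue_compact[OF K'(1)] by (intro sets.Diff) auto
  have LI: "L \<subseteq> interior I0" using K(2)[of 0] W(2)[of 0] by (auto simp: L_def)
  let ?g = "\<lambda>t. blinfun_apply (x N) (f t)"
  have "mass (x N) (A N) \<le> mass (x N) ((\<Union>n\<in>{..N}. W n - K n) \<union> (((interior I0 - L) - K') \<union> L))"
    using cover W(2,3) A(1) sW sK sL LI
    by (intro abs_integral_mono[OF scalar_integrable]) (blast intro: sets.Un sets.finite_UN)+
  also have "\<dots> \<le> mass (x N) (\<Union>n\<in>{..N}. W n - K n) + mass (x N) (((interior I0 - L) - K') \<union> L)"
    using W(2) sW sK sL LI
    by (intro abs_integral_Un_le[OF scalar_integrable]) (blast intro: sets.Un sets.finite_UN)+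
  also have "mass (x N) (((interior I0 - L) - K') \<union> L) \<le> mass (x N) ((interior I0 - L) - K') + mass (x N) L"
    using sK sL LI by (intro abs_integral_Un_le[OF scalar_integrable]) auto
  also have "mass (x N) L = 0" using \<open>negligible L\<close> by (rule integral_negligible)
  also have "mass (x N) ((interior I0 - L) - K') \<le> e / 4" using K'(3) A(4) by blast
  also have "mass (x N) (\<Union>n\<in>{..N}. W n - K n) \<le> (\<Sum>n\<in>{..N}. mass (x N) (W n - K n))"
    using W(2) sW by (intro abs_integral_UN_le[OF scalar_integrable]) auto
  also have "\<dots> \<le> (\<Sum>n\<in>{..N}. e / 8 * (1/2)^n)" using K(3) A(4) by (intro sum_mono) blast
  also have "\<dots> = e / 8 * (\<Sum>n\<in>{..N}. (1/2)^n)" by (rule sum_distrib_left[symmetric])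
  also have "\<dots> \<le> e / 8 * 2"
  proof (intro mult_left_mono)
    show "(\<Sum>n\<in>{..N}. (1/2::real)^n) \<le> 2"
    proof -
      have "(\<Sum>n\<in>{..M}. (1/2::real)^n) = 2 - (1/2)^M" for M :: nat by (induction M) auto
      then show ?thesis by simp
    qed
  qed (use e in auto)
  finally show False using A(5)[of N] e by linarith
qed

text \<open>Finitely many balls of measure below the threshold for \<open>1\<close> cover
  \<open>I0\<close>, and each carries mass at most 1 for all functionals of the unit ball at
  once.\<close>

lemma mass_bounded: "\<exists>S>0. \<forall>x::'x \<Rightarrow>\<^sub>L real. norm x \<le> 1 \<longrightarrow> mass x (interior I0) \<le> S"
proof -
  obtain \<eta> where \<eta>: "0 < \<eta>" "\<And>A (x::'x \<Rightarrow>\<^sub>L real). A \<in> sets lebesgue \<Longrightarrow> A \<subseteq> interior I0 \<Longrightarrow>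
    measure lebesgue A < \<eta> \<Longrightarrow> norm x \<le> 1 \<Longrightarrow> mass x A \<le> 1"
    using uniformly_absolutely_continuous[of 1] by auto
  define c where "c = measure lborel (ball (0::real^'m) 1)"
  \<comment> \<open>With \<open>r \<le> 1\<close> the power \<open>r ^ DIM(real^'m)\<close> is at
    most \<open>r\<close>, so a ball has measure at most \<open>r * c\<close>, and this is below
    \<open>\<eta>\<close>.\<close>
  define r where "r = min 1 (\<eta> / (c + 1))"
  have c: "0 \<le> c" by (simp add: c_def)
  have r: "0 < r" "r \<le> 1" using \<eta>(1) c by (auto simp: r_def)
  have small: "measure lebesgue (ball t r) < \<eta>" for t :: "real^'m"
  proof -
    have "measure lebesgue (ball t r) = r ^ DIM(real^'m) * c"
      unfolding c_def using content_ball_conv_unit_ball[of r t] r by simp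
    also have "\<dots> \<le> r * c"
      using r c power_decreasing[of 1 "DIM(real^'m)" r] by (intro mult_right_mono) (auto simp: Suc_le_eq)
    also have "\<dots> \<le> \<eta> / (c + 1) * c" using c by (intro mult_right_mono) (auto simp: r_def)
    also have "\<dots> < \<eta>" using \<eta>(1) c by (simp add: field_simps)
    finally show ?thesis .
  qed
  obtain k where k: "finite k" "I0 \<subseteq> (\<Union>t\<in>k. ball t r)"
    using interval_compact[OF interval] r(1) unfolding compact_eq_totally_bounded by blast
  have "mass x (interior I0) \<le> real (card k) + 1" if x: "norm x \<le> 1" for x :: "'x \<Rightarrow>\<^sub>L real"
  proof -
    have eq: "interior I0 = (\<Union>t\<in>k. ball t r \<inter> interior I0)" using k(2) interior_subset[of I0] by auto
    have "mass x (interior I0) = mass x (\<Union>t\<in>k. ball t r \<inter> interior I0)" using eq by simp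
    also have "\<dots> \<le> (\<Sum>t\<in>k. mass x (ball t r \<inter> interior I0))"
      using k(1) by (intro abs_integral_UN_le[OF scalar_integrable]) auto
    also have "\<dots> \<le> (\<Sum>t\<in>k. 1)"
    proof (intro sum_mono \<eta>(2) x)
      fix t :: "real^'m"
      have "measure lebesgue (ball t r \<inter> interior I0) \<le> measure lebesgue (ball t r)"
        by (intro measure_mono_fmeasurable) auto
      then show "measure lebesgue (ball t r \<inter> interior I0) < \<eta>" using small[of t] by linarith
    qed auto
    finally show ?thesis by simp
  qed
  then show ?thesis by (intro exI[of _ "real (card k) + 1"]) auto
qed

end

subsection \<open>Approximation by step functions\<close>

text \<open>A form of continuity from below that does not require the sets \<open>A n\<close> to be
  measurable. If sets \<open>G n\<close> of measure at least \<open>e\<close> avoided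
  \<open>A n\<close> for every \<open>n\<close>, their tails would have a common point. That point
  lies in some \<open>A N\<close>, yet also in some \<open>G m\<close> with
  \<open>m \<ge> N\<close>.\<close>

lemma measure_disjoint_from_increasing_cover:
  fixes A :: "nat \<Rightarrow> 'a set"
  assumes U: "U \<in> fmeasurable M" and A: "incseq A" "U \<subseteq> (\<Union>n. A n)" and e: "0 < e"
  shows "\<exists>n. \<forall>G \<in> sets M. G \<subseteq> U \<longrightarrow> G \<inter> A n = {} \<longrightarrow> measure M G < e"
proof (rule ccontr)
  assume "\<not> ?thesis"
  then have "\<forall>n. \<exists>G. G \<in> sets M \<and> G \<subseteq> U \<and> G \<inter> A n = {} \<and> e \<le> measure M G"
    by (meson not_less)
  then obtain G where G: "\<And>n. G n \<in> sets M" "\<And>n. G n \<subseteq> U" "\<And>n. G n \<inter> A n = {}" "\<And>n. e \<le> measure M (G n)"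
    by metis
  define H where "H n = (\<Union>m\<in>{n..}. G m)" for n
  have Hs: "H n \<in> sets M" for n unfolding H_def using G(1) by (intro sets.countable_UN') auto
  have HU: "H n \<subseteq> U" for n using G(2) by (auto simp: H_def)
  have Hf: "H n \<in> fmeasurable M" for n by (rule fmeasurableI2[OF U HU Hs])
  have dec: "decseq H" unfolding decseq_def H_def by (auto intro: order_trans)
  have ge: "e \<le> measure M (H n)" for n
  proof -
    have "measure M (G n) \<le> measure M (H n)"
      using G(1) Hf by (intro measure_mono_fmeasurable) (auto simp: H_def)
    then show ?thesis using G(4)[of n] by linarith
  qed
  have "(\<lambda>n. measure M (H n)) \<longlonglongrightarrow> measure M (\<Inter>n. H n)"
  proof (rule Lim_measure_decseq[OF _ dec])
    show "emeasure M (H n) \<noteq> \<infinity>" for n using Hf[of n] by (auto simp: fmeasurable_def)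
  qed (use Hs in auto)
  then have "e \<le> measure M (\<Inter>n. H n)" using ge by (intro LIMSEQ_le_const) auto
  then have "(\<Inter>n. H n) \<noteq> {}" using e by auto
  then obtain t where t: "\<And>n. t \<in> H n" by blast
  then have "t \<in> U" using HU by blast
  then obtain N where N: "t \<in> A N" using A(2) by blast
  obtain m where "N \<le> m" "t \<in> G m" using t[of N] by (auto simp: H_def)
  then show False using G(3)[of m] N incseqD[OF A(1), of N m] by blast
qed

text \<open>Cells of a fine division of \<open>I0\<close> that touch the boundary must be dropped. A
  compact \<open>K\<close> exhausting the interior up to \<open>z\<close> has positive distance
  \<open>d\<close> from the outside, so cells finer than \<open>d\<close> that meet \<open>K\<close>
  survive.\<close>

lemma fine_interval_family:
  fixes I0 :: "(real^'m) set"
  assumes I0: "I0 \<in> intervals" and \<rho>: "0 < \<rho>" and z: "0 < z"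
  obtains \<D> where "finite \<D>" "\<D> \<subseteq> intervals_in (interior I0)" "pairwise nonoverlapping \<D>"
    "\<And>Q s t. Q \<in> \<D> \<Longrightarrow> s \<in> Q \<Longrightarrow> t \<in> Q \<Longrightarrow> dist s t < \<rho>"
    "measure lebesgue (interior I0 - \<Union>\<D>) < z"
proof -
  obtain a b where ab: "I0 = cbox a b" using I0 by (rule intervalsE)
  obtain K where K: "closed K" "K \<subseteq> interior I0" "interior I0 - K \<in> lmeasurable"
      "emeasure lebesgue (interior I0 - K) < ennreal z"
    using sets_lebesgue_inner_closed[of "interior I0" z] z by auto
  have "bounded K" using K(2) interval_compact[OF I0] interior_subset
    by (meson bounded_subset compact_imp_bounded)
  then have "compact K" using K(1) by (simp add: compact_eq_bounded_closed)
  then obtain d where d: "0 < d" "\<And>s t. s \<in> K \<Longrightarrow> t \<in> - interior I0 \<Longrightarrow> d \<le> dist s t"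
  proof -
    have "closed (- interior I0)" "K \<inter> - interior I0 = {}" using K(2) by auto
    from separate_compact_closed[OF \<open>compact K\<close> this] that show ?thesis by blast
  qed
  define r where "r = min \<rho> d / 2"
  have r: "0 < r" using \<rho> d by (simp add: r_def)
  obtain p where p: "p tagged_division_of cbox a b" "(\<lambda>t. ball t r) fine p"
    using fine_division_exists[of "\<lambda>t. ball t r" a b] r by (auto simp: gauge_def)
  note P = tagged_division_ofD[OF p(1)]
  have diam: "dist s s' < min \<rho> d" if "(t, Q) \<in> p" "s \<in> Q" "s' \<in> Q" for t Q s s'
  proof -
    have "Q \<subseteq> ball t r" using p(2) that(1) by (auto simp: fine_def)
    then have "dist t s < r" "dist t s' < r" using that by auto
    then show ?thesis using dist_triangle2[of s s' t] by (simp add: r_def dist_commute)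
  qed
  define \<D> where "\<D> = {Q \<in> snd ` p. 0 < measure lebesgue Q \<and> Q \<subseteq> interior I0}"
  show ?thesis
  proof
    show "finite \<D>" using P(1) by (simp add: \<D>_def)
    show "\<D> \<subseteq> intervals_in (interior I0)"
    proof
      fix Q assume Q: "Q \<in> \<D>"
      then obtain t where "(t, Q) \<in> p" by (auto simp: \<D>_def)
      then obtain c e where "Q = cbox c e" using P(4) by blast
      with Q show "Q \<in> intervals_in (interior I0)"
        by (auto simp: \<D>_def intervals_in_def intro: cbox_in_intervals)
    qed
    show "pairwise nonoverlapping \<D>"
      unfolding pairwise_def
    proof (intro ballI impI)
      fix Q Q' assume Q: "Q \<in> \<D>" and Q': "Q' \<in> \<D>" and "Q \<noteq> Q'"
      obtain t where "(t, Q) \<in> p" using Q by (auto simp: \<D>_def)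
      moreover obtain t' where "(t', Q') \<in> p" using Q' by (auto simp: \<D>_def)
      ultimately show "nonoverlapping Q Q'" using P(5)[of t Q t' Q'] \<open>Q \<noteq> Q'\<close> by (simp add: nonoverlapping_def)
    qed
    show "dist s t < \<rho>" if "Q \<in> \<D>" "s \<in> Q" "t \<in> Q" for Q s t
      using diam[of _ Q s t] that by (auto simp: \<D>_def)
    \<comment> \<open>Points of \<open>K\<close> can be lost only in degenerate cells, whose union
      is null.\<close>
    define Z where "Z = \<Union>{Q \<in> snd ` p. measure lebesgue Q = 0}"
    have Z: "negligible Z"
      unfolding Z_def
    proof (rule negligible_Union)
      show "finite {Q \<in> snd ` p. measure lebesgue Q = 0}" using P(1) by simp
      fix Q assume "Q \<in> {Q \<in> snd ` p. measure lebesgue Q = 0}"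
      then obtain t where "(t, Q) \<in> p" "measure lebesgue Q = 0" by auto
      then show "negligible Q" using P(4)[of t Q] by (auto simp: negligible_iff_measure)
    qed
    have sub: "interior I0 - \<Union>\<D> \<subseteq> (interior I0 - K) \<union> Z"
    proof
      fix t assume t: "t \<in> interior I0 - \<Union>\<D>"
      then have "t \<in> cbox a b" using ab interior_subset by blast
      then obtain s Q where sQ: "(s, Q) \<in> p" "t \<in> Q" using P(6) by blast
      show "t \<in> (interior I0 - K) \<union> Z"
      proof (rule ccontr)
        assume n: "t \<notin> (interior I0 - K) \<union> Z"
        then have tK: "t \<in> K" using t by auto
        have "Q \<subseteq> interior I0"
        proof
          fix u assume u: "u \<in> Q"
          show "u \<in> interior I0" using d(2)[OF tK, of u] diam[OF sQ u] by fastforce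
        qed
        moreover have "measure lebesgue Q \<noteq> 0" using n sQ by (force simp: Z_def)
        ultimately have "Q \<in> \<D>" using sQ by (force simp: \<D>_def zero_less_measure_iff)
        then show False using t sQ by blast
      qed
    qed
    have \<D>s: "\<Union>\<D> \<in> sets lebesgue"
    proof (rule sets.finite_Union)
      show "finite \<D>" using P(1) by (simp add: \<D>_def)
      show "\<D> \<subseteq> sets lebesgue"
        using P(4) by (force simp: \<D>_def)
    qed
    have "measure lebesgue (interior I0 - \<Union>\<D>) \<le> measure lebesgue ((interior I0 - K) \<union> Z)"
      using \<D>s by (intro measure_mono_fmeasurable[OF sub] fmeasurable.Un[OF K(3) negligible_imp_measurable[OF Z]] sets.Diff) auto
    also have "\<dots> \<le> measure lebesgue (interior I0 - K) + measure lebesgue Z"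
      using K(3) Z by (intro measure_Un_le) (auto intro: negligible_imp_sets)
    also have "\<dots> < z" using K(3,4) Z
      by (simp add: negligible_imp_measure0 emeasure_eq_measure2 ennreal_less_iff)
    finally show "measure lebesgue (interior I0 - \<Union>\<D>) < z" .
  qed
qed

context Dunford_primitive
begin

text \<open>The conditional expectation of \<open>f\<close> in the scalar sense: by
  \<open>primitive\<close>, \<open>x\<close> applied to the value on \<open>Q\<close> is the mean of
  \<open>x f\<close> over \<open>Q\<close>. Interiors keep common faces from being counted
  twice.\<close>

definition step :: "(real^'m) set set \<Rightarrow> real^'m \<Rightarrow> 'x" where
  "step \<D> t = (\<Sum>Q\<in>\<D>. indicator (interior Q) t *\<^sub>R ((1 / measure lebesgue Q) *\<^sub>R F Q))"

lemma step_interior: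
  assumes "finite \<D>" "pairwise nonoverlapping \<D>" "Q \<in> \<D>" "t \<in> interior Q"
  shows "step \<D> t = (1 / measure lebesgue Q) *\<^sub>R F Q"
proof -
  have "t \<notin> interior Q'" if "Q' \<in> \<D>" "Q' \<noteq> Q" for Q'
    using assms that by (auto simp: pairwise_def nonoverlapping_def)
  then have "step \<D> t = (\<Sum>Q'\<in>\<D>. if Q' = Q then (1 / measure lebesgue Q) *\<^sub>R F Q else 0)"
    unfolding step_def using assms(4) by (intro sum.cong) (auto simp: indicator_def)
  then show ?thesis using assms(1,3) by simp
qed

lemma step_outside: "t \<notin> \<Union>\<D> \<Longrightarrow> step \<D> t = 0"
  unfolding step_def using interior_subset by (intro sum.neutral) (auto simp: indicator_def)

lemma step_absolutely_integrable:
  "(\<lambda>t. blinfun_apply x (step \<D> t)) absolutely_integrable_on interior I0"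
proof -
  have U: "interior I0 \<in> lmeasurable" by (rule lmeasurable_subset) auto
  have "integrable lebesgue (\<lambda>t. \<Sum>Q\<in>\<D>. indicator (interior I0 \<inter> interior Q) t *\<^sub>R
      blinfun_apply x ((1 / measure lebesgue Q) *\<^sub>R F Q))"
  proof (intro Bochner_Integration.integrable_sum integrable_scaleR_left integrable_real_indicator)
    fix Q
    show "interior I0 \<inter> interior Q \<in> sets lebesgue" by auto
    have "interior I0 \<inter> interior Q \<in> lmeasurable" by (rule fmeasurableI2[OF U]) auto
    then show "emeasure lebesgue (interior I0 \<inter> interior Q) < \<infinity>" unfolding fmeasurable_def by blast
  qed
  then show ?thesis
    unfolding set_integrable_def step_def
    by (rule Bochner_Integration.integrable_cong[THEN iffD1, rotated 2])
      (auto simp: blinfun.sum_right blinfun.scaleR_right scaleR_sum_right indicator_inter_arith intro!: sum.cong)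
qed

text \<open>Taking means does not increase the \<open>L\<^sup>1\<close> mass on a cell. Hence the
  step function inherits the mass bounds of \<open>f\<close>, uniformly in \<open>x\<close>.\<close>

lemma step_mass:
  assumes \<D>: "finite \<D>" "pairwise nonoverlapping \<D>" "Q \<in> \<D>" "Q \<in> intervals_in (interior I0)"
  shows "integral Q (\<lambda>t. \<bar>blinfun_apply x (step \<D> t)\<bar>) = \<bar>blinfun_apply x (F Q)\<bar>"
    and "\<bar>blinfun_apply x (F Q)\<bar> \<le> mass x Q"
proof -
  obtain a b where ab: "Q = cbox a b" "0 < measure lborel (cbox a b)"
    using \<D>(4) by (auto simp: intervals_in_def elim!: intervalsE)
  have "((\<lambda>t. \<bar>blinfun_apply x (F Q) / measure lborel Q\<bar>) has_integral
      measure lborel (cbox a b) *\<^sub>R \<bar>blinfun_apply x (F Q) / measure lborel Q\<bar>) (cbox a b)"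
    by (rule has_integral_const)
  then have "((\<lambda>t. \<bar>blinfun_apply x (step \<D> t)\<bar>) has_integral
      measure lborel (cbox a b) *\<^sub>R \<bar>blinfun_apply x (F Q) / measure lborel Q\<bar>) (cbox a b)"
    by (rule has_integral_spike_interior)
      (use step_interior[OF \<D>(1-3)] ab in \<open>simp add: blinfun.scaleR_right\<close>)
  then show "integral Q (\<lambda>t. \<bar>blinfun_apply x (step \<D> t)\<bar>) = \<bar>blinfun_apply x (F Q)\<bar>"
    using ab by (simp add: integral_unique)
  have "Q \<in> sets lebesgue" "Q \<subseteq> interior I0"
    using \<D>(4) interval_lmeasurable[of Q] by (auto simp: intervals_in_def)
  then show "\<bar>blinfun_apply x (F Q)\<bar> \<le> mass x Q"
    using integral_abs_bound_subset[OF scalar_integrable, of Q x] primitive[OF \<D>(4), of x] by simp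
qed

text \<open>Off the frontiers, membership in the interior of each of the finitely many cells is
  stable near \<open>t\<close>. This lets a McShane interval that misses its tag still see the value
  at the tag.\<close>

lemma step_locally_constant:
  assumes \<D>: "finite \<D>" "\<D> \<subseteq> intervals" and t: "t \<in> interior I0" "t \<notin> (\<Union>Q\<in>\<D>. frontier Q)"
  shows "\<exists>r>0. max_ball t r \<subseteq> interior I0 \<and> (\<forall>s\<in>max_ball t r. step \<D> s = step \<D> t)"
proof -
  define O' where "O' Q = (if t \<in> interior Q then interior Q else - Q)" for Q
  define V where "V = interior I0 \<inter> (\<Inter>Q\<in>\<D>. O' Q)"
  have cl: "closed Q" if "Q \<in> \<D>" for Q
    using that \<D>(2) interval_compact compact_imp_closed by blast
  have "open V" unfolding V_def
    using \<D>(1) cl by (intro open_Int open_INT) (auto simp: O'_def)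
  moreover have "t \<in> V"
    using t cl by (auto simp: V_def O'_def frontier_def)
  ultimately obtain r where r: "0 < r" "max_ball t r \<subseteq> V" by (rule open_contains_max_ball)
  have "step \<D> s = step \<D> t" if "s \<in> V" for s
    unfolding step_def
  proof (rule sum.cong[OF refl])
    fix Q assume "Q \<in> \<D>"
    then have "s \<in> O' Q" using that unfolding V_def by blast
    then have "s \<in> interior Q \<longleftrightarrow> t \<in> interior Q"
      using interior_subset[of Q] by (auto simp: O'_def split: if_splits)
    then show "indicator (interior Q) s *\<^sub>R ((1 / measure lebesgue Q) *\<^sub>R F Q)
        = indicator (interior Q) t *\<^sub>R ((1 / measure lebesgue Q) *\<^sub>R F Q)"
      by (simp add: indicator_def)
  qed
  then show ?thesis using r by (intro exI[of _ r]) (auto simp: V_def)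
qed

end

lemma HK_partition_subset: "HK_partition U \<pi> \<Longrightarrow> \<pi>' \<subseteq> \<pi> \<Longrightarrow> HK_partition U \<pi>'"
  unfolding HK_partition_def M_partition_def by (meson finite_subset subsetD)

lemma fine_partition_subset: "fine_partition \<delta> \<pi> \<Longrightarrow> \<pi>' \<subseteq> \<pi> \<Longrightarrow> fine_partition \<delta> \<pi>'"
  unfolding fine_partition_def by blast

text \<open>Partitions need not fill \<open>U\<close>, so every part of a fine partition is again
  admissible. All partial signed sums are thus bounded by \<open>e\<close>, and absolute values cost
  a factor 2.\<close>

lemma HK_partition_abs_sum_le:
  fixes x :: "'x::banach \<Rightarrow>\<^sub>L real"
  assumes \<delta>: "\<And>\<pi>. HK_partition U \<pi> \<Longrightarrow> fine_partition \<delta> \<pi> \<Longrightarrow>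
        norm (\<Sum>(t, I)\<in>\<pi>. measure lebesgue I *\<^sub>R f t - F I) < e"
    and \<pi>: "HK_partition U \<pi>" "fine_partition \<delta> \<pi>" and x: "norm x \<le> 1"
  shows "(\<Sum>(t, I)\<in>\<pi>. \<bar>measure lebesgue I * blinfun_apply x (f t) - blinfun_apply x (F I)\<bar>) \<le> 2 * e"
proof -
  have fin: "finite \<pi>" using \<pi>(1) by (simp add: HK_partition_def M_partition_def)
  have "norm (\<Sum>p\<in>Q. measure lebesgue (snd p) * blinfun_apply x (f (fst p)) - blinfun_apply x (F (snd p))) \<le> e"
    if Q: "Q \<subseteq> \<pi>" for Q
  proof -
    have "(\<Sum>p\<in>Q. measure lebesgue (snd p) * blinfun_apply x (f (fst p)) - blinfun_apply x (F (snd p)))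
        = blinfun_apply x (\<Sum>(t, I)\<in>Q. measure lebesgue I *\<^sub>R f t - F I)"
      by (simp add: case_prod_beta blinfun.sum_right blinfun.diff_right blinfun.scaleR_right)
    also have "norm \<dots> \<le> norm x * norm (\<Sum>(t, I)\<in>Q. measure lebesgue I *\<^sub>R f t - F I)"
      by (rule norm_blinfun)
    also have "\<dots> \<le> 1 * e"
      using \<delta>[OF HK_partition_subset[OF \<pi>(1) Q] fine_partition_subset[OF \<pi>(2) Q]] x
      by (intro mult_mono) auto
    finally show ?thesis by simp
  qed
  from sum_norm_allsubsets_bound[OF fin this] show ?thesis by (simp add: case_prod_beta)
qed

lemma sum_measure_family:
  assumes "finite \<D>" "\<D> \<subseteq> intervals" "pairwise nonoverlapping \<D>"
  shows "measure lebesgue (\<Union>\<D>) = (\<Sum>Q\<in>\<D>. measure lebesgue Q)" "\<Union>\<D> \<in> lmeasurable"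
proof -
  show "measure lebesgue (\<Union>\<D>) = (\<Sum>Q\<in>\<D>. measure lebesgue Q)"
  proof (rule measure_negligible_finite_Union[OF assms(1)])
    show "Q \<in> lmeasurable" if "Q \<in> \<D>" for Q using that assms(2) interval_lmeasurable by blast
    show "pairwise (\<lambda>S T. negligible (S \<inter> T)) \<D>"
      using assms(2,3) unfolding pairwise_def by (meson nonoverlapping_negligible subsetD)
  qed
  show "\<Union>\<D> \<in> lmeasurable"
    using assms(1,2) interval_lmeasurable by (intro fmeasurable.finite_Union) auto
qed

context Dunford_primitive
begin

text \<open>Cells are the averaging sets, and a cell containing a point whose gauge exceeds the mesh
  may be tagged by that point. If \<open>x f\<close> there is far from the cell mean, the cell
  contributes to a Henstock-Kurzweil error, so such cells have small total measure. What then
  remains away from the good set avoids \<open>A n\<close> and is small by the choice of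
  \<open>n\<close>. The family \<open>\<D>\<close> is chosen before \<open>x\<close>; only the
  exceptional sets depend on \<open>x\<close>.\<close>

lemma step_approximation:
  assumes HK: "\<And>e. 0 < e \<Longrightarrow> \<exists>\<delta>. gauge_on (interior I0) \<delta> \<and> (\<forall>\<pi>. HK_partition (interior I0) \<pi> \<longrightarrow>
      fine_partition \<delta> \<pi> \<longrightarrow> norm (\<Sum>(t, I)\<in>\<pi>. measure lebesgue I *\<^sub>R f t - F I) < e)"
    and e: "0 < e"
  shows "\<exists>\<D>. finite \<D> \<and> \<D> \<subseteq> intervals_in (interior I0) \<and> pairwise nonoverlapping \<D> \<and>
    (\<forall>x::'x \<Rightarrow>\<^sub>L real. norm x \<le> 1 \<longrightarrow>
      integral (interior I0) (\<lambda>t. \<bar>blinfun_apply x (f t) - blinfun_apply x (step \<D> t)\<bar>) \<le> e)"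
proof -
  let ?U = "interior I0"
  define m0 where "m0 = measure lebesgue ?U"
  have Ulm: "?U \<in> lmeasurable" by (rule lmeasurable_subset) auto
  have m0: "0 \<le> m0" by (simp add: m0_def)
  obtain S where S: "0 < S" "\<And>x::'x \<Rightarrow>\<^sub>L real. norm x \<le> 1 \<Longrightarrow> mass x ?U \<le> S"
    using mass_bounded by blast
  obtain z where z: "0 < z" "\<And>A (x::'x \<Rightarrow>\<^sub>L real). A \<in> sets lebesgue \<Longrightarrow> A \<subseteq> ?U \<Longrightarrow>
      measure lebesgue A < z \<Longrightarrow> norm x \<le> 1 \<Longrightarrow> mass x A \<le> e / 8"
    using uniformly_absolutely_continuous[of "e / 8"] e by auto
  define \<eta> where "\<eta> = e / (8 * (m0 + 1))"
  have \<eta>: "0 < \<eta>" "\<eta> * m0 \<le> e / 8"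
    using e m0 by (auto simp: \<eta>_def field_simps)
  \<comment> \<open>Absolute errors sum to at most \<open>2 * e1\<close>, so cells with deviation
    above \<open>\<eta>\<close> have total measure at most
    \<open>2 * e1 / \<eta> = z / 2\<close>.\<close>
  define e1 where "e1 = \<eta> * z / 4"
  have e1: "0 < e1" using \<eta> z by (simp add: e1_def)
  \<comment> \<open>Chebyshev: cells with a mean above \<open>k\<close> in absolute value have total
    measure at most \<open>S / k = z / 2\<close>.\<close>
  define k where "k = 2 * S / z"
  have k: "0 < k" using S z by (simp add: k_def)
  \<comment> \<open>Below \<open>z\<close> the mass of \<open>f\<close> on the remainder is small;
    below \<open>e / (8 * k)\<close> so is that of a step function bounded by
    \<open>k\<close>.\<close>
  define \<eta>' where "\<eta>' = min z (e / (8 * k))"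
  have \<eta>': "0 < \<eta>'" using z k e by (simp add: \<eta>'_def)
  obtain \<delta> where \<delta>: "gauge_on ?U \<delta>" "\<And>\<pi>. HK_partition ?U \<pi> \<Longrightarrow> fine_partition \<delta> \<pi> \<Longrightarrow>
      norm (\<Sum>(t, I)\<in>\<pi>. measure lebesgue I *\<^sub>R f t - F I) < e1"
    using HK[OF e1] by blast
  \<comment> \<open>\<open>A n\<close> need not be measurable; only measurable sets that avoid it are measured.\<close>
  define A where "A n = {t \<in> ?U. 1 / (real n + 1) < \<delta> t}" for n :: nat
  have "incseq A"
  proof (rule incseq_SucI)
    fix n
    have "1 / (real (Suc n) + 1) \<le> 1 / (real n + 1)" by (simp add: frac_le)
    then show "A n \<subseteq> A (Suc n)" unfolding A_def by fastforce
  qed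
  moreover have "?U \<subseteq> (\<Union>n. A n)"
  proof
    fix t assume t: "t \<in> ?U"
    then have "0 < \<delta> t" using \<delta>(1) by (simp add: gauge_on_def)
    then obtain n where "inverse (real (Suc n)) < \<delta> t" using reals_Archimedean by blast
    then show "t \<in> (\<Union>n. A n)" using t by (auto simp: A_def inverse_eq_divide add.commute intro!: exI[of _ n])
  qed
  ultimately have "\<exists>n. \<forall>G\<in>sets lebesgue. G \<subseteq> ?U \<longrightarrow> G \<inter> A n = {} \<longrightarrow> measure lebesgue G < \<eta>'"
    by (rule measure_disjoint_from_increasing_cover[OF Ulm _ _ \<eta>'])
  then obtain n where n: "\<And>G. G \<in> sets lebesgue \<Longrightarrow> G \<subseteq> ?U \<Longrightarrow> G \<inter> A n = {} \<Longrightarrow> measure lebesgue G < \<eta>'"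
    by blast
  \<comment> \<open>The mesh \<open>1 / (real n + 1)\<close> matches \<open>A n\<close>: a cell
    containing a point of \<open>A n\<close> and tagged by it is automatically
    \<open>\<delta>\<close>-fine.\<close>
  obtain \<D> where \<D>: "finite \<D>" "\<D> \<subseteq> intervals_in ?U" "pairwise nonoverlapping \<D>"
    and mesh: "\<And>Q s t. Q \<in> \<D> \<Longrightarrow> s \<in> Q \<Longrightarrow> t \<in> Q \<Longrightarrow> dist s t < 1 / (real n + 1)"
    and off: "measure lebesgue (?U - \<Union>\<D>) < z"
    by (rule fine_interval_family[OF interval _ z(1), of "1 / (real n + 1)"]) (simp, rule that)
  have Dint: "Q \<in> intervals" "Q \<subseteq> ?U" "Q \<in> sets lebesgue" "Q \<in> intervals_in ?U" if "Q \<in> \<D>" for Q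
    using that \<D>(2) interval_lmeasurable[of Q] by (auto simp: intervals_in_def)
  have sub: "finite \<E>" "\<E> \<subseteq> intervals" "pairwise nonoverlapping \<E>" "\<Union>\<E> \<subseteq> ?U" if "\<E> \<subseteq> \<D>" for \<E>
  proof -
    show "finite \<E>" using that \<D>(1) by (rule finite_subset)
    show "\<E> \<subseteq> intervals" "\<Union>\<E> \<subseteq> ?U" using that Dint(1,2) by blast+
    show "pairwise nonoverlapping \<E>" using \<D>(3) that by (rule pairwise_subset)
  qed
  have "integral ?U (\<lambda>t. \<bar>blinfun_apply x (f t) - blinfun_apply x (step \<D> t)\<bar>) \<le> e"
    if x: "norm x \<le> 1" for x :: "'x \<Rightarrow>\<^sub>L real"
  proof -
    define g where "g t = blinfun_apply x (f t)" for t
    define \<phi> where "\<phi> t = blinfun_apply x (step \<D> t)" for t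
    define h where "h t = g t - \<phi> t" for t
    define c where "c Q = blinfun_apply x (F Q) / measure lebesgue Q" for Q
    have gi: "g absolutely_integrable_on ?U" unfolding g_def by (rule scalar_integrable)
    have \<phi>i: "\<phi> absolutely_integrable_on ?U" unfolding \<phi>_def by (rule step_absolutely_integrable)
    have hi: "h absolutely_integrable_on ?U" unfolding h_def using gi \<phi>i by (rule set_integral_diff(1))
    have \<phi>Q: "\<phi> t = c Q" if "Q \<in> \<D>" "t \<in> interior Q" for Q t
      using step_interior[OF \<D>(1,3) that] by (simp add: \<phi>_def c_def blinfun.scaleR_right)
    have mQ: "0 < measure lebesgue Q" if "Q \<in> \<D>" for Q using Dint(1)[OF that] by (rule interval_measure_pos)
    have \<phi>mass: "integral Q (\<lambda>t. \<bar>\<phi> t\<bar>) \<le> integral Q (\<lambda>t. \<bar>g t\<bar>)" if "Q \<in> \<D>" for Q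
      using step_mass[OF \<D>(1,3) that Dint(4)[OF that], of x] by (simp add: \<phi>_def g_def)
    have cmass: "measure lebesgue Q * \<bar>c Q\<bar> \<le> integral Q (\<lambda>t. \<bar>g t\<bar>)" if "Q \<in> \<D>" for Q
      using step_mass(2)[OF \<D>(1,3) that Dint(4)[OF that], of x] mQ[OF that] by (simp add: c_def g_def)
    have small: "integral B (\<lambda>t. \<bar>g t\<bar>) \<le> e / 8" if "B \<in> sets lebesgue" "B \<subseteq> ?U" "measure lebesgue B < z" for B
      unfolding g_def by (rule z(2)[OF that x])
    have famsum: "(\<Sum>Q\<in>\<E>. integral Q (\<lambda>t. \<bar>g t\<bar>)) \<le> integral (\<Union>\<E>) (\<lambda>t. \<bar>g t\<bar>)" if "\<E> \<subseteq> \<D>" for \<E>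
      using sub[OF that] sum_measure_family(2)[OF sub(1-3)[OF that]] that
      by (intro abs_integral_family_le[OF gi]) (auto simp: pairwise_def)
    have fam: "integral (\<Union>\<E>) (\<lambda>t. \<bar>g t\<bar>) \<le> e / 8 \<and> integral (\<Union>\<E>) (\<lambda>t. \<bar>\<phi> t\<bar>) \<le> e / 8"
      if \<E>: "\<E> \<subseteq> \<D>" and mE: "(\<Sum>Q\<in>\<E>. measure lebesgue Q) < z" for \<E>
    proof -
      have s: "\<Union>\<E> \<in> sets lebesgue" using sum_measure_family(2)[OF sub(1-3)[OF \<E>]] by (rule fmeasurableD)
      have a: "integral (\<Union>\<E>) (\<lambda>t. \<bar>g t\<bar>) \<le> e / 8"
        using sum_measure_family(1)[OF sub(1-3)[OF \<E>]] mE by (intro small s sub(4)[OF \<E>]) auto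
      have "integral (\<Union>Q\<in>\<E>. Q) (\<lambda>t. \<bar>\<phi> t\<bar>) \<le> (\<Sum>Q\<in>\<E>. integral Q (\<lambda>t. \<bar>\<phi> t\<bar>))"
        using \<E> Dint sub(1)[OF \<E>] by (intro abs_integral_UN_le[OF \<phi>i]) auto
      also have "\<dots> \<le> (\<Sum>Q\<in>\<E>. integral Q (\<lambda>t. \<bar>g t\<bar>))"
        using \<E> by (intro sum_mono \<phi>mass) auto
      also have "\<dots> \<le> e / 8" using famsum[OF \<E>] a by linarith
      finally show ?thesis using a by simp
    qed
    define bad where "bad = {Q \<in> \<D>. \<exists>t\<in>A n \<inter> Q. \<eta> < \<bar>g t - c Q\<bar>}"
    have bad: "bad \<subseteq> \<D>" by (auto simp: bad_def)
    have badsum: "(\<Sum>Q\<in>bad. measure lebesgue Q) < z"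
    proof -
      have "\<forall>Q\<in>bad. \<exists>t. t \<in> A n \<inter> Q \<and> \<eta> < \<bar>g t - c Q\<bar>" by (auto simp: bad_def)
      then obtain \<tau> where \<tau>: "\<And>Q. Q \<in> bad \<Longrightarrow> \<tau> Q \<in> A n \<inter> Q \<and> \<eta> < \<bar>g (\<tau> Q) - c Q\<bar>" by metis
      define \<pi> where "\<pi> = (\<lambda>Q. (\<tau> Q, Q)) ` bad"
      have inj: "inj_on (\<lambda>Q. (\<tau> Q, Q)) bad" by (rule inj_onI) simp
      have "HK_partition ?U \<pi>"
        unfolding HK_partition_def M_partition_def
      proof (intro conjI)
        show "finite \<pi>" unfolding \<pi>_def using sub(1)[OF bad] by simp
        show "\<forall>(t, I)\<in>\<pi>. t \<in> ?U \<and> I \<in> intervals_in ?U"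
          using \<tau> bad Dint(4) by (auto simp: \<pi>_def A_def)
        show "\<forall>p\<in>\<pi>. \<forall>q\<in>\<pi>. p \<noteq> q \<longrightarrow> nonoverlapping (snd p) (snd q)"
          using sub(3)[OF bad] by (auto simp: \<pi>_def pairwise_def)
        show "\<forall>(t, I)\<in>\<pi>. t \<in> I" using \<tau> by (auto simp: \<pi>_def)
      qed
      moreover have "fine_partition \<delta> \<pi>"
        unfolding fine_partition_def \<pi>_def
      proof clarify
        fix Q s assume Q: "Q \<in> bad" and s: "s \<in> Q"
        have "dist (\<tau> Q) s < 1 / (real n + 1)" using mesh[of Q "\<tau> Q" s] Q s bad \<tau>[OF Q] by blast
        then have "dist (\<tau> Q) s < \<delta> (\<tau> Q)" using \<tau>[OF Q] by (auto simp: A_def)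
        then show "s \<in> max_ball (\<tau> Q) (\<delta> (\<tau> Q))" using ball_subset_max_ball by (meson mem_ball subsetD)
      qed
      ultimately have "(\<Sum>(t, I)\<in>\<pi>. \<bar>measure lebesgue I * blinfun_apply x (f t) - blinfun_apply x (F I)\<bar>) \<le> 2 * e1"
        by (rule HK_partition_abs_sum_le[rotated]) (fact x, rule \<delta>(2))
      then have le: "(\<Sum>Q\<in>bad. \<bar>measure lebesgue Q * g (\<tau> Q) - blinfun_apply x (F Q)\<bar>) \<le> 2 * e1"
        unfolding \<pi>_def by (simp add: sum.reindex[OF inj] g_def)
      have "\<eta> * (\<Sum>Q\<in>bad. measure lebesgue Q) = (\<Sum>Q\<in>bad. measure lebesgue Q * \<eta>)"
        by (simp add: sum_distrib_left mult.commute)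
      also have "\<dots> \<le> (\<Sum>Q\<in>bad. \<bar>measure lebesgue Q * g (\<tau> Q) - blinfun_apply x (F Q)\<bar>)"
      proof (rule sum_mono)
        fix Q assume Q: "Q \<in> bad"
        have p: "0 < measure lebesgue Q" using mQ Q bad by blast
        have "measure lebesgue Q * g (\<tau> Q) - blinfun_apply x (F Q) = measure lebesgue Q * (g (\<tau> Q) - c Q)"
          using p by (simp add: c_def right_diff_distrib)
        then have "\<bar>measure lebesgue Q * g (\<tau> Q) - blinfun_apply x (F Q)\<bar> = measure lebesgue Q * \<bar>g (\<tau> Q) - c Q\<bar>"
          using p by (simp add: abs_mult)
        then show "measure lebesgue Q * \<eta> \<le> \<bar>measure lebesgue Q * g (\<tau> Q) - blinfun_apply x (F Q)\<bar>"
          using \<tau>[OF Q] p by (simp add: mult_left_mono)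
      qed
      also have "\<dots> \<le> \<eta> * (z / 2)" using le by (simp add: e1_def)
      finally have "(\<Sum>Q\<in>bad. measure lebesgue Q) \<le> z / 2" using \<eta>(1) by simp
      then show ?thesis using z(1) by linarith
    qed
    \<comment> \<open>The averages are not bounded uniformly in \<open>x\<close>; cubes with a large average have small total measure.\<close>
    define big where "big = {Q \<in> \<D>. k < \<bar>c Q\<bar>}"
    have big: "big \<subseteq> \<D>" by (auto simp: big_def)
    have bigsum: "(\<Sum>Q\<in>big. measure lebesgue Q) < z"
    proof -
      have "k * (\<Sum>Q\<in>big. measure lebesgue Q) = (\<Sum>Q\<in>big. measure lebesgue Q * k)"
        by (simp add: sum_distrib_left mult.commute)
      also have "\<dots> \<le> (\<Sum>Q\<in>big. integral Q (\<lambda>t. \<bar>g t\<bar>))"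
      proof (rule sum_mono)
        fix Q assume "Q \<in> big"
        then have "Q \<in> \<D>" "k \<le> \<bar>c Q\<bar>" by (auto simp: big_def)
        then show "measure lebesgue Q * k \<le> integral Q (\<lambda>t. \<bar>g t\<bar>)"
          using cmass[of Q] mult_left_mono[of k "\<bar>c Q\<bar>" "measure lebesgue Q"] by simp
      qed
      also have "\<dots> \<le> integral (\<Union>big) (\<lambda>t. \<bar>g t\<bar>)" by (rule famsum[OF big])
      also have "\<dots> \<le> integral ?U (\<lambda>t. \<bar>g t\<bar>)"
        using sub(4)[OF big] sum_measure_family(2)[OF sub(1-3)[OF big]]
        by (intro abs_integral_mono[OF gi]) auto
      also have "\<dots> \<le> S" using S(2)[OF x] by (simp add: g_def)
      finally have "(\<Sum>Q\<in>big. measure lebesgue Q) \<le> z / 2" using k S z by (simp add: k_def field_simps)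
      then show ?thesis using z(1) by linarith
    qed
    define N where "N = ?U \<inter> (\<Union>Q\<in>\<D>. frontier Q)"
    have N: "negligible N"
    proof -
      have "negligible (frontier Q)" if "Q \<in> \<D>" for Q
        using Dint(1)[OF that] by (auto elim!: intervalsE intro: negligible_convex_frontier)
      then have "negligible (\<Union>Q\<in>\<D>. frontier Q)" using \<D>(1) by (intro negligible_Union) auto
      then show ?thesis unfolding N_def by (rule negligible_subset) auto
    qed
    define Off where "Off = ?U - \<Union>\<D>"
    define R where "R = {t \<in> ?U. \<bar>h t\<bar> \<le> \<eta>}"
    \<comment> \<open>Each point of \<open>G\<close> lies inside a cell that is not bad, and there
      \<open>x f\<close> is far from the mean; so it cannot belong to \<open>A n\<close>.\<close>
    define G where "G = ?U - R - \<Union>bad - Off - N"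
    have sD: "\<Union>\<E> \<in> sets lebesgue" if "\<E> \<subseteq> \<D>" for \<E>
      using sum_measure_family(2)[OF sub(1-3)[OF that]] by (rule fmeasurableD)
    have sOff: "Off \<in> sets lebesgue" unfolding Off_def using sD[of \<D>] by (intro sets.Diff) auto
    have sN: "N \<in> sets lebesgue" using N by (rule negligible_imp_sets)
    have sR: "R \<in> sets lebesgue"
    proof -
      have "h \<in> borel_measurable (lebesgue_on ?U)"
        using hi by (intro integrable_imp_measurable) (auto simp: absolutely_integrable_on_def)
      then have "{t \<in> space (lebesgue_on ?U). \<bar>h t\<bar> \<le> \<eta>} \<in> sets (lebesgue_on ?U)"
        by measurable
      then show ?thesis unfolding R_def by (simp add: sets_restrict_space_iff)
    qed
    have sG: "G \<in> sets lebesgue" unfolding G_def using sR sOff sN sD[OF bad] by (intro sets.Diff) auto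
    have GU: "G \<subseteq> ?U" by (auto simp: G_def)
    have Gmem: "\<exists>Q\<in>\<D> - bad. t \<in> interior Q" if tG: "t \<in> G" for t
    proof -
      obtain Q where Q: "Q \<in> \<D>" "t \<in> Q" "Q \<notin> bad" using tG by (auto simp: G_def Off_def)
      have "t \<notin> frontier Q" using tG Q by (auto simp: G_def N_def)
      moreover have "closed Q" using Dint(1)[OF Q(1)] interval_compact compact_imp_closed by blast
      ultimately show ?thesis using Q by (auto simp: frontier_def)
    qed
    have "G \<inter> A n = {}"
    proof -
      have False if tG: "t \<in> G" and tA: "t \<in> A n" for t
      proof -
        obtain Q where Q: "Q \<in> \<D>" "Q \<notin> bad" "t \<in> interior Q" using Gmem[OF tG] by blast
        have "t \<in> Q" using Q(3) interior_subset by blast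
        then have "\<bar>g t - c Q\<bar> \<le> \<eta>" using Q tA by (force simp: bad_def)
        then have "t \<in> R" using \<phi>Q[OF Q(1,3)] tG GU by (auto simp: R_def h_def)
        then show False using tG by (simp add: G_def)
      qed
      then show ?thesis by blast
    qed
    then have mG: "measure lebesgue G < \<eta>'" using n sG GU by blast
    have hle: "integral B (\<lambda>t. \<bar>h t\<bar>) \<le> integral B (\<lambda>t. \<bar>g t\<bar>) + integral B (\<lambda>t. \<bar>\<phi> t\<bar>)"
      if B: "B \<in> sets lebesgue" "B \<subseteq> ?U" for B
    proof -
      note i = absolutely_integrable_on_subset(3)[OF _ B]
      have "integral B (\<lambda>t. \<bar>h t\<bar>) \<le> integral B (\<lambda>t. \<bar>g t\<bar> + \<bar>\<phi> t\<bar>)"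
        using i[OF hi] i[OF gi] i[OF \<phi>i] by (intro integral_le integrable_add) (auto simp: h_def)
      also have "\<dots> = integral B (\<lambda>t. \<bar>g t\<bar>) + integral B (\<lambda>t. \<bar>\<phi> t\<bar>)"
        using i[OF gi] i[OF \<phi>i] by (intro Henstock_Kurzweil_Integration.integral_add)
      finally show ?thesis .
    qed
    have bound: "integral B (\<lambda>t. \<bar>w t\<bar>) \<le> b * measure lebesgue B"
      if B: "B \<in> sets lebesgue" "B \<subseteq> ?U" and w: "w absolutely_integrable_on ?U" "\<And>t. t \<in> B \<Longrightarrow> \<bar>w t\<bar> \<le> b" for B w b
    proof -
      have lm: "B \<in> lmeasurable" using B by (rule lmeasurable_subset)
      have "integral B (\<lambda>t. \<bar>w t\<bar>) \<le> integral B (\<lambda>t. b)"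
        using absolutely_integrable_on_subset(3)[OF w(1) B] w(2)
        by (intro integral_le integrable_on_const lm) auto
      also have "\<dots> = integral B (\<lambda>t. b * 1)" by simp
      also have "\<dots> = b * measure lebesgue B"
        unfolding integral_mult_right lmeasure_integral[OF lm] ..
      finally show ?thesis .
    qed
    have 1: "integral R (\<lambda>t. \<bar>h t\<bar>) \<le> e / 8"
    proof -
      have "integral R (\<lambda>t. \<bar>h t\<bar>) \<le> \<eta> * measure lebesgue R"
        using sR hi by (intro bound) (auto simp: R_def)
      also have "\<dots> \<le> \<eta> * m0"
        unfolding m0_def using \<eta>(1) sR Ulm
        by (intro mult_left_mono measure_mono_fmeasurable) (auto simp: R_def)
      finally show ?thesis using \<eta>(2) by linarith
    qed
    have 2: "integral Off (\<lambda>t. \<bar>h t\<bar>) \<le> e / 8"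
    proof -
      have "integral Off (\<lambda>t. \<bar>h t\<bar>) = integral Off (\<lambda>t. \<bar>g t\<bar>)"
        by (intro integral_cong) (simp add: h_def \<phi>_def Off_def step_outside)
      also have "\<dots> \<le> e / 8"
        using sOff off by (intro small) (auto simp: Off_def)
      finally show ?thesis .
    qed
    have 3: "integral (\<Union>bad) (\<lambda>t. \<bar>h t\<bar>) \<le> e / 4"
      using hle[OF sD[OF bad] sub(4)[OF bad]] fam[OF bad badsum] by linarith
    have 4: "integral G (\<lambda>t. \<bar>h t\<bar>) \<le> 3 * e / 8"
    proof -
      have a: "integral G (\<lambda>t. \<bar>g t\<bar>) \<le> e / 8"
        using mG by (intro small sG GU) (simp add: \<eta>'_def)
      have sGb: "G - \<Union>big \<in> sets lebesgue" using sG sD[OF big] by (rule sets.Diff)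
      have "integral G (\<lambda>t. \<bar>\<phi> t\<bar>) \<le> integral ((G - \<Union>big) \<union> \<Union>big) (\<lambda>t. \<bar>\<phi> t\<bar>)"
        using sG sGb sD[OF big] GU sub(4)[OF big] by (intro abs_integral_mono[OF \<phi>i] sets.Un) auto
      also have "\<dots> \<le> integral (G - \<Union>big) (\<lambda>t. \<bar>\<phi> t\<bar>) + integral (\<Union>big) (\<lambda>t. \<bar>\<phi> t\<bar>)"
        using sGb sD[OF big] GU sub(4)[OF big] by (intro abs_integral_Un_le[OF \<phi>i]) auto
      also have "integral (\<Union>big) (\<lambda>t. \<bar>\<phi> t\<bar>) \<le> e / 8" using fam[OF big bigsum] by simp
      also have "integral (G - \<Union>big) (\<lambda>t. \<bar>\<phi> t\<bar>) \<le> k * measure lebesgue (G - \<Union>big)"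
      proof (rule bound[OF sGb _ \<phi>i])
        show "G - \<Union>big \<subseteq> ?U" using GU by blast
        fix t assume t: "t \<in> G - \<Union>big"
        then obtain Q where Q: "Q \<in> \<D>" "t \<in> interior Q" using Gmem by blast
        moreover have "Q \<notin> big" using t Q(2) interior_subset by blast
        ultimately show "\<bar>\<phi> t\<bar> \<le> k" using \<phi>Q[OF Q] by (simp add: big_def)
      qed
      also have "measure lebesgue (G - \<Union>big) \<le> measure lebesgue G"
        using sGb lmeasurable_subset[OF sG GU] by (intro measure_mono_fmeasurable) auto
      also have "measure lebesgue G \<le> e / (8 * k)" using mG by (simp add: \<eta>'_def)
      finally have "integral G (\<lambda>t. \<bar>\<phi> t\<bar>) \<le> k * (e / (8 * k)) + e / 8" using k by simp
      then have "integral G (\<lambda>t. \<bar>\<phi> t\<bar>) \<le> e / 4" using k by simp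
      then show ?thesis using hle[OF sG GU] a by linarith
    qed
    have "integral ?U (\<lambda>t. \<bar>h t\<bar>) \<le> integral (R \<union> (Off \<union> (\<Union>bad \<union> (G \<union> N)))) (\<lambda>t. \<bar>h t\<bar>)"
      using sR sOff sD[OF bad] sG sN sub(4)[OF bad]
      by (intro abs_integral_mono[OF hi] sets.Un) (auto simp: G_def R_def Off_def N_def)
    also have "\<dots> \<le> integral R (\<lambda>t. \<bar>h t\<bar>) + integral (Off \<union> (\<Union>bad \<union> (G \<union> N))) (\<lambda>t. \<bar>h t\<bar>)"
      using sR sOff sD[OF bad] sG sN sub(4)[OF bad] GU
      by (intro abs_integral_Un_le[OF hi] sets.Un) (auto simp: R_def Off_def N_def)
    also have "integral (Off \<union> (\<Union>bad \<union> (G \<union> N))) (\<lambda>t. \<bar>h t\<bar>)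
        \<le> integral Off (\<lambda>t. \<bar>h t\<bar>) + integral (\<Union>bad \<union> (G \<union> N)) (\<lambda>t. \<bar>h t\<bar>)"
      using sOff sD[OF bad] sG sN sub(4)[OF bad] GU
      by (intro abs_integral_Un_le[OF hi] sets.Un) (auto simp: Off_def N_def)
    also have "integral (\<Union>bad \<union> (G \<union> N)) (\<lambda>t. \<bar>h t\<bar>)
        \<le> integral (\<Union>bad) (\<lambda>t. \<bar>h t\<bar>) + integral (G \<union> N) (\<lambda>t. \<bar>h t\<bar>)"
      using sD[OF bad] sG sN sub(4)[OF bad] GU
      by (intro abs_integral_Un_le[OF hi] sets.Un) (auto simp: N_def)
    also have "integral (G \<union> N) (\<lambda>t. \<bar>h t\<bar>) \<le> integral G (\<lambda>t. \<bar>h t\<bar>) + integral N (\<lambda>t. \<bar>h t\<bar>)"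
      using sG sN GU by (intro abs_integral_Un_le[OF hi]) (auto simp: N_def)
    also have "integral N (\<lambda>t. \<bar>h t\<bar>) = 0" using N by (rule integral_negligible)
    \<comment> \<open>The shares are \<open>e / 8\<close> on \<open>R\<close>, \<open>e / 8\<close>
      on \<open>Off\<close>, \<open>e / 4\<close> on the bad cells and \<open>3 * e / 8\<close> on
      \<open>G\<close>.\<close>
    finally have "integral ?U (\<lambda>t. \<bar>h t\<bar>) \<le> e" using 1 2 3 4 e by linarith
    then show ?thesis by (simp add: h_def g_def \<phi>_def)
  qed
  then show ?thesis using \<D> by blast
qed

end

subsection \<open>A covering lemma for cubes\<close>

definition cube :: "real^'m \<Rightarrow> real \<Rightarrow> (real^'m) set" where
  "cube t r = cbox (\<chi> i. t $ i - r) (\<chi> i. t $ i + r)"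

lemma mem_cube: "s \<in> cube t r \<longleftrightarrow> (\<forall>i. \<bar>s $ i - t $ i\<bar> \<le> r)"
  unfolding cube_def mem_box_cart by (auto simp: abs_le_iff algebra_simps)

lemma infnorm_le_iff_cart: "infnorm (x :: real^'m) \<le> r \<longleftrightarrow> (\<forall>i. \<bar>x $ i\<bar> \<le> r)"
proof
  assume "infnorm x \<le> r"
  then show "\<forall>i. \<bar>x $ i\<bar> \<le> r" using component_le_infnorm_cart order_trans by blast
next
  assume *: "\<forall>i. \<bar>x $ i\<bar> \<le> r"
  have "Max ((\<lambda>i. \<bar>x \<bullet> i\<bar>) ` Basis) \<le> r"
    using * by (subst Max_le_iff) (auto simp: Basis_vec_def inner_axis)
  then show "infnorm x \<le> r" by (simp add: infnorm_Max)
qed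

lemma cube_eq_infnorm: "cube t r = {s. infnorm (s - t) \<le> r}"
  by (auto simp: mem_cube infnorm_le_iff_cart)

lemma max_ball_subset_cube: "max_ball t r \<subseteq> cube t r"
  by (auto simp: cube_eq_infnorm max_ball_def)

lemma cube_subset_max_ball: "r < r' \<Longrightarrow> cube t r \<subseteq> max_ball t r'"
  by (auto simp: cube_eq_infnorm max_ball_def)

lemma measure_cube: "0 \<le> r \<Longrightarrow> measure lebesgue (cube (t :: real^'m) r) = (2 * r) ^ CARD('m)"
proof -
  assume r: "0 \<le> r"
  then have "cube t r \<noteq> {}" using mem_cube[of t t r] by auto
  then show ?thesis unfolding cube_def by (simp add: content_cbox_cart)
qed

lemma cube_in_intervals: "0 < r \<Longrightarrow> cube t r \<in> intervals"
  unfolding cube_def intervals_def by (auto intro!: exI)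

lemma cube_enlarge:
  assumes "cube s r \<inter> cube t r' \<noteq> {}" "r \<le> r'"
  shows "cube s r \<subseteq> cube t (3 * r')"
proof
  fix u assume u: "u \<in> cube s r"
  obtain v where v: "v \<in> cube s r" "v \<in> cube t r'" using assms(1) by blast
  show "u \<in> cube t (3 * r')"
    unfolding mem_cube
  proof
    fix i
    have "\<bar>u $ i - s $ i\<bar> \<le> r" "\<bar>v $ i - s $ i\<bar> \<le> r" "\<bar>v $ i - t $ i\<bar> \<le> r'"
      using u v by (auto simp: mem_cube)
    then show "\<bar>u $ i - t $ i\<bar> \<le> 3 * r'" using assms(2) by linarith
  qed
qed

text \<open>Vitali's greedy selection: keep a largest cube \<open>m\<close>, discard the cubes that
  meet it, since its threefold enlargement contains them, and treat the rest by induction.\<close>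

lemma finite_cube_covering:
  assumes "finite T" "\<And>t. t \<in> T \<Longrightarrow> 0 < r t"
  shows "\<exists>S\<subseteq>T. (\<forall>s\<in>S. \<forall>t\<in>S. s \<noteq> t \<longrightarrow> cube s (r s) \<inter> cube t (r t) = {}) \<and>
    (\<Union>t\<in>T. cube t (r t)) \<subseteq> (\<Union>s\<in>S. cube s (3 * r s))"
  using assms
proof (induction T rule: finite_psubset_induct)
  case (psubset T)
  show ?case
  proof (cases "T = {}")
    case True
    then show ?thesis by auto
  next
    case False
    obtain m where m: "m \<in> T" "\<And>t. t \<in> T \<Longrightarrow> r t \<le> r m"
    proof -
      have "Max (r ` T) \<in> r ` T" using psubset.hyps False by (intro Max_in) auto
      then obtain m where "m \<in> T" "r m = Max (r ` T)" by auto
      then show ?thesis using psubset.hyps by (intro that[of m]) auto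
    qed
    define T' where "T' = {t \<in> T. cube t (r t) \<inter> cube m (r m) = {}}"
    have mc: "m \<in> cube m (r m)" using psubset.prems[OF m(1)] by (simp add: mem_cube)
    then have "T' \<subset> T" using m(1) by (auto simp: T'_def)
    then obtain S where S: "S \<subseteq> T'" "\<forall>s\<in>S. \<forall>t\<in>S. s \<noteq> t \<longrightarrow> cube s (r s) \<inter> cube t (r t) = {}"
        "(\<Union>t\<in>T'. cube t (r t)) \<subseteq> (\<Union>s\<in>S. cube s (3 * r s))"
      using psubset.IH[of T'] psubset.prems by blast
    have "cube t (r t) \<subseteq> (\<Union>s\<in>insert m S. cube s (3 * r s))" if "t \<in> T" for t
    proof (cases "t \<in> T'")
      case True
      then show ?thesis using S(3) by blast
    next
      case False
      then have "cube t (r t) \<subseteq> cube m (3 * r m)"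
        using that m(2)[OF that] by (intro cube_enlarge) (auto simp: T'_def)
      then show ?thesis by blast
    qed
    moreover have "\<forall>s\<in>insert m S. \<forall>t\<in>insert m S. s \<noteq> t \<longrightarrow> cube s (r s) \<inter> cube t (r t) = {}"
      using S(1,2) unfolding T'_def by blast
    moreover have "insert m S \<subseteq> T" using S(1) m(1) by (auto simp: T'_def)
    ultimately show ?thesis by (intro exI[of _ "insert m S"]) blast
  qed
qed

text \<open>The price for passing from intervals near the tags to disjoint cubes centred at them is
  the dimensional factor \<open>3 ^ CARD('m)\<close>.\<close>

lemma measure_le_cube_packing:
  fixes T :: "(real^'m) set"
  assumes T: "finite T" "\<And>t. t \<in> T \<Longrightarrow> 0 < r t"
    and B: "B \<in> sets lebesgue" "B \<subseteq> (\<Union>t\<in>T. cube t (r t))"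
  obtains S where "S \<subseteq> T" "\<And>s t. s \<in> S \<Longrightarrow> t \<in> S \<Longrightarrow> s \<noteq> t \<Longrightarrow> cube s (r s) \<inter> cube t (r t) = {}"
    "measure lebesgue B \<le> 3 ^ CARD('m) * (\<Sum>s\<in>S. measure lebesgue (cube s (r s)))"
proof -
  have "\<exists>S\<subseteq>T. (\<forall>s\<in>S. \<forall>t\<in>S. s \<noteq> t \<longrightarrow> cube s (r s) \<inter> cube t (r t) = {}) \<and>
      (\<Union>t\<in>T. cube t (r t)) \<subseteq> (\<Union>s\<in>S. cube s (3 * r s))"
    using T by (rule finite_cube_covering)
  then obtain S where S: "S \<subseteq> T" "\<forall>s\<in>S. \<forall>t\<in>S. s \<noteq> t \<longrightarrow> cube s (r s) \<inter> cube t (r t) = {}"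
      "(\<Union>t\<in>T. cube t (r t)) \<subseteq> (\<Union>s\<in>S. cube s (3 * r s))"
    by (elim exE conjE)
  have fin: "finite S" using S(1) T(1) by (rule finite_subset)
  have lm: "cube s c \<in> lmeasurable" for s :: "real^'m" and c by (simp add: cube_def)
  have "measure lebesgue B \<le> measure lebesgue (\<Union>s\<in>S. cube s (3 * r s))"
    using B S(3) fin lm by (intro measure_mono_fmeasurable fmeasurable.finite_UN) auto
  also have "\<dots> \<le> (\<Sum>s\<in>S. measure lebesgue (cube s (3 * r s)))"
    using fin lm by (intro measure_UNION_le) auto
  also have "\<dots> = (\<Sum>s\<in>S. 3 ^ CARD('m) * measure lebesgue (cube s (r s)))"
  proof (rule sum.cong[OF refl])
    fix s assume "s \<in> S"
    then have "0 < r s" using S(1) T(2) by blast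
    then show "measure lebesgue (cube s (3 * r s)) = 3 ^ CARD('m) * measure lebesgue (cube s (r s))"
      using power_mult_distrib[of 3 "2 * r s" "CARD('m)"] by (simp add: measure_cube)
  qed
  also have "\<dots> = 3 ^ CARD('m) * (\<Sum>s\<in>S. measure lebesgue (cube s (r s)))"
    by (rule sum_distrib_left[symmetric])
  finally show ?thesis using S(1,2) by (intro that[of S]) auto
qed

lemma open_superset_of_negligible:
  fixes N :: "(real^'m) set"
  assumes N: "negligible N" and z: "0 < z" and U: "open U" "U \<in> lmeasurable"
  obtains V where "open V" "N \<subseteq> V" "measure lebesgue (V \<inter> U) < z"
proof -
  have Ns: "N \<in> sets lebesgue" using N by (rule negligible_imp_sets)
  obtain V where V: "open V" "N \<subseteq> V" "V - N \<in> lmeasurable" "emeasure lebesgue (V - N) < ennreal z"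
    using sets_lebesgue_outer_open[OF Ns z] by blast
  have "measure lebesgue (V \<inter> U) \<le> measure lebesgue ((V - N) \<union> N)"
  proof (rule measure_mono_fmeasurable)
    show "(V - N) \<union> N \<in> lmeasurable"
      using V(3) negligible_imp_measurable[OF N] by (rule fmeasurable.Un)
    show "V \<inter> U \<in> sets lebesgue" using V(1) U(1) by simp
  qed auto
  also have "\<dots> \<le> measure lebesgue (V - N) + measure lebesgue N"
    using V(3) Ns by (intro measure_Un_le) auto
  also have "\<dots> < z" using V(3,4) N
    by (simp add: negligible_imp_measure0 emeasure_eq_measure2 ennreal_less_iff)
  finally show ?thesis using V(1,2) by (intro that)
qed

subsection \<open>From Henstock-Kurzweil to McShane\<close>

lemma M_partition_subset: "M_partition U \<pi> \<Longrightarrow> \<pi>' \<subseteq> \<pi> \<Longrightarrow> M_partition U \<pi>'"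
  unfolding M_partition_def by (meson finite_subset subsetD)

context Dunford_primitive
begin

text \<open>Once a norming functional is chosen, the pairs fall into three classes: tags on a
  frontier of a cell, where the gauge forces the intervals into the small set \<open>V\<close>; tags
  where \<open>x f\<close> is within \<open>\<eta>\<close> of the step function; and the remaining
  ones, whose intervals have small total measure by the packing argument. Small total measure
  suffices because \<open>norm (f t) \<le> M\<close>.\<close>

lemma M_estimate_bounded_tags:
  assumes HK: "\<And>e. 0 < e \<Longrightarrow> \<exists>\<delta>. gauge_on (interior I0) \<delta> \<and> (\<forall>\<pi>. HK_partition (interior I0) \<pi> \<longrightarrow>
      fine_partition \<delta> \<pi> \<longrightarrow> norm (\<Sum>(t, I)\<in>\<pi>. measure lebesgue I *\<^sub>R f t - F I) < e)"
    and M: "0 \<le> M" and tol: "0 < tol"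
  shows "\<exists>\<delta>. gauge_on (interior I0) \<delta> \<and> (\<forall>\<pi>. M_partition (interior I0) \<pi> \<longrightarrow> fine_partition \<delta> \<pi> \<longrightarrow>
      (\<forall>(t, I)\<in>\<pi>. norm (f t) \<le> M) \<longrightarrow> norm (\<Sum>(t, I)\<in>\<pi>. measure lebesgue I *\<^sub>R f t - F I) \<le> tol)"
proof -
  let ?U = "interior I0"
  define m0 where "m0 = measure lebesgue ?U"
  have Ulm: "?U \<in> lmeasurable" by (rule lmeasurable_subset) auto
  have m0: "0 \<le> m0" by (simp add: m0_def)
  \<comment> \<open>The budget is \<open>2 * b\<close> for frontier tags, \<open>4 * b\<close> for
    bad tags and \<open>2 * b\<close> for good tags.\<close>
  define b where "b = tol / 8"
  have b: "0 < b" using tol by (simp add: b_def)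
  define \<eta> where "\<eta> = b / (m0 + 1)"
  have \<eta>: "0 < \<eta>" "\<eta> * m0 \<le> b" using b m0 by (auto simp: \<eta>_def field_simps)
  obtain z where z: "0 < z" "\<And>A (x::'x \<Rightarrow>\<^sub>L real). A \<in> sets lebesgue \<Longrightarrow> A \<subseteq> ?U \<Longrightarrow>
      measure lebesgue A < z \<Longrightarrow> norm x \<le> 1 \<Longrightarrow> mass x A \<le> b"
    using uniformly_absolutely_continuous[OF b] by blast
  \<comment> \<open>A family of total measure at most \<open>\<kappa>\<close> has integrals bounded
    by \<open>b\<close> through \<open>z\<close>, and Riemann terms bounded by
    \<open>M * \<kappa> \<le> b\<close>.\<close>
  define \<kappa> where "\<kappa> = min (z / 2) (b / (M + 1))"
  have \<kappa>: "0 < \<kappa>" "\<kappa> < z" using z(1) b M by (auto simp: \<kappa>_def)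
  have M\<kappa>: "M * \<kappa> \<le> b"
  proof -
    have "M * \<kappa> \<le> M * (b / (M + 1))" using M by (intro mult_left_mono) (auto simp: \<kappa>_def)
    also have "\<dots> \<le> b" using M b by (simp add: field_simps)
    finally show ?thesis .
  qed
  define q where "q = (3::real) ^ CARD('m)"
  have q: "0 < q" by (simp add: q_def)
  \<comment> \<open>In the packing argument the cubes incur \<open>2 * e1\<close> from the
    Henstock-Kurzweil estimate and \<open>e1\<close> from the step approximation; \<open>q\<close>
    is the covering factor.\<close>
  define e1 where "e1 = min b (\<eta> * \<kappa> / (3 * q))"
  have e1: "0 < e1" using b \<eta> \<kappa> q by (simp add: e1_def)
  have e1b: "e1 \<le> b" by (simp add: e1_def)
  have e1\<kappa>: "q * (3 * e1 / \<eta>) \<le> \<kappa>"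
  proof -
    have "e1 \<le> \<eta> * \<kappa> / (3 * q)" by (simp add: e1_def)
    then show ?thesis using q \<eta>(1) by (simp add: field_simps)
  qed
  obtain \<delta>H where \<delta>H: "gauge_on ?U \<delta>H" "\<And>\<pi>. HK_partition ?U \<pi> \<Longrightarrow> fine_partition \<delta>H \<pi> \<Longrightarrow>
      norm (\<Sum>(t, I)\<in>\<pi>. measure lebesgue I *\<^sub>R f t - F I) < e1"
    using HK[OF e1] by blast
  obtain \<D> where \<D>: "finite \<D>" "\<D> \<subseteq> intervals_in ?U" "pairwise nonoverlapping \<D>"
    and approx: "\<And>x::'x \<Rightarrow>\<^sub>L real. norm x \<le> 1 \<Longrightarrow>
      integral ?U (\<lambda>t. \<bar>blinfun_apply x (f t) - blinfun_apply x (step \<D> t)\<bar>) \<le> e1"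
    using step_approximation[OF HK e1] by blast
  have Dint: "\<D> \<subseteq> intervals" using \<D>(2) by (auto simp: intervals_in_def)
  define N where "N = (\<Union>Q\<in>\<D>. frontier Q)"
  have "negligible N"
    unfolding N_def
  proof (rule negligible_Union)
    show "finite (frontier ` \<D>)" using \<D>(1) by simp
    show "negligible T" if "T \<in> frontier ` \<D>" for T
      using that Dint by (auto elim!: intervalsE intro!: negligible_convex_frontier)
  qed
  then obtain V where V: "open V" "N \<subseteq> V" "measure lebesgue (V \<inter> ?U) < \<kappa>"
    using \<kappa>(1) Ulm by (rule open_superset_of_negligible[OF _ _ open_interior])
  \<comment> \<open>The doubled radius makes room for the closed cube of radius \<open>r\<close>
    around \<open>t\<close>: it contains the intervals tagged by \<open>t\<close>, yet is still fine
    for \<open>\<delta>H\<close> and sees a constant step function.\<close>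
  define R where "R t r \<longleftrightarrow> 0 < r \<and> (t \<in> N \<longrightarrow> max_ball t r \<subseteq> V \<inter> ?U) \<and>
      (t \<notin> N \<longrightarrow> 2 * r \<le> \<delta>H t \<and> max_ball t (2 * r) \<subseteq> ?U \<and>
      (\<forall>s\<in>max_ball t (2 * r). step \<D> s = step \<D> t))" for t r
  have "\<exists>r. R t r" if t: "t \<in> ?U" for t
  proof (cases "t \<in> N")
    case True
    obtain r where "0 < r" "max_ball t r \<subseteq> V \<inter> ?U"
      by (rule open_contains_max_ball[of "V \<inter> ?U" t]) (use V True t in auto)

    then show ?thesis using True unfolding R_def by blast
  next
    case False
    obtain r where r: "0 < r" "max_ball t r \<subseteq> ?U" "\<forall>s\<in>max_ball t r. step \<D> s = step \<D> t"
      using step_locally_constant[OF \<D>(1) Dint t] False unfolding N_def by blast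
    define r' where "r' = min r (\<delta>H t) / 2"
    have r': "0 < r'" "2 * r' \<le> \<delta>H t" "2 * r' \<le> r"
      using r(1) \<delta>H(1) t by (auto simp: r'_def gauge_on_def)
    then have "max_ball t (2 * r') \<subseteq> max_ball t r" by (intro max_ball_mono)
    then show ?thesis using r r' False unfolding R_def by (intro exI[of _ r']) blast
  qed
  then obtain \<delta> where R: "\<And>t. t \<in> ?U \<Longrightarrow> R t (\<delta> t)" by metis
  have \<delta>: "0 < \<delta> t" if "t \<in> ?U" for t using R[OF that] by (simp add: R_def)
  have \<delta>N: "max_ball t (\<delta> t) \<subseteq> V \<inter> ?U" if "t \<in> ?U" "t \<in> N" for t
    using R[OF that(1)] that(2) unfolding R_def by blast
  have \<delta>H': "2 * \<delta> t \<le> \<delta>H t" and \<delta>U: "max_ball t (2 * \<delta> t) \<subseteq> ?U" if "t \<in> ?U" "t \<notin> N" for t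
    using R[OF that(1)] that(2) unfolding R_def by blast+
  have \<delta>c: "step \<D> s = step \<D> t" if "t \<in> ?U" "t \<notin> N" "s \<in> max_ball t (2 * \<delta> t)" for t s
    using R[OF that(1)] that(2,3) unfolding R_def by blast
  have "norm (\<Sum>(t, I)\<in>\<pi>. measure lebesgue I *\<^sub>R f t - F I) \<le> tol"
    if \<pi>: "M_partition ?U \<pi>" and fine: "fine_partition \<delta> \<pi>" and bd: "\<forall>(t, I)\<in>\<pi>. norm (f t) \<le> M" for \<pi>
  proof -
    \<comment> \<open>The functional depends on \<open>\<pi>\<close>; this is harmless, because
      \<open>\<delta>\<close> and \<open>\<D>\<close> were fixed with estimates uniform over the
      unit ball.\<close>
    obtain x :: "'x \<Rightarrow>\<^sub>L real" where x: "norm x \<le> 1"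
      "blinfun_apply x (\<Sum>(t, I)\<in>\<pi>. measure lebesgue I *\<^sub>R f t - F I) = norm (\<Sum>(t, I)\<in>\<pi>. measure lebesgue I *\<^sub>R f t - F I)"
      by (rule norming_functional)
    define g where "g t = blinfun_apply x (f t)" for t
    define \<phi> where "\<phi> t = blinfun_apply x (step \<D> t)" for t
    define h where "h t = g t - \<phi> t" for t
    have gi: "g absolutely_integrable_on ?U" unfolding g_def by (rule scalar_integrable)
    have \<phi>i: "\<phi> absolutely_integrable_on ?U" unfolding \<phi>_def by (rule step_absolutely_integrable)
    have hi: "h absolutely_integrable_on ?U" unfolding h_def using gi \<phi>i by (rule set_integral_diff(1))
    have happ: "integral ?U (\<lambda>t. \<bar>h t\<bar>) \<le> e1" using approx[OF x(1)] by (simp add: h_def g_def \<phi>_def)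
    have fin: "finite \<pi>" using \<pi> by (simp add: M_partition_def)
    have tU: "fst p \<in> ?U" and Iin: "snd p \<in> intervals_in ?U" if "p \<in> \<pi>" for p
      using \<pi> that by (auto simp: M_partition_def)
    have Iint: "snd p \<in> intervals" "snd p \<subseteq> ?U" "snd p \<in> sets lebesgue" "snd p \<in> lmeasurable" if "p \<in> \<pi>" for p
      using Iin[OF that] interval_lmeasurable[of "snd p"] by (auto simp: intervals_in_def)
    have nov: "nonoverlapping (snd p) (snd p')" if "p \<in> \<pi>" "p' \<in> \<pi>" "p \<noteq> p'" for p p'
      using \<pi> that by (simp add: M_partition_def)
    have If: "snd p \<subseteq> max_ball (fst p) (\<delta> (fst p))" if "p \<in> \<pi>" for p
      using fine that unfolding fine_partition_def by (metis (no_types, lifting) case_prod_beta)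
    have gM: "\<bar>g (fst p)\<bar> \<le> M" if "p \<in> \<pi>" for p
    proof -
      have "\<bar>g (fst p)\<bar> \<le> norm x * norm (f (fst p))" unfolding g_def using norm_blinfun[of x "f (fst p)"] by simp
      also have "norm (f (fst p)) \<le> M" using bd that by (metis (no_types, lifting) case_prod_beta)
      then have "norm x * norm (f (fst p)) \<le> 1 * M" using x(1) by (intro mult_mono) auto
      finally show ?thesis by simp
    qed
    have phic: "\<phi> s = \<phi> (fst p)" if "p \<in> \<pi>" "fst p \<notin> N" "s \<in> snd p" for p s
    proof -
      have "max_ball (fst p) (\<delta> (fst p)) \<subseteq> max_ball (fst p) (2 * \<delta> (fst p))"
        using \<delta>[OF tU[OF that(1)]] by (intro max_ball_mono) simp
      then have "s \<in> max_ball (fst p) (2 * \<delta> (fst p))" using If[OF that(1)] that(3) by blast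
      then show ?thesis unfolding \<phi>_def using \<delta>c[OF tU[OF that(1)] that(2)] by metis
    qed
    \<comment> \<open>Used both for intervals of \<open>\<pi>\<close> and for the cubes: where
      \<open>\<phi>\<close> has a constant value, the oscillation of \<open>g\<close> on
      \<open>J\<close> is carried by \<open>h\<close>, which is small in
      \<open>L\<^sup>1\<close>.\<close>
    have dec: "integral J g = measure lebesgue J * c + integral J h \<and> integral J (\<lambda>t. \<bar>\<phi> t\<bar>) = measure lebesgue J * \<bar>c\<bar> \<and>
        \<bar>integral J h\<bar> \<le> integral J (\<lambda>t. \<bar>h t\<bar>) \<and> integral J (\<lambda>t. \<bar>\<phi> t\<bar>) \<le> integral J (\<lambda>t. \<bar>g t\<bar>) + integral J (\<lambda>t. \<bar>h t\<bar>)"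
      if J: "J \<in> lmeasurable" "J \<subseteq> ?U" and c: "\<And>s. s \<in> J \<Longrightarrow> \<phi> s = c" for J c
    proof (intro conjI)
      have Js: "J \<in> sets lebesgue" using J(1) by (rule fmeasurableD)
      note i = absolutely_integrable_on_subset[OF _ Js J(2)]
      have const: "integral J (\<lambda>t. a) = measure lebesgue J * a" for a :: real
      proof -
        have "integral J (\<lambda>t. a) = integral J (\<lambda>t. a * 1)" by simp
        also have "\<dots> = a * integral J (\<lambda>t. 1)" by (rule integral_mult_right)
        finally show ?thesis by (simp add: lmeasure_integral[OF J(1)] mult.commute)
      qed
      have "integral J g = integral J (\<lambda>t. \<phi> t + h t)" by (simp add: h_def)
      also have "\<dots> = integral J \<phi> + integral J h"
        using i(2)[OF \<phi>i] i(2)[OF hi] by (rule Henstock_Kurzweil_Integration.integral_add)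
      also have "integral J \<phi> = integral J (\<lambda>t. c)" by (rule integral_cong) (rule c)
      finally show "integral J g = measure lebesgue J * c + integral J h" using const by simp
      have "integral J (\<lambda>t. \<bar>\<phi> t\<bar>) = integral J (\<lambda>t. \<bar>c\<bar>)" by (rule integral_cong) (simp add: c)
      then show "integral J (\<lambda>t. \<bar>\<phi> t\<bar>) = measure lebesgue J * \<bar>c\<bar>" using const by simp
      show "\<bar>integral J h\<bar> \<le> integral J (\<lambda>t. \<bar>h t\<bar>)" using Js J(2) by (rule integral_abs_bound_subset[OF hi])
      have "integral J (\<lambda>t. \<bar>\<phi> t\<bar>) \<le> integral J (\<lambda>t. \<bar>g t\<bar> + \<bar>h t\<bar>)"
        using i(3)[OF \<phi>i] integrable_add[OF i(3)[OF gi] i(3)[OF hi]] by (rule integral_le) (simp add: h_def)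
      also have "\<dots> = integral J (\<lambda>t. \<bar>g t\<bar>) + integral J (\<lambda>t. \<bar>h t\<bar>)"
        using i(3)[OF gi] i(3)[OF hi] by (rule Henstock_Kurzweil_Integration.integral_add)
      finally show "integral J (\<lambda>t. \<bar>\<phi> t\<bar>) \<le> integral J (\<lambda>t. \<bar>g t\<bar>) + integral J (\<lambda>t. \<bar>h t\<bar>)" .
    qed
    have UN: "(\<Union>p\<in>P. snd p) \<in> lmeasurable \<and> (\<Union>p\<in>P. snd p) \<subseteq> ?U \<and>
        measure lebesgue (\<Union>p\<in>P. snd p) = (\<Sum>p\<in>P. measure lebesgue (snd p))" if P: "P \<subseteq> \<pi>" for P
    proof (intro conjI)
      show "(\<Union>p\<in>P. snd p) \<in> lmeasurable"
        using finite_subset[OF P fin] Iint(4) P by (intro fmeasurable.finite_UN) auto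
      show "(\<Union>p\<in>P. snd p) \<subseteq> ?U" using P Iint(2) by blast
      show "measure lebesgue (\<Union>p\<in>P. snd p) = (\<Sum>p\<in>P. measure lebesgue (snd p))"
      proof (rule measure_negligible_finite_Union_image)
        show "finite P" using P fin by (rule finite_subset)
        show "snd p \<in> lmeasurable" if "p \<in> P" for p using that P Iint(4) by blast
        show "pairwise (\<lambda>p p'. negligible (snd p \<inter> snd p')) P"
          using P Iint(1) nov unfolding pairwise_def by (meson nonoverlapping_negligible subsetD)
      qed
    qed
    have fam: "(\<Sum>p\<in>P. integral (snd p) (\<lambda>t. \<bar>w t\<bar>)) \<le> integral A (\<lambda>t. \<bar>w t\<bar>)"
      if P: "P \<subseteq> \<pi>" and w: "w absolutely_integrable_on ?U" and A: "A \<in> sets lebesgue" "A \<subseteq> ?U" "(\<Union>p\<in>P. snd p) \<subseteq> A"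
      for P A and w :: "real^'m \<Rightarrow> real"
    proof (rule abs_integral_family_le[OF w])
      show "finite P" using P fin by (rule finite_subset)
      show "snd p \<in> intervals" if "p \<in> P" for p using that P Iint(1) by blast
      show "snd p \<subseteq> A" if "p \<in> P" for p using that A(3) by blast
      show "nonoverlapping (snd p) (snd p')" if "p \<in> P" "p' \<in> P" "p \<noteq> p'" for p p' using that P nov by blast
    qed (use A in auto)
    have smallP: "(\<Sum>p\<in>P. measure lebesgue (snd p) * M + integral (snd p) (\<lambda>t. \<bar>g t\<bar>)) \<le> 2 * b"
      if P: "P \<subseteq> \<pi>" and mP: "(\<Sum>p\<in>P. measure lebesgue (snd p)) \<le> \<kappa>" for P
    proof -
      have s: "(\<Union>p\<in>P. snd p) \<in> sets lebesgue" using UN[OF P] by (blast dest: fmeasurableD)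
      have "(\<Sum>p\<in>P. integral (snd p) (\<lambda>t. \<bar>g t\<bar>)) \<le> integral (\<Union>p\<in>P. snd p) (\<lambda>t. \<bar>g t\<bar>)"
        using UN[OF P] s by (intro fam[OF P gi]) auto
      also have "\<dots> \<le> b"
        unfolding g_def using UN[OF P] mP \<kappa>(2) by (intro z(2)[OF s _ _ x(1)]) auto
      finally have "(\<Sum>p\<in>P. integral (snd p) (\<lambda>t. \<bar>g t\<bar>)) \<le> b" .
      moreover have "(\<Sum>p\<in>P. measure lebesgue (snd p) * M) \<le> b"
        using mult_left_mono[OF mP M] M\<kappa> by (simp add: sum_distrib_right mult.commute sum_distrib_left)
      ultimately show ?thesis by (simp add: sum.distrib)
    qed
    define err where "err p = measure lebesgue (snd p) * g (fst p) - integral (snd p) g" for p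
    define PN where "PN = {p \<in> \<pi>. fst p \<in> N}"
    define PB where "PB = {p \<in> \<pi>. fst p \<notin> N \<and> \<eta> < \<bar>g (fst p) - \<phi> (fst p)\<bar>}"
    define PG where "PG = {p \<in> \<pi>. fst p \<notin> N \<and> \<bar>g (fst p) - \<phi> (fst p)\<bar> \<le> \<eta>}"
    have split: "\<pi> = PN \<union> (PB \<union> PG)" "PN \<inter> (PB \<union> PG) = {}" "PB \<inter> PG = {}"
      and sub: "PN \<subseteq> \<pi>" "PB \<subseteq> \<pi>" "PG \<subseteq> \<pi>"
      by (auto simp: PN_def PB_def PG_def)
    have finP: "finite PN" "finite PB" "finite PG" using sub fin by (auto intro: finite_subset)
    have PN: "(\<Sum>p\<in>PN. \<bar>err p\<bar>) \<le> 2 * b"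
    proof -
      have "(\<Sum>p\<in>PN. \<bar>err p\<bar>) \<le> (\<Sum>p\<in>PN. measure lebesgue (snd p) * M + integral (snd p) (\<lambda>t. \<bar>g t\<bar>))"
      proof (rule sum_mono)
        fix p assume p: "p \<in> PN"
        then have p': "p \<in> \<pi>" using sub by blast
        have "\<bar>integral (snd p) g\<bar> \<le> integral (snd p) (\<lambda>t. \<bar>g t\<bar>)"
          using Iint(3,2)[OF p'] by (rule integral_abs_bound_subset[OF gi])
        moreover have "\<bar>measure lebesgue (snd p) * g (fst p)\<bar> \<le> measure lebesgue (snd p) * M"
          using gM[OF p'] by (simp add: abs_mult mult_left_mono)
        ultimately show "\<bar>err p\<bar> \<le> measure lebesgue (snd p) * M + integral (snd p) (\<lambda>t. \<bar>g t\<bar>)"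
          unfolding err_def by linarith
      qed
      also have "\<dots> \<le> 2 * b"
      proof (rule smallP[OF sub(1)])
        have "(\<Union>p\<in>PN. snd p) \<subseteq> V \<inter> ?U"
          using If \<delta>N tU unfolding PN_def by blast
        then have "measure lebesgue (\<Union>p\<in>PN. snd p) \<le> measure lebesgue (V \<inter> ?U)"
          using UN[OF sub(1)] V(1) Ulm
          by (intro measure_mono_fmeasurable) (auto intro: fmeasurableI2[OF Ulm])
        then show "(\<Sum>p\<in>PN. measure lebesgue (snd p)) \<le> \<kappa>" using UN[OF sub(1)] V(3) by simp
      qed
      finally show ?thesis .
    qed
    have split_err: "err p = measure lebesgue (snd p) * (g (fst p) - \<phi> (fst p)) - integral (snd p) h"
      and phi_int: "measure lebesgue (snd p) * \<bar>\<phi> (fst p)\<bar> \<le> integral (snd p) (\<lambda>t. \<bar>g t\<bar>) + integral (snd p) (\<lambda>t. \<bar>h t\<bar>)"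
      and h_int: "\<bar>integral (snd p) h\<bar> \<le> integral (snd p) (\<lambda>t. \<bar>h t\<bar>)"
      if "p \<in> \<pi>" "fst p \<notin> N" for p
      using dec[OF Iint(4,2)[OF that(1)] phic[OF that]] by (auto simp: err_def right_diff_distrib)
    have PG: "(\<Sum>p\<in>PG. \<bar>err p\<bar>) \<le> b + (\<Sum>p\<in>PG. integral (snd p) (\<lambda>t. \<bar>h t\<bar>))"
    proof -
      have "(\<Sum>p\<in>PG. \<bar>err p\<bar>) \<le> (\<Sum>p\<in>PG. measure lebesgue (snd p) * \<eta> + integral (snd p) (\<lambda>t. \<bar>h t\<bar>))"
      proof (rule sum_mono)
        fix p assume p: "p \<in> PG"
        then have p': "p \<in> \<pi>" "fst p \<notin> N" "\<bar>g (fst p) - \<phi> (fst p)\<bar> \<le> \<eta>" by (auto simp: PG_def)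
        have "\<bar>measure lebesgue (snd p) * (g (fst p) - \<phi> (fst p))\<bar> \<le> measure lebesgue (snd p) * \<eta>"
          using p'(3) by (simp add: abs_mult mult_left_mono)
        then show "\<bar>err p\<bar> \<le> measure lebesgue (snd p) * \<eta> + integral (snd p) (\<lambda>t. \<bar>h t\<bar>)"
          using split_err[OF p'(1,2)] h_int[OF p'(1,2)] by linarith
      qed
      also have "\<dots> = \<eta> * measure lebesgue (\<Union>p\<in>PG. snd p) + (\<Sum>p\<in>PG. integral (snd p) (\<lambda>t. \<bar>h t\<bar>))"
        using UN[OF sub(3)] by (simp add: sum.distrib sum_distrib_left mult.commute)
      also have "measure lebesgue (\<Union>p\<in>PG. snd p) \<le> m0"
        unfolding m0_def using UN[OF sub(3)] Ulm by (intro measure_mono_fmeasurable) auto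
      finally show ?thesis using \<eta> by (simp add: mult_left_mono order_trans)
    qed
    have PBm: "(\<Sum>p\<in>PB. measure lebesgue (snd p)) \<le> \<kappa>"
    proof -
      \<comment> \<open>One tag may carry many intervals, so the covering is done over the set of
        tags. Each interval lies in the cube of its tag, and a selected cube contains its centre, as
        the Henstock-Kurzweil estimate requires.\<close>
      define T where "T = fst ` PB"
      have T: "finite T" "\<And>t. t \<in> T \<Longrightarrow> t \<in> ?U" "\<And>t. t \<in> T \<Longrightarrow> t \<notin> N" "\<And>t. t \<in> T \<Longrightarrow> \<eta> < \<bar>g t - \<phi> t\<bar>"
        using finP(2) tU by (auto simp: T_def PB_def)
      have Bs: "(\<Union>p\<in>PB. snd p) \<in> sets lebesgue" using UN[OF sub(2)] by (blast dest: fmeasurableD)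
      have Bsub: "(\<Union>p\<in>PB. snd p) \<subseteq> (\<Union>t\<in>T. cube t (\<delta> t))"
        using If max_ball_subset_cube sub(2) unfolding T_def by blast
      obtain S where S: "S \<subseteq> T" "\<And>s t. s \<in> S \<Longrightarrow> t \<in> S \<Longrightarrow> s \<noteq> t \<Longrightarrow> cube s (\<delta> s) \<inter> cube t (\<delta> t) = {}"
        and Sm: "measure lebesgue (\<Union>p\<in>PB. snd p) \<le> 3 ^ CARD('m) * (\<Sum>s\<in>S. measure lebesgue (cube s (\<delta> s)))"
        by (rule measure_le_cube_packing[OF T(1) _ Bs Bsub]) (blast intro: \<delta> T(2), rule that)
      have finS: "finite S" using S(1) T(1) by (rule finite_subset)
      have ST: "s \<in> ?U" "s \<notin> N" "\<eta> < \<bar>g s - \<phi> s\<bar>" "0 < \<delta> s" if "s \<in> S" for s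
        using that S(1) T \<delta> by auto
      have cs: "cube s (\<delta> s) \<subseteq> max_ball s (2 * \<delta> s)" if "s \<in> S" for s
        using ST(4)[OF that] by (intro cube_subset_max_ball) simp
      have cU: "cube s (\<delta> s) \<subseteq> ?U" if "s \<in> S" for s using cs[OF that] \<delta>U[OF ST(1,2)[OF that]] by blast
      have cI: "cube s (\<delta> s) \<in> intervals_in ?U" if "s \<in> S" for s
        using cU[OF that] cube_in_intervals[OF ST(4)[OF that]] by (auto simp: intervals_in_def)
      have clm: "cube s (\<delta> s) \<in> lmeasurable" for s by (simp add: cube_def)
      define \<pi>' where "\<pi>' = (\<lambda>s. (s, cube s (\<delta> s))) ` S"
      have inj: "inj_on (\<lambda>s. (s, cube s (\<delta> s))) S" by (rule inj_onI) simp
      have novS: "nonoverlapping (cube s (\<delta> s)) (cube t (\<delta> t))" if "s \<in> S" "t \<in> S" "s \<noteq> t" for s t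
        using S(2)[OF that] interior_subset unfolding nonoverlapping_def by blast
      have "HK_partition ?U \<pi>'"
        unfolding HK_partition_def M_partition_def
      proof (intro conjI)
        show "finite \<pi>'" unfolding \<pi>'_def using finS by simp
        show "\<forall>(t, I)\<in>\<pi>'. t \<in> ?U \<and> I \<in> intervals_in ?U"
          unfolding \<pi>'_def using ST(1) cI by auto
        show "\<forall>p\<in>\<pi>'. \<forall>p'\<in>\<pi>'. p \<noteq> p' \<longrightarrow> nonoverlapping (snd p) (snd p')"
          unfolding \<pi>'_def using novS by auto
        show "\<forall>(t, I)\<in>\<pi>'. t \<in> I"
          unfolding \<pi>'_def using ST(4) by (auto simp: mem_cube less_imp_le)
      qed
      moreover have "fine_partition \<delta>H \<pi>'"
        unfolding fine_partition_def \<pi>'_def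
      proof clarify
        fix s u assume s: "s \<in> S" and u: "u \<in> cube s (\<delta> s)"
        have "max_ball s (2 * \<delta> s) \<subseteq> max_ball s (\<delta>H s)"
          using \<delta>H'[OF ST(1,2)[OF s]] by (rule max_ball_mono)
        then show "u \<in> max_ball s (\<delta>H s)" using cs[OF s] u by blast
      qed
      ultimately have "(\<Sum>(t, I)\<in>\<pi>'. \<bar>measure lebesgue I * blinfun_apply x (f t) - blinfun_apply x (F I)\<bar>) \<le> 2 * e1"
        by (rule HK_partition_abs_sum_le[rotated]) (fact x(1), rule \<delta>H(2))
      then have le: "(\<Sum>s\<in>S. \<bar>measure lebesgue (cube s (\<delta> s)) * g s - blinfun_apply x (F (cube s (\<delta> s)))\<bar>) \<le> 2 * e1"
        unfolding \<pi>'_def by (simp add: sum.reindex[OF inj] g_def)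
      have "\<eta> * (\<Sum>s\<in>S. measure lebesgue (cube s (\<delta> s))) = (\<Sum>s\<in>S. measure lebesgue (cube s (\<delta> s)) * \<eta>)"
        by (simp add: sum_distrib_left mult.commute)
      \<comment> \<open>At a bad centre the deviation exceeds \<open>\<eta>\<close>. With
        \<open>\<phi>\<close> constant on the cube, this deviation times the measure is at most the
        Henstock-Kurzweil error plus the mass of \<open>h\<close> on the cube.\<close>
      also have "\<dots> \<le> (\<Sum>s\<in>S. \<bar>measure lebesgue (cube s (\<delta> s)) * g s - blinfun_apply x (F (cube s (\<delta> s)))\<bar>
          + integral (cube s (\<delta> s)) (\<lambda>t. \<bar>h t\<bar>))"
      proof (rule sum_mono)
        fix s assume s: "s \<in> S"
        let ?J = "cube s (\<delta> s)"
        have "\<phi> u = \<phi> s" if "u \<in> ?J" for u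
          unfolding \<phi>_def using \<delta>c[OF ST(1,2)[OF s]] cs[OF s] that by (metis subsetD)
        from dec[OF clm cU[OF s] this]
        have d: "integral ?J g = measure lebesgue ?J * \<phi> s + integral ?J h" "\<bar>integral ?J h\<bar> \<le> integral ?J (\<lambda>t. \<bar>h t\<bar>)"
          by auto
        have "integral ?J g = blinfun_apply x (F ?J)" unfolding g_def by (rule primitive[OF cI[OF s]])
        then have "measure lebesgue ?J * g s - blinfun_apply x (F ?J)
            = measure lebesgue ?J * (g s - \<phi> s) - integral ?J h" using d(1) by (simp add: right_diff_distrib)
        moreover have "measure lebesgue ?J * \<eta> \<le> \<bar>measure lebesgue ?J * (g s - \<phi> s)\<bar>"
          using ST(3)[OF s] by (simp add: abs_mult mult_left_mono)
        ultimately show "measure lebesgue ?J * \<eta> \<le> \<bar>measure lebesgue ?J * g s - blinfun_apply x (F ?J)\<bar>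
            + integral ?J (\<lambda>t. \<bar>h t\<bar>)" using d(2) by linarith
      qed
      also have "\<dots> \<le> 2 * e1 + integral ?U (\<lambda>t. \<bar>h t\<bar>)"
      proof -
        have "(\<Sum>s\<in>S. integral (cube s (\<delta> s)) (\<lambda>t. \<bar>h t\<bar>)) \<le> integral ?U (\<lambda>t. \<bar>h t\<bar>)"
          using finS cI novS by (intro abs_integral_family_le[OF hi]) (auto simp: intervals_in_def)
        then show ?thesis using le by (simp add: sum.distrib)
      qed
      also have "\<dots> \<le> 3 * e1" using happ by simp
      finally have "(\<Sum>s\<in>S. measure lebesgue (cube s (\<delta> s))) \<le> 3 * e1 / \<eta>"
        using \<eta>(1) by (simp add: pos_le_divide_eq mult.commute)
      then have "q * (\<Sum>s\<in>S. measure lebesgue (cube s (\<delta> s))) \<le> q * (3 * e1 / \<eta>)"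
        using q by (intro mult_left_mono) auto
      then show ?thesis using Sm UN[OF sub(2)] e1\<kappa> by (simp add: q_def)
    qed
    \<comment> \<open>The value \<open>\<phi> (fst p)\<close> has no bound uniform in the
      functional. It is absorbed by \<open>phi_int\<close>: times the measure of the interval, it is
      the mass of \<open>\<phi>\<close> there, at most that of \<open>g\<close> plus that of
      \<open>h\<close>.\<close>
    have PB: "(\<Sum>p\<in>PB. \<bar>err p\<bar>) \<le> 2 * b + 2 * (\<Sum>p\<in>PB. integral (snd p) (\<lambda>t. \<bar>h t\<bar>))"
    proof -
      have "(\<Sum>p\<in>PB. \<bar>err p\<bar>) \<le> (\<Sum>p\<in>PB. (measure lebesgue (snd p) * M + integral (snd p) (\<lambda>t. \<bar>g t\<bar>))
          + 2 * integral (snd p) (\<lambda>t. \<bar>h t\<bar>))"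
      proof (rule sum_mono)
        fix p assume p: "p \<in> PB"
        then have p': "p \<in> \<pi>" "fst p \<notin> N" by (auto simp: PB_def)
        have "\<bar>measure lebesgue (snd p) * (g (fst p) - \<phi> (fst p))\<bar>
            = measure lebesgue (snd p) * \<bar>g (fst p) - \<phi> (fst p)\<bar>" by (simp add: abs_mult)
        also have "\<dots> \<le> measure lebesgue (snd p) * (M + \<bar>\<phi> (fst p)\<bar>)"
          using gM[OF p'(1)] by (intro mult_left_mono) auto
        also have "\<dots> \<le> measure lebesgue (snd p) * M + (integral (snd p) (\<lambda>t. \<bar>g t\<bar>) + integral (snd p) (\<lambda>t. \<bar>h t\<bar>))"
          using phi_int[OF p'] by (simp add: distrib_left)
        finally show "\<bar>err p\<bar> \<le> (measure lebesgue (snd p) * M + integral (snd p) (\<lambda>t. \<bar>g t\<bar>))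
          + 2 * integral (snd p) (\<lambda>t. \<bar>h t\<bar>)"
          using split_err[OF p'] h_int[OF p'] by linarith
      qed
      also have "\<dots> = (\<Sum>p\<in>PB. measure lebesgue (snd p) * M + integral (snd p) (\<lambda>t. \<bar>g t\<bar>))
          + 2 * (\<Sum>p\<in>PB. integral (snd p) (\<lambda>t. \<bar>h t\<bar>))"
        by (simp only: sum.distrib sum_distrib_left)
      finally show ?thesis using smallP[OF sub(2) PBm] by linarith
    qed
    have hsum: "(\<Sum>p\<in>PB. integral (snd p) (\<lambda>t. \<bar>h t\<bar>)) \<le> b" "(\<Sum>p\<in>PG. integral (snd p) (\<lambda>t. \<bar>h t\<bar>)) \<le> b"
      using fam[OF sub(2) hi, of ?U] fam[OF sub(3) hi, of ?U] UN[OF sub(2)] UN[OF sub(3)] happ e1b by auto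
    have "blinfun_apply x (\<Sum>(t, I)\<in>\<pi>. measure lebesgue I *\<^sub>R f t - F I) = (\<Sum>p\<in>\<pi>. err p)"
    proof -
      have "integral (snd p) g = blinfun_apply x (F (snd p))" if "p \<in> \<pi>" for p
        unfolding g_def by (rule primitive[OF Iin[OF that]])
      then show ?thesis
        by (simp add: case_prod_beta blinfun.sum_right blinfun.diff_right blinfun.scaleR_right err_def)
          (simp add: g_def)
    qed
    also have "\<dots> \<le> (\<Sum>p\<in>\<pi>. \<bar>err p\<bar>)" by (intro sum_mono) simp
    also have "\<dots> = (\<Sum>p\<in>PN. \<bar>err p\<bar>) + ((\<Sum>p\<in>PB. \<bar>err p\<bar>) + (\<Sum>p\<in>PG. \<bar>err p\<bar>))"
      using finP split(2,3) by (subst split(1)) (simp add: sum.union_disjoint)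
    also have "\<dots> \<le> tol" using PN PB PG hsum by (simp add: b_def)
    finally show ?thesis using x(2) by simp
  qed
  then show ?thesis using \<delta> by (intro exI[of _ \<delta>]) (auto simp: gauge_on_def)
qed

end

context Dunford_primitive
begin

text \<open>The gauge at a tag is the one for the class of that tag. Each class of a partition is
  again a partition, so it can be estimated alone; the tolerances add up to at most
  \<open>e / 2\<close>.\<close>

lemma M_estimate:
  assumes HK: "\<And>e. 0 < e \<Longrightarrow> \<exists>\<delta>. gauge_on (interior I0) \<delta> \<and> (\<forall>\<pi>. HK_partition (interior I0) \<pi> \<longrightarrow>
      fine_partition \<delta> \<pi> \<longrightarrow> norm (\<Sum>(t, I)\<in>\<pi>. measure lebesgue I *\<^sub>R f t - F I) < e)"
    and e: "0 < e"
  shows "\<exists>\<delta>. gauge_on (interior I0) \<delta> \<and> (\<forall>\<pi>. M_partition (interior I0) \<pi> \<longrightarrow> fine_partition \<delta> \<pi> \<longrightarrow>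
      norm (\<Sum>(t, I)\<in>\<pi>. measure lebesgue I *\<^sub>R f t - F I) < e)"
proof -
  let ?U = "interior I0"
  have "\<exists>\<delta>. gauge_on ?U \<delta> \<and> (\<forall>\<pi>. M_partition ?U \<pi> \<longrightarrow> fine_partition \<delta> \<pi> \<longrightarrow>
      (\<forall>(t, I)\<in>\<pi>. norm (f t) \<le> real n) \<longrightarrow>
      norm (\<Sum>(t, I)\<in>\<pi>. measure lebesgue I *\<^sub>R f t - F I) \<le> e / 4 * (1/2)^n)" for n
    using e by (intro M_estimate_bounded_tags[OF HK]) auto
  then have "\<forall>n. \<exists>\<delta>. gauge_on ?U \<delta> \<and> (\<forall>\<pi>. M_partition ?U \<pi> \<longrightarrow> fine_partition \<delta> \<pi> \<longrightarrow>
      (\<forall>(t, I)\<in>\<pi>. norm (f t) \<le> real n) \<longrightarrow>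
      norm (\<Sum>(t, I)\<in>\<pi>. measure lebesgue I *\<^sub>R f t - F I) \<le> e / 4 * (1/2)^n)" by blast
  from choice[OF this] obtain \<delta> where \<delta>: "\<And>n. gauge_on ?U (\<delta> n)" "\<And>n \<pi>. M_partition ?U \<pi> \<Longrightarrow> fine_partition (\<delta> n) \<pi> \<Longrightarrow>
      (\<forall>(t, I)\<in>\<pi>. norm (f t) \<le> real n) \<Longrightarrow>
      norm (\<Sum>(t, I)\<in>\<pi>. measure lebesgue I *\<^sub>R f t - F I) \<le> e / 4 * (1/2)^n"
    by blast
  define c where "c t = nat \<lceil>norm (f t)\<rceil>" for t
  have c: "norm (f t) \<le> real (c t)" for t unfolding c_def by (rule real_nat_ceiling_ge)
  show ?thesis
  proof (intro exI[of _ "\<lambda>t. \<delta> (c t) t"] conjI allI impI)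
    show "gauge_on ?U (\<lambda>t. \<delta> (c t) t)" using \<delta>(1) by (simp add: gauge_on_def)
    fix \<pi> assume \<pi>: "M_partition ?U \<pi>" "fine_partition (\<lambda>t. \<delta> (c t) t) \<pi>"
    have fin: "finite \<pi>" using \<pi>(1) by (simp add: M_partition_def)
    define T where "T = (\<lambda>p. c (fst p)) ` \<pi>"
    have finT: "finite T" using fin by (simp add: T_def)
    have est: "norm (\<Sum>(t, I)\<in>{p \<in> \<pi>. c (fst p) = n}. measure lebesgue I *\<^sub>R f t - F I) \<le> e / 4 * (1/2)^n" for n
    proof (rule \<delta>(2))
      show "M_partition ?U {p \<in> \<pi>. c (fst p) = n}" by (rule M_partition_subset[OF \<pi>(1)]) auto
      show "fine_partition (\<delta> n) {p \<in> \<pi>. c (fst p) = n}"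
        using \<pi>(2) unfolding fine_partition_def by fastforce
      show "\<forall>(t, I)\<in>{p \<in> \<pi>. c (fst p) = n}. norm (f t) \<le> real n" using c by auto
    qed
    have "(\<Sum>(t, I)\<in>\<pi>. measure lebesgue I *\<^sub>R f t - F I)
        = (\<Sum>n\<in>T. \<Sum>(t, I)\<in>{p \<in> \<pi>. c (fst p) = n}. measure lebesgue I *\<^sub>R f t - F I)"
      by (rule sum.group[symmetric, OF fin finT]) (simp add: T_def)
    also have "norm \<dots> \<le> (\<Sum>n\<in>T. e / 4 * (1/2)^n)"
      using est by (rule sum_norm_le)
    also have "\<dots> = e / 4 * (\<Sum>n\<in>T. (1/2)^n)" by (rule sum_distrib_left[symmetric])
    also have "(\<Sum>n\<in>T. (1/2)^n) \<le> (\<Sum>n. (1/2::real)^n)"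
      by (rule sum_le_suminf[OF _ finT]) (auto intro: summable_geometric)
    also have "(\<Sum>n. (1/2::real)^n) = 2" by (simp add: suminf_geometric)
    finally have "norm (\<Sum>(t, I)\<in>\<pi>. measure lebesgue I *\<^sub>R f t - F I) \<le> e / 4 * 2" using e by simp
    then show "norm (\<Sum>(t, I)\<in>\<pi>. measure lebesgue I *\<^sub>R f t - F I) < e" using e by linarith
  qed
qed

text \<open>\<open>I\<close> may protrude from \<open>I0\<close>, where \<open>F\<close> has no
  meaning; the series over \<open>D\<close> replaces \<open>F I\<close>. Its finite partial sums are
  integrals over non-overlapping intervals inside \<open>I \<inter> interior I0\<close>, and the
  bound by the mass passes to the limit.\<close>

lemma abs_series_sum_le_mass:
  assumes D: "D \<in> divisions_of (interior I0)" and I: "I \<in> intervals"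
  shows "\<bar>blinfun_apply x (series_sum F D I)\<bar> \<le> mass x (I \<inter> interior I0)"
proof -
  let ?U = "interior I0"
  have Dk: "D k \<in> intervals_in ?U" and Dn: "j \<noteq> k \<Longrightarrow> nonoverlapping (D j) (D k)" for j k
    using D by (auto simp: divisions_of_def divisions_in_def)
  have "D \<in> divisions_in I0"
    using Dk Dn interior_subset[of I0] unfolding divisions_in_def intervals_in_def by blast
  then have "series_convergent F D I" using I by (rule series)
  then have "((\<lambda>k. F (I \<inter> D k)) has_sum series_sum F D I) (meeting D I)"
    unfolding series_convergent_def series_sum_def by (rule has_sum_infsum)
  then have "((\<lambda>k. blinfun_apply x (F (I \<inter> D k))) has_sum blinfun_apply x (series_sum F D I)) (meeting D I)"
    by (rule has_sum_bounded_linear[OF blinfun.bounded_linear_right])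
  then have lim: "((\<lambda>K. \<Sum>k\<in>K. blinfun_apply x (F (I \<inter> D k))) \<longlongrightarrow> blinfun_apply x (series_sum F D I))
      (finite_subsets_at_top (meeting D I))"
    by (simp add: has_sum_def)
  have I': "I \<inter> ?U \<in> sets lebesgue" using interval_lmeasurable[OF I] by auto
  have "norm (\<Sum>k\<in>K. blinfun_apply x (F (I \<inter> D k))) \<le> mass x (I \<inter> ?U)" if K: "finite K" "K \<subseteq> meeting D I" for K
  proof -
    have ID: "I \<inter> D k \<in> intervals" "I \<inter> D k \<subseteq> I \<inter> ?U" "I \<inter> D k \<in> intervals_in ?U" if "k \<in> K" for k
    proof -
      show "I \<inter> D k \<in> intervals"
        using that K(2) Dk[of k] I by (intro interval_Int) (auto simp: meeting_def intervals_in_def)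
      then show "I \<inter> D k \<subseteq> I \<inter> ?U" "I \<inter> D k \<in> intervals_in ?U"
        using Dk[of k] by (auto simp: intervals_in_def)
    qed
    have "norm (\<Sum>k\<in>K. blinfun_apply x (F (I \<inter> D k))) \<le> (\<Sum>k\<in>K. mass x (I \<inter> D k))"
    proof (rule sum_norm_le)
      fix k assume k: "k \<in> K"
      have "\<bar>integral (I \<inter> D k) (\<lambda>t. blinfun_apply x (f t))\<bar> \<le> mass x (I \<inter> D k)"
        using ID[OF k] interval_lmeasurable[OF ID(1)[OF k]]
        by (intro integral_abs_bound_subset[OF scalar_integrable]) auto
      then show "norm (blinfun_apply x (F (I \<inter> D k))) \<le> mass x (I \<inter> D k)"
        using primitive[OF ID(3)[OF k], of x] by simp
    qed
    also have "\<dots> \<le> mass x (I \<inter> ?U)"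
    proof (rule abs_integral_family_le[OF scalar_integrable K(1) ID(1,2) _ I'])
      show "nonoverlapping (I \<inter> D j) (I \<inter> D k)" if "j \<noteq> k" for j k
        using Dn[OF that] by (rule nonoverlapping_mono) auto
    qed auto
    finally show ?thesis .
  qed
  then have "norm (blinfun_apply x (series_sum F D I)) \<le> mass x (I \<inter> ?U)"
    by (intro Lim_norm_ubound[OF _ lim]) (auto simp: eventually_finite_subsets_at_top intro!: exI[of _ "{}"])
  then show ?thesis by simp
qed

text \<open>An interval tagged outside the interior can be kept so close to its tag that it meets
  the interior only in a thin neighbourhood of the frontier. There uniform absolute continuity
  bounds the whole sum at once, whatever the division \<open>D\<close>.\<close>

lemma M_negligible_variation: "negligible_variation M_partition I0 F (UNIV - interior I0)"
  unfolding negligible_variation_def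
proof (intro conjI allI impI)
  show "additive_interval_function I0 F" by (rule additive)
  let ?U = "interior I0"
  have Ulm: "?U \<in> lmeasurable" by (rule lmeasurable_subset) auto
  have cl: "closed I0" using interval_compact[OF interval] by (rule compact_imp_closed)
  fix e :: real assume e: "0 < e"
  obtain z where z: "0 < z" "\<And>A (x::'x \<Rightarrow>\<^sub>L real). A \<in> sets lebesgue \<Longrightarrow> A \<subseteq> ?U \<Longrightarrow>
      measure lebesgue A < z \<Longrightarrow> norm x \<le> 1 \<Longrightarrow> mass x A \<le> e / 2"
    using uniformly_absolutely_continuous[OF half_gt_zero[OF e]] by blast
  have "negligible (frontier I0)"
    using interval by (auto elim!: intervalsE intro!: negligible_convex_frontier)
  then obtain V where V: "open V" "frontier I0 \<subseteq> V" "measure lebesgue (V \<inter> ?U) < z"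
    using z(1) Ulm by (rule open_superset_of_negligible[OF _ _ open_interior])
  \<comment> \<open>A tag outside the interior lies on the frontier or off the closed set
    \<open>I0\<close>; this open set contains both kinds and meets the interior only inside
    \<open>V\<close>.\<close>
  have op: "open (V \<union> - I0)" using V(1) cl by auto
  have "\<exists>r>0. max_ball t r \<subseteq> V \<union> - I0" if "t \<in> UNIV - ?U" for t
  proof -
    have "t \<in> V \<union> - I0" using that V(2) cl by (auto simp: frontier_def)
    with op show ?thesis by (metis open_contains_max_ball)
  qed
  then obtain \<delta> where \<delta>: "\<And>t. t \<in> UNIV - ?U \<Longrightarrow> 0 < \<delta> t" "\<And>t. t \<in> UNIV - ?U \<Longrightarrow> max_ball t (\<delta> t) \<subseteq> V \<union> - I0"
    by metis
  show "\<exists>\<delta>. gauge_on (UNIV - ?U) \<delta> \<and> (\<forall>\<pi>. M_partition UNIV \<pi> \<longrightarrow> tagged_in (UNIV - ?U) \<pi> \<longrightarrow> fine_partition \<delta> \<pi> \<longrightarrow>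
      (\<forall>D\<in>divisions_of ?U. (\<forall>(t, I)\<in>\<pi>. series_convergent F D I) \<and> norm (\<Sum>(t, I)\<in>\<pi>. series_sum F D I) < e))"
  proof (intro exI[of _ \<delta>] conjI allI impI)
    show "gauge_on (UNIV - ?U) \<delta>" using \<delta>(1) by (simp add: gauge_on_def)
    fix \<pi> assume \<pi>: "M_partition UNIV \<pi>" "tagged_in (UNIV - ?U) \<pi>" "fine_partition \<delta> \<pi>"
    have fin: "finite \<pi>" using \<pi>(1) by (simp add: M_partition_def)
    have I: "snd p \<in> intervals" if "p \<in> \<pi>" for p
      using \<pi>(1) that by (auto simp: M_partition_def intervals_in_def)
    have nov: "nonoverlapping (snd p) (snd q)" if "p \<in> \<pi>" "q \<in> \<pi>" "p \<noteq> q" for p q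
      using \<pi>(1) that by (simp add: M_partition_def)
    have IV: "snd p \<inter> ?U \<subseteq> V \<inter> ?U" if "p \<in> \<pi>" for p
    proof -
      have "fst p \<in> UNIV - ?U" using \<pi>(2) that unfolding tagged_in_def by (metis (no_types, lifting) case_prod_beta)
      moreover have "snd p \<subseteq> max_ball (fst p) (\<delta> (fst p))"
        using \<pi>(3) that unfolding fine_partition_def by (metis (no_types, lifting) case_prod_beta)
      ultimately show ?thesis using \<delta>(2) interior_subset[of I0] by blast
    qed
    show "\<forall>D\<in>divisions_of ?U. (\<forall>(t, I)\<in>\<pi>. series_convergent F D I) \<and>
        norm (\<Sum>(t, I)\<in>\<pi>. series_sum F D I) < e"
    proof (rule ballI, rule conjI)
      fix D assume D: "D \<in> divisions_of ?U"
      have DI: "D \<in> divisions_in I0"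
        using D interior_subset[of I0] unfolding divisions_of_def divisions_in_def intervals_in_def by blast
      show "\<forall>(t, I)\<in>\<pi>. series_convergent F D I"
      proof clarify
        fix t J assume "(t, J) \<in> \<pi>"
        then show "series_convergent F D J" using I[of "(t, J)"] by (intro series[OF DI]) simp
      qed
      obtain x :: "'x \<Rightarrow>\<^sub>L real" where x: "norm x \<le> 1"
        "blinfun_apply x (\<Sum>(t, I)\<in>\<pi>. series_sum F D I) = norm (\<Sum>(t, I)\<in>\<pi>. series_sum F D I)"
        by (rule norming_functional)
      have "blinfun_apply x (\<Sum>(t, I)\<in>\<pi>. series_sum F D I) = (\<Sum>p\<in>\<pi>. blinfun_apply x (series_sum F D (snd p)))"
        by (simp add: case_prod_beta blinfun.sum_right)
      also have "\<dots> \<le> (\<Sum>p\<in>\<pi>. mass x (snd p \<inter> ?U))"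
      proof (rule sum_mono)
        fix p assume "p \<in> \<pi>"
        then show "blinfun_apply x (series_sum F D (snd p)) \<le> mass x (snd p \<inter> ?U)"
          using abs_series_sum_le_mass[OF D I, of p x] by simp
      qed
      also have "\<dots> \<le> mass x (V \<inter> ?U)"
      proof (rule abs_integral_almost_disjoint_le[OF scalar_integrable fin])
        show "snd p \<inter> ?U \<in> sets lebesgue" if "p \<in> \<pi>" for p using interval_lmeasurable[OF I[OF that]] by auto
        show "snd p \<inter> ?U \<subseteq> V \<inter> ?U" if "p \<in> \<pi>" for p using IV[OF that] .
        show "negligible ((snd p \<inter> ?U) \<inter> (snd q \<inter> ?U))" if "p \<in> \<pi>" "q \<in> \<pi>" "p \<noteq> q" for p q
          using nonoverlapping_negligible[OF I[OF that(1)] I[OF that(2)] nov[OF that]]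
          by (rule negligible_subset) auto
      qed (use V(1) in auto)
      also have "\<dots> \<le> e / 2" using V by (intro z(2) x(1)) auto
      finally show "norm (\<Sum>(t, I)\<in>\<pi>. series_sum F D I) < e" using x(2) e by simp
    qed
  qed
qed

end

section \<open>The converse direction: McShane estimates imply Henstock-Kurzweil estimates and
  scalar integrability\<close>

lemma HK_partition_imp_M_partition: "HK_partition U \<pi> \<Longrightarrow> M_partition U \<pi>"
  by (simp add: HK_partition_def)

lemma exists_gauge_weaken:
  assumes "\<exists>\<delta>. gauge_on Z \<delta> \<and> (\<forall>\<pi>. P \<pi> \<longrightarrow> Q \<delta> \<pi>)" and "\<And>\<pi>. P' \<pi> \<Longrightarrow> P \<pi>"
  shows "\<exists>\<delta>. gauge_on Z \<delta> \<and> (\<forall>\<pi>. P' \<pi> \<longrightarrow> Q \<delta> \<pi>)"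
  using assms by blast

lemmas M_estimate_imp_HK_estimate =
  exists_gauge_weaken[where P = "M_partition U" and P' = "HK_partition U" for U,
    OF _ HK_partition_imp_M_partition]

lemma M_negligible_variation_imp_HK:
  assumes "negligible_variation M_partition E F Z"
  shows "negligible_variation HK_partition E F Z"
  unfolding negligible_variation_def
proof (intro conjI allI impI)
  show "additive_interval_function E F" using assms by (simp add: negligible_variation_def)
  fix e :: real assume "0 < e"
  with assms have "\<exists>\<delta>. gauge_on Z \<delta> \<and> (\<forall>\<pi>. M_partition UNIV \<pi> \<longrightarrow> tagged_in Z \<pi> \<longrightarrow> fine_partition \<delta> \<pi> \<longrightarrow>
      (\<forall>D\<in>divisions_of (interior E). (\<forall>(t, I)\<in>\<pi>. series_convergent F D I) \<and>
        norm (\<Sum>(t, I)\<in>\<pi>. series_sum F D I) < e))"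
    unfolding negligible_variation_def by (elim conjE allE[of _ e]) (rule mp)
  then show "\<exists>\<delta>. gauge_on Z \<delta> \<and> (\<forall>\<pi>. HK_partition UNIV \<pi> \<longrightarrow> tagged_in Z \<pi> \<longrightarrow> fine_partition \<delta> \<pi> \<longrightarrow>
      (\<forall>D\<in>divisions_of (interior E). (\<forall>(t, I)\<in>\<pi>. series_convergent F D I) \<and>
        norm (\<Sum>(t, I)\<in>\<pi>. series_sum F D I) < e))"
    by (rule exists_gauge_weaken) (rule HK_partition_imp_M_partition)
qed

text \<open>Any division \<open>d\<close> is intersected with one fixed fine tagged division
  \<open>p\<close>, and each piece inherits its tag from \<open>p\<close>. The tag may lie outside
  the piece, which is where McShane's freedom is indispensable. The result bounds the variation by a
  quantity depending on \<open>p\<close> alone.\<close>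

lemma M_estimate_absolutely_integrable_interval:
  fixes x :: "'x::banach \<Rightarrow>\<^sub>L real"
  assumes F: "additive_interval_function E F" and UE: "U \<subseteq> E"
    and est: "\<And>e. 0 < e \<Longrightarrow> \<exists>\<delta>. gauge_on U \<delta> \<and> (\<forall>\<pi>. M_partition U \<pi> \<longrightarrow> fine_partition \<delta> \<pi> \<longrightarrow>
        norm (\<Sum>(t, I)\<in>\<pi>. measure lebesgue I *\<^sub>R f t - F I) < e)"
    and ab: "cbox a b \<subseteq> U"
  shows "(\<lambda>t. blinfun_apply x (f t)) absolutely_integrable_on cbox a b"
proof (cases "0 < measure lborel (cbox a b)")
  case False
  then have "negligible (cbox a b)" by (simp add: negligible_iff_measure zero_less_measure_iff)
  then show ?thesis by (rule absolutely_integrable_negligible)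
next
  case True
  define g where "g t = blinfun_apply x (f t)" for t
  have prim: "(g has_integral blinfun_apply x (F I)) I" if "I \<in> intervals_in U" for I
    unfolding g_def by (rule primitive_has_integral[OF F UE M_estimate_imp_HK_estimate[OF est] that])
  have abU: "cbox a b \<in> intervals_in U" using True ab by (auto simp: intervals_in_def cbox_in_intervals)
  obtain \<delta> where \<delta>: "gauge_on U \<delta>" "\<And>\<pi>. M_partition U \<pi> \<Longrightarrow> fine_partition \<delta> \<pi> \<Longrightarrow>
      norm (\<Sum>(t, I)\<in>\<pi>. measure lebesgue I *\<^sub>R f t - F I) < 1"
    using est[of 1] by auto
  define \<gamma> where "\<gamma> t = (if t \<in> U then ball t (\<delta> t) else UNIV)" for t
  have "gauge \<gamma>" using \<delta>(1) by (auto simp: gauge_def \<gamma>_def gauge_on_def)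
  then obtain p where p: "p tagged_division_of cbox a b" "\<gamma> fine p" by (rule fine_division_exists)
  note P = tagged_division_ofD[OF p(1)]
  have pf: "L \<subseteq> max_ball t (\<delta> t)" "t \<in> U" if "(t, L) \<in> p" for t L
  proof -
    show "t \<in> U" using P(2,3)[OF that] ab by blast
    moreover have "L \<subseteq> \<gamma> t" using p(2) that by (auto simp: fine_def)
    ultimately show "L \<subseteq> max_ball t (\<delta> t)" using ball_subset_max_ball[of t "\<delta> t"] by (auto simp: \<gamma>_def)
  qed
  \<comment> \<open>The first summand is the McShane error with tolerance 1, doubled for absolute
    values; the second is the absolute Riemann sum over \<open>p\<close>. Neither depends on
    \<open>d\<close>.\<close>
  define B where "B = norm x * 2 + (\<Sum>(t, L)\<in>p. measure lebesgue L * \<bar>g t\<bar>)"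
  have "g absolutely_integrable_on cbox a b"
  proof (rule bounded_variation_absolutely_integrable_interval)
    show "g integrable_on cbox a b" using prim[OF abU] by (rule has_integral_integrable)
    fix d assume d: "d division_of cbox a b"
    show "(\<Sum>K\<in>d. norm (integral K g)) \<le> B"
    proof -
      note Dd = division_ofD[OF d]
      have pbox: "\<exists>u v. snd q = cbox u v" and psub: "snd q \<subseteq> cbox a b" if "q \<in> p" for q
        using P(3,4)[of "fst q" "snd q"] that by auto
      have Kbox: "\<exists>u v. K \<inter> snd q = cbox u v" if Kq: "K \<in> d" "q \<in> p" for K q
      proof -
        obtain u v where "K = cbox u v" using Dd(4)[OF Kq(1)] by blast
        moreover obtain u' v' where "snd q = cbox u' v'" using pbox[OF Kq(2)] by blast
        moreover obtain w z where "cbox u v \<inter> cbox u' v' = cbox w z" using Int_interval by blast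
        ultimately show ?thesis by auto
      qed
      have negbox: "negligible (S \<inter> T)"
        if "\<exists>u v. S = cbox u v" "\<exists>u v. T = cbox u v" "interior S \<inter> interior T = {}" for S T :: "(real^'a) set"
      proof -
        have "convex (S \<inter> T)" using that by (auto intro: convex_Int)
        then show ?thesis using that(3) by (simp add: negligible_convex_interior interior_Int)
      qed
      have pdis: "interior (snd q) \<inter> interior (snd q') = {}" if "q \<in> p" "q' \<in> p" "q \<noteq> q'" for q q'
        using P(5)[of "fst q" "snd q" "fst q'" "snd q'"] that by simp
      have pneg: "negligible (snd q \<inter> snd q')" if "q \<in> p" "q' \<in> p" "q \<noteq> q'" for q q'
        using that by (intro negbox pbox pdis)
      have dneg: "negligible (K \<inter> K')" if "K \<in> d" "K' \<in> d" "K \<noteq> K'" for K K'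
        using that by (intro negbox Dd(4,5))
      have KL_int: "g integrable_on K \<inter> snd q" if Kq: "K \<in> d" "q \<in> p" for K q
      proof -
        obtain u v where uv: "K \<inter> snd q = cbox u v" using Kbox[OF Kq] by blast
        have "cbox u v \<subseteq> cbox a b" using uv psub[OF Kq(2)] by blast
        then show ?thesis unfolding uv
          using has_integral_integrable[OF prim[OF abU]] by (rule integrable_on_subcbox[rotated])
      qed
      have Ksum: "integral K g = (\<Sum>q\<in>p. integral (K \<inter> snd q) g)" if K: "K \<in> d" for K
      proof -
        have "(g has_integral (\<Sum>q\<in>p. integral (K \<inter> snd q) g)) (\<Union>q\<in>p. K \<inter> snd q)"
        proof (rule has_integral_UN[OF P(1)])
          show "(g has_integral integral (K \<inter> snd q) g) (K \<inter> snd q)" if "q \<in> p" for q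
            using KL_int[OF K that] by (rule integrable_integral)
          show "pairwise (\<lambda>q q'. negligible (K \<inter> snd q \<inter> (K \<inter> snd q'))) p"
            unfolding pairwise_def
          proof (intro ballI impI)
            fix q q' assume "q \<in> p" "q' \<in> p" "q \<noteq> q'"
            then have "negligible (snd q \<inter> snd q')" by (rule pneg)
            then show "negligible (K \<inter> snd q \<inter> (K \<inter> snd q'))" by (rule negligible_subset) auto
          qed
        qed
        moreover have "(\<Union>q\<in>p. K \<inter> snd q) = K"
          using Dd(2)[OF K] P(6) by force
        ultimately show ?thesis by (simp add: integral_unique)
      qed
      \<comment> \<open>Indices are pairs of a cell of \<open>d\<close> and a tagged cell of
        \<open>p\<close>; null intersections are left out because they are not intervals.\<close>
      define R where "R = {r \<in> d \<times> p. 0 < measure lebesgue (fst r \<inter> snd (snd r))}"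
      define J where "J r = fst r \<inter> snd (snd r)" for r :: "(real^'a) set \<times> (real^'a) \<times> (real^'a) set"
      have finR: "finite R" unfolding R_def using Dd(1) P(1) by auto
      have Rmem: "fst r \<in> d" "snd r \<in> p" "0 < measure lebesgue (J r)" if "r \<in> R" for r
        using that by (auto simp: R_def J_def)
      have Jbox: "\<exists>u v. J r = cbox u v" if "r \<in> R" for r
        unfolding J_def by (rule Kbox[OF Rmem(1,2)[OF that]])
      have JU: "J r \<in> intervals_in U" if r: "r \<in> R" for r
      proof -
        obtain u v where "J r = cbox u v" using Jbox[OF r] by blast
        then show ?thesis
          using Rmem(3)[OF r] psub[OF Rmem(2)[OF r]] ab
          by (auto simp: intervals_in_def J_def intro!: cbox_in_intervals)
      qed
      have Jdis: "interior (J r) \<inter> interior (J r') = {}" if "r \<in> R" "r' \<in> R" "r \<noteq> r'" for r r'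
      proof (cases "fst r = fst r'")
        case True
        then have "snd r \<noteq> snd r'" using that(3) by (simp add: prod_eq_iff)
        then show ?thesis using pdis[OF Rmem(2)[OF that(1)] Rmem(2)[OF that(2)]]
          by (auto simp: J_def interior_Int)
      next
        case False
        then show ?thesis using Dd(5)[OF Rmem(1)[OF that(1)] Rmem(1)[OF that(2)]]
          by (auto simp: J_def interior_Int)
      qed
      have Jne: "interior (J r) \<noteq> {}" if "r \<in> R" for r
        using JU[OF that] interval_interior_nonempty by (auto simp: intervals_in_def)
      \<comment> \<open>Partitions are sets of pairs, so different indices must give different
        pairs; equal non-degenerate pieces would have overlapping interiors.\<close>
      have inj: "inj_on (\<lambda>r. (fst (snd r), J r)) R"
      proof (rule inj_onI, rule ccontr)
        fix r r' assume r: "r \<in> R" "r' \<in> R" "(fst (snd r), J r) = (fst (snd r'), J r')" "r \<noteq> r'"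
        then show False using Jdis[OF r(1,2,4)] Jne[OF r(1)] by simp
      qed
      have sub: "norm (\<Sum>r\<in>Q. measure lebesgue (J r) * g (fst (snd r)) - integral (J r) g) \<le> norm x" if Q: "Q \<subseteq> R" for Q
      proof -
        define \<pi> where "\<pi> = (\<lambda>r. (fst (snd r), J r)) ` Q"
        have "M_partition U \<pi>"
          unfolding M_partition_def
        proof (intro conjI)
          show "finite \<pi>" unfolding \<pi>_def using finite_subset[OF Q finR] by simp
          show "\<forall>(t, I)\<in>\<pi>. t \<in> U \<and> I \<in> intervals_in U"
          proof clarify
            fix t I assume "(t, I) \<in> \<pi>"
            then obtain r where r: "r \<in> R" "t = fst (snd r)" "I = J r" using Q by (auto simp: \<pi>_def)
            have "(fst (snd r), snd (snd r)) \<in> p" using Rmem(2)[OF r(1)] by simp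
            then show "t \<in> U \<and> I \<in> intervals_in U" using r JU pf(2) by blast
          qed
          show "\<forall>q\<in>\<pi>. \<forall>q'\<in>\<pi>. q \<noteq> q' \<longrightarrow> nonoverlapping (snd q) (snd q')"
          proof (intro ballI impI)
            fix q q' assume q: "q \<in> \<pi>" and q': "q' \<in> \<pi>" and ne: "q \<noteq> q'"
            obtain r where r1: "q = (fst (snd r), J r)" "r \<in> Q" using q unfolding \<pi>_def by (rule imageE)
            obtain r' where r2: "q' = (fst (snd r'), J r')" "r' \<in> Q" using q' unfolding \<pi>_def by (rule imageE)
            have r: "r \<in> R" "r' \<in> R" "q = (fst (snd r), J r)" "q' = (fst (snd r'), J r')"
              using r1 r2 Q by auto
            then have "r \<noteq> r'" using ne by blast
            with Jdis[OF r(1,2)] show "nonoverlapping (snd q) (snd q')" using r(3,4) by (simp add: nonoverlapping_def)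
          qed
        qed
        moreover have "fine_partition \<delta> \<pi>"
          unfolding fine_partition_def \<pi>_def
        proof clarify
          fix K t L s assume "(K, t, L) \<in> Q" and s: "s \<in> J (K, t, L)"
          then have "(t, L) \<in> p" using Q Rmem(2) by force
          from pf(1)[OF this] s show "s \<in> max_ball (fst (snd (K, t, L))) (\<delta> (fst (snd (K, t, L))))"
            by (auto simp: J_def)
        qed
        ultimately have less: "norm (\<Sum>(t, I)\<in>\<pi>. measure lebesgue I *\<^sub>R f t - F I) < 1" by (rule \<delta>(2))
        have "(\<Sum>r\<in>Q. measure lebesgue (J r) * g (fst (snd r)) - integral (J r) g)
            = (\<Sum>r\<in>Q. blinfun_apply x (measure lebesgue (J r) *\<^sub>R f (fst (snd r)) - F (J r)))"
        proof (rule sum.cong[OF refl])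
          fix r assume "r \<in> Q"
          then have "integral (J r) g = blinfun_apply x (F (J r))"
            using Q JU prim integral_unique by blast
          then show "measure lebesgue (J r) * g (fst (snd r)) - integral (J r) g
              = blinfun_apply x (measure lebesgue (J r) *\<^sub>R f (fst (snd r)) - F (J r))"
            by (simp add: blinfun.diff_right blinfun.scaleR_right g_def)
        qed
        also have "\<dots> = blinfun_apply x (\<Sum>(t, I)\<in>\<pi>. measure lebesgue I *\<^sub>R f t - F I)"
          unfolding \<pi>_def using inj_on_subset[OF inj Q] by (simp add: sum.reindex blinfun.sum_right)
        also have "norm \<dots> \<le> norm x * norm (\<Sum>(t, I)\<in>\<pi>. measure lebesgue I *\<^sub>R f t - F I)"
          by (rule norm_blinfun)
        also have "\<dots> \<le> norm x * 1" using less by (intro mult_left_mono) auto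
        finally show ?thesis by simp
      qed
      have 1: "(\<Sum>r\<in>R. \<bar>measure lebesgue (J r) * g (fst (snd r)) - integral (J r) g\<bar>) \<le> 2 * norm x"
        using sum_norm_allsubsets_bound[OF finR sub] by simp
      have 2: "(\<Sum>r\<in>R. measure lebesgue (J r) * \<bar>g (fst (snd r))\<bar>) \<le> (\<Sum>(t, L)\<in>p. measure lebesgue L * \<bar>g t\<bar>)"
      proof -
        have "(\<Sum>r\<in>R. measure lebesgue (J r) * \<bar>g (fst (snd r))\<bar>)
            \<le> (\<Sum>r\<in>d \<times> p. measure lebesgue (J r) * \<bar>g (fst (snd r))\<bar>)"
          using Dd(1) P(1) by (intro sum_mono2) (auto simp: R_def)
        also have "\<dots> = (\<Sum>K\<in>d. \<Sum>q\<in>p. measure lebesgue (K \<inter> snd q) * \<bar>g (fst q)\<bar>)"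
          by (simp add: sum.cartesian_product J_def case_prod_beta)
        also have "\<dots> = (\<Sum>q\<in>p. (\<Sum>K\<in>d. measure lebesgue (K \<inter> snd q)) * \<bar>g (fst q)\<bar>)"
          by (subst sum.swap) (simp add: sum_distrib_right)
        also have "\<dots> \<le> (\<Sum>q\<in>p. measure lebesgue (snd q) * \<bar>g (fst q)\<bar>)"
        proof (rule sum_mono, rule mult_right_mono)
          fix q assume q: "q \<in> p"
          have lm: "K \<inter> snd q \<in> lmeasurable" if "K \<in> d" for K using Kbox[OF that q] by auto
          have "measure lebesgue (\<Union>K\<in>d. K \<inter> snd q) = (\<Sum>K\<in>d. measure lebesgue (K \<inter> snd q))"
          proof (rule measure_negligible_finite_Union_image[OF Dd(1) lm])
            show "pairwise (\<lambda>K K'. negligible (K \<inter> snd q \<inter> (K' \<inter> snd q))) d"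
              unfolding pairwise_def
            proof (intro ballI impI)
              fix K K' assume "K \<in> d" "K' \<in> d" "K \<noteq> K'"
              then have "negligible (K \<inter> K')" by (rule dneg)
              then show "negligible (K \<inter> snd q \<inter> (K' \<inter> snd q))" by (rule negligible_subset) auto
            qed
          qed
          moreover have "measure lebesgue (\<Union>K\<in>d. K \<inter> snd q) \<le> measure lebesgue (snd q)"
          proof (rule measure_mono_fmeasurable)
            show "(\<Union>K\<in>d. K \<inter> snd q) \<in> sets lebesgue"
              using Dd(1) lm fmeasurableD by (intro sets.finite_UN) blast+
            show "snd q \<in> lmeasurable" using pbox[OF q] by auto
          qed auto
          ultimately show "(\<Sum>K\<in>d. measure lebesgue (K \<inter> snd q)) \<le> measure lebesgue (snd q)" by simp
        qed simp
        finally show ?thesis by (simp add: case_prod_beta)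
      qed
      have "(\<Sum>K\<in>d. norm (integral K g)) \<le> (\<Sum>K\<in>d. \<Sum>q\<in>p. \<bar>integral (K \<inter> snd q) g\<bar>)"
        using Ksum by (intro sum_mono) (simp add: sum_abs)
      also have "\<dots> = (\<Sum>r\<in>d \<times> p. \<bar>integral (J r) g\<bar>)"
        by (simp add: sum.cartesian_product J_def case_prod_beta)
      also have "\<dots> = (\<Sum>r\<in>R. \<bar>integral (J r) g\<bar>)"
      proof (rule sum.mono_neutral_right)
        show "\<forall>r\<in>d \<times> p - R. \<bar>integral (J r) g\<bar> = 0"
        proof
          fix r assume r: "r \<in> d \<times> p - R"
          then obtain u v where "J r = cbox u v" using Kbox[of "fst r" "snd r"] by (auto simp: J_def)
          with r show "\<bar>integral (J r) g\<bar> = 0" by (auto simp: R_def J_def zero_less_measure_iff)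
        qed
      qed (use Dd(1) P(1) in \<open>auto simp: R_def\<close>)
      also have "\<dots> \<le> (\<Sum>r\<in>R. \<bar>measure lebesgue (J r) * g (fst (snd r)) - integral (J r) g\<bar>
          + measure lebesgue (J r) * \<bar>g (fst (snd r))\<bar>)"
      proof (rule sum_mono)
        fix r
        have "\<bar>measure lebesgue (J r) * g (fst (snd r))\<bar> = measure lebesgue (J r) * \<bar>g (fst (snd r))\<bar>"
          by (simp add: abs_mult)
        then show "\<bar>integral (J r) g\<bar> \<le> \<bar>measure lebesgue (J r) * g (fst (snd r)) - integral (J r) g\<bar>
          + measure lebesgue (J r) * \<bar>g (fst (snd r))\<bar>" by linarith
      qed
      also have "\<dots> \<le> B" using 1 2 by (simp add: sum.distrib B_def)
      finally show ?thesis .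
    qed
  qed
  then show ?thesis unfolding g_def .
qed

text \<open>Compact intervals inside the interior give no control near the boundary. The series
  condition does: off a finite union of such intervals all sums of \<open>F\<close> are bounded by
  1, which yields integrability on the open remainder.\<close>

lemma M_estimate_absolutely_integrable:
  fixes x :: "'x::banach \<Rightarrow>\<^sub>L real" and I0 :: "(real^'m) set"
  assumes I0: "I0 \<in> intervals" and F: "additive_interval_function I0 F"
    and series: "\<And>D. D \<in> divisions_in I0 \<Longrightarrow> series_convergent F D I0"
    and est: "\<And>e. 0 < e \<Longrightarrow> \<exists>\<delta>. gauge_on (interior I0) \<delta> \<and> (\<forall>\<pi>. M_partition (interior I0) \<pi> \<longrightarrow> fine_partition \<delta> \<pi> \<longrightarrow>
        norm (\<Sum>(t, I)\<in>\<pi>. measure lebesgue I *\<^sub>R f t - F I) < e)"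
  shows "(\<lambda>t. blinfun_apply x (f t)) absolutely_integrable_on I0"
proof -
  let ?U = "interior I0" and ?g = "\<lambda>t. blinfun_apply x (f t)"
  have box: "?g absolutely_integrable_on cbox a b" if "cbox a b \<subseteq> ?U" for a b
    by (rule M_estimate_absolutely_integrable_interval[OF F interior_subset est that])
  have prim: "integral I ?g = blinfun_apply x (F I)" if "I \<in> intervals_in ?U" for I
    by (rule integral_unique, rule primitive_has_integral[OF F interior_subset M_estimate_imp_HK_estimate[OF est] that])
  have "\<exists>G. finite G \<and> G \<subseteq> intervals_in ?U \<and>
    (\<forall>C. finite C \<longrightarrow> C \<subseteq> intervals_in (?U - \<Union>G) \<longrightarrow> pairwise nonoverlapping C \<longrightarrow> norm (sum F C) \<le> 1)"
    by (rule additive_sum_extraction[OF series interior_subset order_refl]) auto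
  then obtain G where G: "finite G" "G \<subseteq> intervals_in ?U"
    and bd: "\<And>C. finite C \<Longrightarrow> C \<subseteq> intervals_in (?U - \<Union>G) \<Longrightarrow> pairwise nonoverlapping C \<Longrightarrow> norm (sum F C) \<le> 1"
    by (elim exE conjE) metis
  have Gint: "K \<in> intervals" "K \<subseteq> ?U" if "K \<in> G" for K using G(2) that by (auto simp: intervals_in_def)
  have "compact (\<Union>G)" using G(1) Gint interval_compact by (intro compact_Union) auto
  then have op: "open (?U - \<Union>G)" by (intro open_Diff) (auto intro: compact_imp_closed)
  have 1: "?g absolutely_integrable_on ?U - \<Union>G"
  proof (rule absolutely_integrable_open_bounded_sums(1)[OF op])
    show "?g absolutely_integrable_on cbox a b" if "cbox a b \<subseteq> ?U - \<Union>G" for a b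
      using that by (intro box) auto
  next
    fix C assume C: "finite C" "C \<subseteq> intervals_in (?U - \<Union>G)" "pairwise nonoverlapping C"
    have "(\<Sum>K\<in>C. integral K ?g) = (\<Sum>K\<in>C. blinfun_apply x (F K))"
      using C(2) by (intro sum.cong refl prim) (auto simp: intervals_in_def)
    also have "\<dots> = blinfun_apply x (sum F C)" by (simp add: blinfun.sum_right)
    also have "\<bar>\<dots>\<bar> \<le> norm x * norm (sum F C)" using norm_blinfun[of x "sum F C"] by simp
    also have "\<dots> \<le> norm x * 1" using bd[OF C] by (intro mult_left_mono) auto
    finally show "\<bar>\<Sum>K\<in>C. integral K ?g\<bar> \<le> norm x * 1" .
  qed
  have 2: "?g absolutely_integrable_on (\<Union>K\<in>G. K)"
  proof (rule set_integrable_UN[OF G(1)])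
    fix K assume K: "K \<in> G"
    show "K \<in> sets lebesgue" using interval_lmeasurable[OF Gint(1)[OF K]] by (rule fmeasurableD)
    obtain a b where ab: "K = cbox a b" using Gint(1)[OF K] by (rule intervalsE)
    show "?g absolutely_integrable_on K" using Gint(2)[OF K] unfolding ab by (rule box)
  qed
  have "(?U - \<Union>G) \<union> (\<Union>K\<in>G. K) = ?U" using Gint(2) by auto
  moreover have "?U - \<Union>G \<in> sets lebesgue" using op by simp
  moreover have "(\<Union>K\<in>G. K) \<in> sets lebesgue"
    using G(1) Gint(1) interval_lmeasurable by (intro sets.finite_UN) auto
  ultimately have "?g absolutely_integrable_on ?U"
    using set_integrable_Un[OF 1 2] by simp
  then show ?thesis
  proof (rule absolutely_integrable_spike_set)
    \<comment> \<open>The values of \<open>f\<close> on the boundary are unrestricted by the gauge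
      estimate, but they occur only on a null set.\<close>
    have "negligible (frontier I0)"
      using I0 by (auto elim!: intervalsE intro!: negligible_convex_frontier)
    then show "negligible {t \<in> I0 - ?U. ?g t \<noteq> 0}"
      by (rule negligible_subset) (auto simp: frontier_def closure_subset[THEN subsetD])
    have "{t \<in> ?U - I0. ?g t \<noteq> 0} = {}" using interior_subset[of I0] by auto
    then show "negligible {t \<in> ?U - I0. ?g t \<noteq> 0}" by (simp only: negligible_empty)
  qed
qed

theorem theorem3p9:
  fixes I0 :: "(real^'m) set"
    and f :: "real^'m \<Rightarrow> 'x::banach"
    and F :: "(real^'m) set \<Rightarrow> 'x"
  assumes "I0 \<in> intervals"
    and "additive_interval_function I0 F"
  shows "(Dunford_integrable I0 f \<and> Dunford_Henstock_Kurzweil_integrable I0 f F)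
    \<longleftrightarrow> Dunford_McShane_integrable I0 f F"
proof
  assume L: "Dunford_integrable I0 f \<and> Dunford_Henstock_Kurzweil_integrable I0 f F"
  then have HK: "\<exists>\<delta>. gauge_on (interior I0) \<delta> \<and> (\<forall>\<pi>. HK_partition (interior I0) \<pi> \<longrightarrow>
      fine_partition \<delta> \<pi> \<longrightarrow> norm (\<Sum>(t, I)\<in>\<pi>. measure lebesgue I *\<^sub>R f t - F I) < e)" if "0 < e" for e
    using that unfolding Dunford_Henstock_Kurzweil_integrable_def Dunford_gauge_integrable_def by blast
  have DF: "Dunford_function I0 F"
    using L unfolding Dunford_Henstock_Kurzweil_integrable_def Dunford_gauge_integrable_def by blast
  \<comment> \<open>Dunford integrability supplies \<open>scalar_integrable\<close>; the
    Henstock-Kurzweil estimate serves here only to identify \<open>F\<close> as the scalar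
    primitive.\<close>
  interpret Dunford_primitive I0 f F
  proof
    show "(\<lambda>t. blinfun_apply x (f t)) absolutely_integrable_on interior I0" for x :: "'x \<Rightarrow>\<^sub>L real"
    proof (rule set_integrable_subset)
      show "(\<lambda>t. blinfun_apply x (f t)) absolutely_integrable_on I0"
        using L unfolding Dunford_integrable_def by blast
    qed (auto simp: interior_subset)
    show "series_convergent F D J" if "D \<in> divisions_in I0" "J \<in> intervals" for D J
      using DF that unfolding Dunford_function_def by blast
    show "integral I (\<lambda>t. blinfun_apply x (f t)) = blinfun_apply x (F I)"
      if "I \<in> intervals_in (interior I0)" for x :: "'x \<Rightarrow>\<^sub>L real" and I
      by (rule integral_unique, rule primitive_has_integral[OF assms(2) interior_subset HK that])
  qed (fact assms)+
  show "Dunford_McShane_integrable I0 f F"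
    unfolding Dunford_McShane_integrable_def Dunford_gauge_integrable_def
    using M_estimate[OF HK] DF M_negligible_variation by blast
next
  assume R: "Dunford_McShane_integrable I0 f F"
  then have M: "\<exists>\<delta>. gauge_on (interior I0) \<delta> \<and> (\<forall>\<pi>. M_partition (interior I0) \<pi> \<longrightarrow>
      fine_partition \<delta> \<pi> \<longrightarrow> norm (\<Sum>(t, I)\<in>\<pi>. measure lebesgue I *\<^sub>R f t - F I) < e)" if "0 < e" for e
    using that unfolding Dunford_McShane_integrable_def Dunford_gauge_integrable_def by blast
  have DF: "Dunford_function I0 F"
    using R unfolding Dunford_McShane_integrable_def Dunford_gauge_integrable_def by blast
  have conv: "series_convergent F D I0" if "D \<in> divisions_in I0" for D
    using DF that assms(1) unfolding Dunford_function_def by blast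
  have "Dunford_integrable I0 f"
    unfolding Dunford_integrable_def
    by (intro allI M_estimate_absolutely_integrable[OF assms conv M])
  moreover have "negligible_variation HK_partition I0 F (UNIV - interior I0)"
    using R unfolding Dunford_McShane_integrable_def Dunford_gauge_integrable_def
    by (intro M_negligible_variation_imp_HK) blast
  ultimately show "Dunford_integrable I0 f \<and> Dunford_Henstock_Kurzweil_integrable I0 f F"
    unfolding Dunford_Henstock_Kurzweil_integrable_def Dunford_gauge_integrable_def
    using M_estimate_imp_HK_estimate[OF M] DF by blast
qed

end
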